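(* Consider the anisotropic XY chain on $\mathbb{Z}$ with real sequences $(\mu_j)_{j\in\mathbb{Z}}$, $(\gamma_j)_{j\in\mathbb{Z}}$, $(\nu_j)_{j\in\mathbb{Z}}$, $\mu_j\ne0$ for all $j$. Let $C,\eta>0$ be fixed constants, independent of $\Lambda$ and of the pair of observables, and suppose that the Lieb–Robinson bound holds for all $\Lambda$ with the constants $C$, $\eta$ and velocity $v=0$: for every $\Lambda=[m,n]\cap\mathbb{Z}$, every pair $A,B\in\mathcal{A}_\Lambda$ with $S_1=\operatorname{supp}A$, $S_2=\operatorname{supp}B$ and $\max S_1<\min S_2$, and every $t\in\mathbb{R}$, $$\|[\tau^{(\Lambda)}_t(A),B]\|\le C\|A\|\,\|B\|\,e^{-\eta\, d(S_1,S_2)}.$$ Then the associated one-particle Hamiltonian $M^{(\infty)}$ exhibits uniform dynamical localization, that is, $$\sup_{t\in\mathbb{R}}\big|M^{(\infty)}_{l,r}(t)\big|\le Ce^{-\eta(r-l)}\quad\text{for all } l<r \text{ in } \mathbb{Z},$$ where $M^{(\infty)}_{l,r}(t)$ is the $(l,r)$ matrix entry of $M^{(\infty)}(t)=e^{-itM^{(\infty)}}$.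
   Context: For finite $S\subset\mathbb{Z}$, $\mathcal{A}_S=\bigotimes_{j\in S}M(2,\mathbb{C})$ acts on $\bigotimes_{j\in S}\mathbb{C}^2$; for $S_1\subset S_2$ one views $\mathcal{A}_{S_1}\subset\mathcal{A}_{S_2}$ via $A\mapsto A\otimes\mathbb{I}_{S_2\setminus S_1}$. $\operatorname{supp}A$ is the smallest $S$ with $A\in\mathcal{A}_S$. For $\Lambda=[m,n]\cap\mathbb{Z}$, the XY Hamiltonian is $$H^{(\Lambda)}=\sum_{j=m}^{n-1}\mu_j\big[(1+\gamma_j)\sigma^{(x)}_j\sigma^{(x)}_{j+1}+(1-\gamma_j)\sigma^{(y)}_j\sigma^{(y)}_{j+1}\big]+\sum_{j=m}^n\nu_j\sigma^{(z)}_j,$$ with $\sigma^{(x)},\sigma^{(y)},\sigma^{(z)}$ the Pauli matrices, the subscript $j$ meaning acting on the $j$-th tensor factor. $\tau^{(\Lambda)}_t(A)=e^{itH^{(\Lambda)}}Ae^{-itH^{(\Lambda)}}$, and $d(S_1,S_2)=\min_{(i,j)\in S_1\times S_2}|i-j|$. The associated one-particle Hamiltonian $M^{(\infty)}$ is the infinite block tridiagonal matrix, viewed as an operator on $\ell^2(\mathbb{Z})$ with canonical basis $\{\delta_k\}_{k\in\mathbb{Z}}$, with $2\times2$ blocks indexed by sites $j\in\mathbb{Z}$, site $j$ corresponding to the basis vectors $\delta_{2j-1},\delta_{2j}$: the diagonal block at site $j$ is $J_j=2\begin{pmatrix}\nu_j&0\\0&-\nu_j\end{pmatrix}$, the block at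 sites $(j-1,j)$ is $\Gamma_j=2\begin{pmatrix}-\mu_{j-1}&-\mu_{j-1}\gamma_{j-1}\\ \mu_{j-1}\gamma_{j-1}&\mu_{j-1}\end{pmatrix}$, the block at sites $(j,j-1)$ is $\Gamma_j^*$ (the transpose), and all other blocks vanish. $M^{(\infty)}_{a,b}(t)=\langle\delta_a,e^{-itM^{(\infty)}}\delta_b\rangle$.
   Formalization: Here l and r are sites: the bound holds for all four scalar entries of the 2×2 block (l,r), since with scalar indices the exponent r−l would be about twice the site distance and the claim false; M^(∞) is assumed self-adjoint on its maximal domain, so that e^{-itM} is defined for unbounded sequences. *)

theory Defs
  imports "HOL-Analysis.Analysis"
begin

section \<open>The XY chain on finite sets of sites\<close>

text \<open>The canonical basis of the tensor product of copies of \<open>\<complex>\<^sup>2\<close> over the sites in \<open>S\<close> is indexed by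
  the maps \<open>S \<rightarrow> {1, 2}\<close>: the map \<open>s\<close> stands for the product of the canonical basis
  vectors with index \<open>s j\<close>, \<open>j \<in> S\<close>.  An element of \<open>\<A>\<^sub>S\<close> is the matrix of an
  operator in this basis, extended by 0 to indices that are not configurations on \<open>S\<close>.\<close>

type_synonym configuration = "int \<Rightarrow> 2"
type_synonym spin_op = "configuration \<Rightarrow> configuration \<Rightarrow> complex"

definition config :: "int set \<Rightarrow> configuration set" where
  "config S = (S \<rightarrow>\<^sub>E UNIV)"

definition spin_alg :: "int set \<Rightarrow> spin_op set" where
  "spin_alg S = {A. \<forall>s s'. A s s' \<noteq> 0 \<longrightarrow> s \<in> config S \<and> s' \<in> config S}"

definition op_id :: "int set \<Rightarrow> spin_op" where
  "op_id S = (\<lambda>s s'. if s \<in> config S \<and> s = s' then 1 else 0)"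

definition op_mult :: "int set \<Rightarrow> spin_op \<Rightarrow> spin_op \<Rightarrow> spin_op" where
  "op_mult S A B = (\<lambda>s s''. \<Sum>s'\<in>config S. A s s' * B s' s'')"

definition op_commutator :: "int set \<Rightarrow> spin_op \<Rightarrow> spin_op \<Rightarrow> spin_op" where
  "op_commutator S A B = (\<lambda>s s'. op_mult S A B s s' - op_mult S B A s s')"

definition op_scale :: "complex \<Rightarrow> spin_op \<Rightarrow> spin_op" where
  "op_scale c A = (\<lambda>s s'. c * A s s')"

definition op_exp :: "int set \<Rightarrow> spin_op \<Rightarrow> spin_op" where
  "op_exp S A = (\<lambda>s s'. \<Sum>n. ((op_mult S A ^^ n) (op_id S)) s s' / fact n)"

definition op_apply :: "int set \<Rightarrow> spin_op \<Rightarrow> (configuration \<Rightarrow> complex) \<Rightarrow> configuration \<Rightarrow> complex" where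
  "op_apply S A v = (\<lambda>s. \<Sum>s'\<in>config S. A s s' * v s')"

definition vec_norm :: "int set \<Rightarrow> (configuration \<Rightarrow> complex) \<Rightarrow> real" where
  "vec_norm S v = L2_set (\<lambda>s. cmod (v s)) (config S)"

definition op_norm :: "int set \<Rightarrow> spin_op \<Rightarrow> real" where
  "op_norm S A = (SUP v\<in>{v. vec_norm S v \<le> 1}. vec_norm S (op_apply S A v))"

text \<open>The inclusion of \<open>\<A>\<^sub>S\<close> in \<open>\<A>\<^sub>\<Lambda>\<close> for \<open>S \<subseteq> \<Lambda>\<close>: tensoring with the identity on \<open>\<Lambda> - S\<close>.\<close>

definition op_embed :: "int set \<Rightarrow> int set \<Rightarrow> spin_op \<Rightarrow> spin_op" where
  "op_embed S \<Lambda> A = (\<lambda>s s'.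
     if s \<in> config \<Lambda> \<and> s' \<in> config \<Lambda> \<and> (\<forall>j\<in>\<Lambda> - S. s j = s' j)
     then A (restrict s S) (restrict s' S) else 0)"

definition op_supp :: "int set \<Rightarrow> spin_op \<Rightarrow> int set" where
  "op_supp \<Lambda> A = (LEAST S. S \<subseteq> \<Lambda> \<and> A \<in> op_embed S \<Lambda> ` spin_alg S)"

definition site_op :: "int set \<Rightarrow> int \<Rightarrow> complex ^ 2 ^ 2 \<Rightarrow> spin_op" where
  "site_op \<Lambda> j a = (\<lambda>s s'.
     if s \<in> config \<Lambda> \<and> s' \<in> config \<Lambda> \<and> (\<forall>i\<in>\<Lambda> - {j}. s i = s' i)
     then a $ s j $ s' j else 0)"

definition pauli_x :: "complex ^ 2 ^ 2" where
  "pauli_x = vector [vector [0, 1], vector [1, 0]]"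

definition pauli_y :: "complex ^ 2 ^ 2" where
  "pauli_y = vector [vector [0, - \<i>], vector [\<i>, 0]]"

definition pauli_z :: "complex ^ 2 ^ 2" where
  "pauli_z = vector [vector [1, 0], vector [0, - 1]]"

definition xy_hamiltonian ::
  "(int \<Rightarrow> real) \<Rightarrow> (int \<Rightarrow> real) \<Rightarrow> (int \<Rightarrow> real) \<Rightarrow> int \<Rightarrow> int \<Rightarrow> spin_op" where
  "xy_hamiltonian \<mu> \<gamma> \<nu> m n = (\<lambda>s s'.
     (\<Sum>j\<in>{m..n-1}. of_real (\<mu> j) *
        (of_real (1 + \<gamma> j) *
           op_mult {m..n} (site_op {m..n} j pauli_x) (site_op {m..n} (j+1) pauli_x) s s' +
         of_real (1 - \<gamma> j) *
           op_mult {m..n} (site_op {m..n} j pauli_y) (site_op {m..n} (j+1) pauli_y) s s')) +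
     (\<Sum>j\<in>{m..n}. of_real (\<nu> j) * site_op {m..n} j pauli_z s s'))"

definition heisenberg ::
  "(int \<Rightarrow> real) \<Rightarrow> (int \<Rightarrow> real) \<Rightarrow> (int \<Rightarrow> real) \<Rightarrow> int \<Rightarrow> int \<Rightarrow> real \<Rightarrow> spin_op \<Rightarrow> spin_op" where
  "heisenberg \<mu> \<gamma> \<nu> m n t A =
     op_mult {m..n}
       (op_mult {m..n} (op_exp {m..n} (op_scale (\<i> * of_real t) (xy_hamiltonian \<mu> \<gamma> \<nu> m n))) A)
       (op_exp {m..n} (op_scale (- \<i> * of_real t) (xy_hamiltonian \<mu> \<gamma> \<nu> m n)))"

definition set_distance :: "int set \<Rightarrow> int set \<Rightarrow> int" where
  "set_distance S1 S2 = Min ((\<lambda>(i, j). \<bar>i - j\<bar>) ` (S1 \<times> S2))"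

text \<open>Multiples of the identity have empty support; they commute with everything, so the
  non-emptiness conditions, which give meaning to \<open>Max\<close>, \<open>Min\<close> and the
  distance, exclude nothing but trivial cases.\<close>

definition zero_velocity_LR ::
  "(int \<Rightarrow> real) \<Rightarrow> (int \<Rightarrow> real) \<Rightarrow> (int \<Rightarrow> real) \<Rightarrow> real \<Rightarrow> real \<Rightarrow> bool" where
  "zero_velocity_LR \<mu> \<gamma> \<nu> C \<eta> \<longleftrightarrow>
     (\<forall>m n. \<forall>A\<in>spin_alg {m..n}. \<forall>B\<in>spin_alg {m..n}. \<forall>t::real.
        let S1 = op_supp {m..n} A; S2 = op_supp {m..n} B in
          S1 \<noteq> {} \<and> S2 \<noteq> {} \<and> Max S1 < Min S2 \<longrightarrow>
          op_norm {m..n} (op_commutator {m..n} (heisenberg \<mu> \<gamma> \<nu> m n t A) B)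
            \<le> C * op_norm {m..n} A * op_norm {m..n} B * exp (- \<eta> * real_of_int (set_distance S1 S2)))"


section \<open>Operators on square-summable sequences\<close>

definition ell2 :: "(int \<Rightarrow> complex) set" where
  "ell2 = {\<psi>. (\<lambda>k. (cmod (\<psi> k))\<^sup>2) summable_on UNIV}"

definition ell2_inner :: "(int \<Rightarrow> complex) \<Rightarrow> (int \<Rightarrow> complex) \<Rightarrow> complex" where
  "ell2_inner \<phi> \<psi> = (\<Sum>\<^sub>\<infinity>k. cnj (\<phi> k) * \<psi> k)"

definition ell2_norm :: "(int \<Rightarrow> complex) \<Rightarrow> real" where
  "ell2_norm \<psi> = sqrt (\<Sum>\<^sub>\<infinity>k. (cmod (\<psi> k))\<^sup>2)"

definition \<delta> :: "int \<Rightarrow> int \<Rightarrow> complex" where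
  "\<delta> k = (\<lambda>i. if i = k then 1 else 0)"

text \<open>A possibly unbounded operator is a domain \<open>D\<close> together with a map \<open>T\<close>, of which only the
  values on \<open>D\<close> matter.  The last clause says that \<open>T\<close> with domain \<open>D\<close> coincides
  with its adjoint.\<close>

definition self_adjoint ::
  "(int \<Rightarrow> complex) set \<Rightarrow> ((int \<Rightarrow> complex) \<Rightarrow> (int \<Rightarrow> complex)) \<Rightarrow> bool" where
  "self_adjoint D T \<longleftrightarrow>
     D \<subseteq> ell2 \<and> T ` D \<subseteq> ell2 \<and>
     (\<forall>\<phi>\<in>ell2. \<forall>\<epsilon>>0. \<exists>\<psi>\<in>D. ell2_norm (\<lambda>k. \<phi> k - \<psi> k) < \<epsilon>) \<and>
     (\<forall>\<phi>\<in>ell2. \<forall>\<xi>\<in>ell2.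
        (\<forall>\<psi>\<in>D. ell2_inner \<phi> (T \<psi>) = ell2_inner \<xi> \<psi>) \<longleftrightarrow> \<phi> \<in> D \<and> T \<phi> = \<xi>)"

definition unitary_on_ell2 :: "((int \<Rightarrow> complex) \<Rightarrow> (int \<Rightarrow> complex)) \<Rightarrow> bool" where
  "unitary_on_ell2 V \<longleftrightarrow>
     V ` ell2 = ell2 \<and>
     (\<forall>\<phi>\<in>ell2. \<forall>\<psi>\<in>ell2. \<forall>c d.
        V (\<lambda>k. c * \<phi> k + d * \<psi> k) = (\<lambda>k. c * V \<phi> k + d * V \<psi> k)) \<and>
     (\<forall>\<phi>\<in>ell2. \<forall>\<psi>\<in>ell2. ell2_inner (V \<phi>) (V \<psi>) = ell2_inner \<phi> \<psi>)"

definition unitary_group :: "(real \<Rightarrow> (int \<Rightarrow> complex) \<Rightarrow> (int \<Rightarrow> complex)) \<Rightarrow> bool" where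
  "unitary_group U \<longleftrightarrow>
     (\<forall>t. unitary_on_ell2 (U t)) \<and>
     (\<forall>\<psi>\<in>ell2. U 0 \<psi> = \<psi> \<and> (\<forall>s t. U (s + t) \<psi> = U s (U t \<psi>)) \<and>
        ((\<lambda>t. ell2_norm (\<lambda>k. U t \<psi> k - \<psi> k)) \<longlongrightarrow> 0) (at 0))"

text \<open>For self-adjoint \<open>T\<close>, \<open>exp (- i t T)\<close> is the strongly continuous one-parameter
  unitary group with infinitesimal generator \<open>- i T\<close>, including equality of domains.  By Stone's
  theorem it exists and is unique on \<open>ell2\<close>; the choice only concerns the irrelevant values
  outside \<open>ell2\<close>.\<close>

definition exp_group ::
  "(int \<Rightarrow> complex) set \<Rightarrow> ((int \<Rightarrow> complex) \<Rightarrow> (int \<Rightarrow> complex)) \<Rightarrow>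
     real \<Rightarrow> (int \<Rightarrow> complex) \<Rightarrow> (int \<Rightarrow> complex)" where
  "exp_group D T = (SOME U. unitary_group U \<and>
     (\<forall>\<psi>\<in>ell2. \<forall>\<phi>\<in>ell2.
        \<psi> \<in> D \<and> T \<psi> = \<phi> \<longleftrightarrow>
        ((\<lambda>t. ell2_norm (\<lambda>k. (U t \<psi> k - \<psi> k) / of_real t - (- \<i>) * \<phi> k)) \<longlongrightarrow> 0) (at 0)))"


section \<open>The one-particle Hamiltonian\<close>

text \<open>The index \<open>2 * j - 1\<close> is component 1, and \<open>2 * j\<close> is component 2, of the
  block row (or column) of site \<open>j\<close>.\<close>

definition site :: "int \<Rightarrow> int" where
  "site a = (a + 1) div 2"

definition block_index :: "int \<Rightarrow> 2" where
  "block_index a = (if odd a then 1 else 2)"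

definition J_block :: "(int \<Rightarrow> real) \<Rightarrow> int \<Rightarrow> real ^ 2 ^ 2" where
  "J_block \<nu> j = 2 *\<^sub>R vector [vector [\<nu> j, 0], vector [0, - \<nu> j]]"

definition \<Gamma>_block :: "(int \<Rightarrow> real) \<Rightarrow> (int \<Rightarrow> real) \<Rightarrow> int \<Rightarrow> real ^ 2 ^ 2" where
  "\<Gamma>_block \<mu> \<gamma> j = 2 *\<^sub>R vector
     [vector [- \<mu> (j-1), - \<mu> (j-1) * \<gamma> (j-1)],
      vector [\<mu> (j-1) * \<gamma> (j-1), \<mu> (j-1)]]"

definition M_block ::
  "(int \<Rightarrow> real) \<Rightarrow> (int \<Rightarrow> real) \<Rightarrow> (int \<Rightarrow> real) \<Rightarrow> int \<Rightarrow> int \<Rightarrow> real ^ 2 ^ 2" where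
  "M_block \<mu> \<gamma> \<nu> i j =
     (if i = j then J_block \<nu> j
      else if i = j - 1 then \<Gamma>_block \<mu> \<gamma> j
      else if i = j + 1 then transpose (\<Gamma>_block \<mu> \<gamma> i)
      else 0)"

definition M_matrix ::
  "(int \<Rightarrow> real) \<Rightarrow> (int \<Rightarrow> real) \<Rightarrow> (int \<Rightarrow> real) \<Rightarrow> int \<Rightarrow> int \<Rightarrow> real" where
  "M_matrix \<mu> \<gamma> \<nu> a b = M_block \<mu> \<gamma> \<nu> (site a) (site b) $ block_index a $ block_index b"

text \<open>Each row of the matrix has finitely many nonzero entries, so the sum below is finite for
  every \<open>\<psi>\<close>.  The coefficients are not assumed to be bounded; the matrix acts on its maximal
  domain in \<open>ell2\<close>, which is all of \<open>ell2\<close> if they are.  This operator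
  is self-adjoint if and only if the matrix is essentially self-adjoint on the finitely
  supported sequences, and then it is the closure of the latter operator.\<close>

definition M_op ::
  "(int \<Rightarrow> real) \<Rightarrow> (int \<Rightarrow> real) \<Rightarrow> (int \<Rightarrow> real) \<Rightarrow> (int \<Rightarrow> complex) \<Rightarrow> (int \<Rightarrow> complex)" where
  "M_op \<mu> \<gamma> \<nu> \<psi> = (\<lambda>a. \<Sum>\<^sub>\<infinity>b. of_real (M_matrix \<mu> \<gamma> \<nu> a b) * \<psi> b)"

definition M_dom ::
  "(int \<Rightarrow> real) \<Rightarrow> (int \<Rightarrow> real) \<Rightarrow> (int \<Rightarrow> real) \<Rightarrow> (int \<Rightarrow> complex) set" where
  "M_dom \<mu> \<gamma> \<nu> = {\<psi>\<in>ell2. M_op \<mu> \<gamma> \<nu> \<psi> \<in> ell2}"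

definition M_entry ::
  "(int \<Rightarrow> real) \<Rightarrow> (int \<Rightarrow> real) \<Rightarrow> (int \<Rightarrow> real) \<Rightarrow> real \<Rightarrow> int \<Rightarrow> int \<Rightarrow> complex" where
  "M_entry \<mu> \<gamma> \<nu> t a b =
     ell2_inner (\<delta> a) (exp_group (M_dom \<mu> \<gamma> \<nu>) (M_op \<mu> \<gamma> \<nu>) t (\<delta> b))"

text \<open>In the decay estimate \<open>l\<close> and \<open>r\<close> are sites, as they are in the Lieb-Robinson
  bound from which it is derived, so that all four scalar entries of the block at sites
  \<open>(l, r)\<close> are bounded.  With \<open>l\<close> and \<open>r\<close> denoting scalar indices instead, the
  exponent would be about twice the distance of the sites.\<close>

definition uniform_dynamical_localization ::
  "(int \<Rightarrow> real) \<Rightarrow> (int \<Rightarrow> real) \<Rightarrow> (int \<Rightarrow> real) \<Rightarrow> real \<Rightarrow> real \<Rightarrow> bool" where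
  "uniform_dynamical_localization \<mu> \<gamma> \<nu> C \<eta> \<longleftrightarrow>
     (\<forall>l r. l < r \<longrightarrow>
        (\<forall>a\<in>{2*l-1, 2*l}. \<forall>b\<in>{2*r-1, 2*r}.
           (SUP t::real. ereal (cmod (M_entry \<mu> \<gamma> \<nu> t a b)))
             \<le> ereal (C * exp (- \<eta> * real_of_int (r - l)))))"

end

theory Submission
  imports Defs
begin

text \<open>The Jordan-Wigner operators \<open>c\<^sub>j\<close>, with strings extending from the left end of the
  chain up to \<open>j\<close>, evolve linearly under \<open>\<tau>\<^sub>t\<close>, with coefficients the entries of
  \<open>exp(-itM)\<close>.  The commutator of \<open>\<tau>\<^sub>t(c\<^sub>l)\<close> with \<open>\<sigma>\<^sup>z\<close> at site \<open>r\<close> isolates the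
  coefficients at \<open>r\<close>, and \<open>c\<^sub>l\<close> has support \<open>[m, l]\<close>, so that the Lieb-Robinson bound
  gives the decay of the finite-volume coefficients.

  These coefficients are bounded by 1 and, away from the boundary, satisfy the equations
  \<open>u' = -iMu\<close> in both indices.  By compactness they have a pointwise limit along some filter,
  whose rows are solutions of \<open>u' = -iMu\<close> that stay in the maximal domain.  Symmetry of \<open>M\<close>
  on this domain makes the inner product of two solutions constant in time.  It follows that
  the limit is the kernel of a unitary group generated by \<open>-iM\<close>, and that every such
  group has this kernel.\<close>

text \<open>The coefficients of M may be unbounded, so M enters only through its finite rows, entry
  by entry. The delicate point is that a pointwise limit must lie in the maximal domain of M. The
  two index equations settle this: at finite volume both express the derivative of the same entry,
  so in the limit M applied to row a equals the combination of the rows c with the finitely many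
  weights M(a,c). Since every row has norm at most 1, this is square-summable, with a norm bound
  that does not depend on time. That bound gives Lipschitz continuity in norm and weak
  differentiability, which is just enough for the product rule behind the conservation of inner
  products. The constant C survives unchanged: a Jordan-Wigner operator and a Pauli matrix have norm
  at most 1, the coefficient at b is an average of matrix entries of the evolved operator with
  weights of modulus 1, and each of these entries is dominated by an entry of the
  commutator.\<close>

text \<open>The mean value inequality over an unordered segment, so that increments of either sign
  are covered. With \<open>B = 0\<close> it turns a vanishing derivative into a conservation
  law.\<close>

lemma has_vector_derivative_bounded_increment:
  fixes f :: "real \<Rightarrow> 'a::real_normed_vector"
  assumes f': "\<And>s. s \<in> closed_segment a b \<Longrightarrow> (f has_vector_derivative f' s) (at s)"
    and B: "\<And>s. s \<in> closed_segment a b \<Longrightarrow> norm (f' s) \<le> B"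
  shows "norm (f b - f a) \<le> B * \<bar>b - a\<bar>"
proof -
  have "norm (f b - f a) \<le> B * norm (b - a)"
  proof (rule differentiable_bound[where S = "closed_segment a b" and f' = "\<lambda>s h. h *\<^sub>R f' s"])
    show "(f has_derivative (\<lambda>h. h *\<^sub>R f' s)) (at s within closed_segment a b)"
      if "s \<in> closed_segment a b" for s
      using f'[OF that] by (auto simp: has_vector_derivative_def intro: has_derivative_at_withinI)
    show "onorm (\<lambda>h. h *\<^sub>R f' s) \<le> B" if "s \<in> closed_segment a b" for s
      by (rule onorm_le) (use B[OF that] in \<open>simp add: mult.commute[of B] mult_left_mono\<close>)
  qed auto
  then show ?thesis by (simp add: real_norm_def)
qed

section \<open>Square-summable sequences\<close>

abbreviation cmod2_sum :: "(int \<Rightarrow> complex) \<Rightarrow> int set \<Rightarrow> real" where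
  "cmod2_sum \<psi> F \<equiv> (\<Sum>k\<in>F. (cmod (\<psi> k))\<^sup>2)"

lemma ell2_boundI:
  assumes "B \<ge> 0" "\<And>F. finite F \<Longrightarrow> cmod2_sum \<psi> F \<le> B\<^sup>2"
  shows "\<psi> \<in> ell2" "ell2_norm \<psi> \<le> B"
proof -
  have s: "(\<lambda>k. (cmod (\<psi> k))\<^sup>2) summable_on UNIV"
    by (rule nonneg_bdd_above_summable_on) (auto intro!: bdd_aboveI2[of _ _ "B\<^sup>2"] assms)
  then show "\<psi> \<in> ell2" by (simp add: ell2_def)
  have "(\<Sum>\<^sub>\<infinity>k. (cmod (\<psi> k))\<^sup>2) \<le> B\<^sup>2"
    by (rule infsum_le_finite_sums[OF s]) (auto intro: assms)
  then show "ell2_norm \<psi> \<le> B"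
    unfolding ell2_norm_def using assms(1) real_le_lsqrt by blast
qed

lemma ell2_norm_nonneg [simp]: "ell2_norm \<psi> \<ge> 0"
  by (simp add: ell2_norm_def infsum_nonneg)

lemma ell2_norm_sq: "(ell2_norm \<psi>)\<^sup>2 = (\<Sum>\<^sub>\<infinity>k. (cmod (\<psi> k))\<^sup>2)"
  by (simp add: ell2_norm_def infsum_nonneg)

lemma cmod2_sum_le:
  assumes "\<psi> \<in> ell2" "finite F"
  shows "cmod2_sum \<psi> F \<le> (ell2_norm \<psi>)\<^sup>2"
  unfolding ell2_norm_sq
  by (rule finite_sum_le_infsum) (use assms in \<open>auto simp: ell2_def\<close>)

lemma L2_set_le_ell2_norm:
  assumes "\<psi> \<in> ell2" "finite F"
  shows "L2_set (\<lambda>k. cmod (\<psi> k)) F \<le> ell2_norm \<psi>"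
  unfolding L2_set_def by (rule real_le_lsqrt) (use cmod2_sum_le[OF assms] in \<open>auto\<close>)

lemma cmod_le_ell2_norm:
  assumes "\<psi> \<in> ell2" shows "cmod (\<psi> k) \<le> ell2_norm \<psi>"
  using L2_set_le_ell2_norm[OF assms, of "{k}"] by simp

lemma ell2_boundI_L2_set:
  assumes "\<And>F. finite F \<Longrightarrow> L2_set (\<lambda>k. cmod (\<psi> k)) F \<le> B"
  shows "\<psi> \<in> ell2" "ell2_norm \<psi> \<le> B"
proof -
  have B: "B \<ge> 0" using assms[of "{}"] by simp
  have "cmod2_sum \<psi> F \<le> B\<^sup>2" if "finite F" for F
    using power_mono[OF assms[OF that] L2_set_nonneg, of 2]
    by (simp add: L2_set_def sum_nonneg)
  from ell2_boundI[OF B this] show "\<psi> \<in> ell2" "ell2_norm \<psi> \<le> B" by auto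
qed

lemma ell2_add:
  assumes "\<phi> \<in> ell2" "\<psi> \<in> ell2"
  shows "(\<lambda>k. \<phi> k + \<psi> k) \<in> ell2" "ell2_norm (\<lambda>k. \<phi> k + \<psi> k) \<le> ell2_norm \<phi> + ell2_norm \<psi>"
proof -
  have "L2_set (\<lambda>k. cmod (\<phi> k + \<psi> k)) F \<le> ell2_norm \<phi> + ell2_norm \<psi>" if "finite F" for F
  proof -
    have "L2_set (\<lambda>k. cmod (\<phi> k + \<psi> k)) F \<le> L2_set (\<lambda>k. cmod (\<phi> k) + cmod (\<psi> k)) F"
      by (rule L2_set_mono) (auto intro: norm_triangle_ineq)
    also have "\<dots> \<le> L2_set (\<lambda>k. cmod (\<phi> k)) F + L2_set (\<lambda>k. cmod (\<psi> k)) F"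
      by (rule L2_set_triangle_ineq)
    finally show ?thesis
      using L2_set_le_ell2_norm[OF assms(1) that] L2_set_le_ell2_norm[OF assms(2) that] by linarith
  qed
  from ell2_boundI_L2_set[OF this]
  show "(\<lambda>k. \<phi> k + \<psi> k) \<in> ell2" "ell2_norm (\<lambda>k. \<phi> k + \<psi> k) \<le> ell2_norm \<phi> + ell2_norm \<psi>"
    by auto
qed

lemma ell2_scale:
  assumes "\<psi> \<in> ell2"
  shows "(\<lambda>k. c * \<psi> k) \<in> ell2" "ell2_norm (\<lambda>k. c * \<psi> k) \<le> cmod c * ell2_norm \<psi>"
proof -
  have "L2_set (\<lambda>k. cmod (c * \<psi> k)) F \<le> cmod c * ell2_norm \<psi>" if "finite F" for F
    using L2_set_le_ell2_norm[OF assms that]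
    by (simp add: norm_mult mult_left_mono flip: L2_set_right_distrib)
  from ell2_boundI_L2_set[OF this]
  show "(\<lambda>k. c * \<psi> k) \<in> ell2" "ell2_norm (\<lambda>k. c * \<psi> k) \<le> cmod c * ell2_norm \<psi>" by auto
qed

lemma ell2_divide:
  assumes "\<psi> \<in> ell2"
  shows "(\<lambda>k. \<psi> k / c) \<in> ell2" "ell2_norm (\<lambda>k. \<psi> k / c) \<le> ell2_norm \<psi> / cmod c"
  using ell2_scale[OF assms, of "inverse c"] by (simp_all add: divide_inverse norm_inverse mult_ac)

lemma ell2_lincomb:
  assumes "\<phi> \<in> ell2" "\<psi> \<in> ell2"
  shows "(\<lambda>k. c * \<phi> k + d * \<psi> k) \<in> ell2"
  using ell2_add(1)[OF ell2_scale(1)[OF assms(1)] ell2_scale(1)[OF assms(2)]] .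

lemma ell2_diff:
  assumes "\<phi> \<in> ell2" "\<psi> \<in> ell2"
  shows "(\<lambda>k. \<phi> k - \<psi> k) \<in> ell2" "ell2_norm (\<lambda>k. \<phi> k - \<psi> k) \<le> ell2_norm \<phi> + ell2_norm \<psi>"
proof -
  have m: "(\<lambda>k. - 1 * \<psi> k) \<in> ell2" "ell2_norm (\<lambda>k. - 1 * \<psi> k) \<le> ell2_norm \<psi>"
    using ell2_scale[OF assms(2), of "-1"] by auto
  show "(\<lambda>k. \<phi> k - \<psi> k) \<in> ell2" "ell2_norm (\<lambda>k. \<phi> k - \<psi> k) \<le> ell2_norm \<phi> + ell2_norm \<psi>"
    using ell2_add[OF assms(1) m(1)] m(2) by simp_all
qed

lemma ell2_zero: "(\<lambda>k. 0) \<in> ell2"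
  by (simp add: ell2_def)

lemma ell2_sum:
  assumes "finite F" "\<And>i. i \<in> F \<Longrightarrow> f i \<in> ell2"
  shows "(\<lambda>k. \<Sum>i\<in>F. f i k) \<in> ell2" "ell2_norm (\<lambda>k. \<Sum>i\<in>F. f i k) \<le> (\<Sum>i\<in>F. ell2_norm (f i))"
proof -
  have "(\<lambda>k. \<Sum>i\<in>F. f i k) \<in> ell2 \<and> ell2_norm (\<lambda>k. \<Sum>i\<in>F. f i k) \<le> (\<Sum>i\<in>F. ell2_norm (f i))"
    using assms
  proof (induction F rule: finite_induct)
    case empty
    then show ?case by (simp add: ell2_zero ell2_norm_def)
  next
    case (insert x F)
    then show ?case
      using ell2_add[of "f x" "\<lambda>k. \<Sum>i\<in>F. f i k"] by (auto intro: order_trans)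
  qed
  then show "(\<lambda>k. \<Sum>i\<in>F. f i k) \<in> ell2" "ell2_norm (\<lambda>k. \<Sum>i\<in>F. f i k) \<le> (\<Sum>i\<in>F. ell2_norm (f i))"
    by auto
qed

lemma finite_support_ell2:
  assumes "finite F" "\<And>k. k \<notin> F \<Longrightarrow> \<psi> k = 0"
  shows "\<psi> \<in> ell2" "ell2_norm \<psi> = L2_set (\<lambda>k. cmod (\<psi> k)) F"
proof -
  have "((\<lambda>k. (cmod (\<psi> k))\<^sup>2) has_sum cmod2_sum \<psi> F) UNIV"
    using has_sum_finite[OF assms(1), of "\<lambda>k. (cmod (\<psi> k))\<^sup>2"]
    by (rule has_sum_cong_neutral[THEN iffD1, rotated -1]) (use assms in auto)
  then show "\<psi> \<in> ell2" "ell2_norm \<psi> = L2_set (\<lambda>k. cmod (\<psi> k)) F"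
    by (auto simp: ell2_def ell2_norm_def L2_set_def summable_on_def dest: infsumI)
qed

lemma \<delta>_ell2 [simp]: "\<delta> a \<in> ell2" and ell2_norm_\<delta> [simp]: "ell2_norm (\<delta> a) = 1"
  using finite_support_ell2[of "{a}" "\<delta> a"] by (auto simp: \<delta>_def)

lemma ell2_inner_abs_summable:
  assumes "\<phi> \<in> ell2" "\<psi> \<in> ell2"
  shows "(\<lambda>k. norm (cnj (\<phi> k) * \<psi> k)) summable_on UNIV"
  by (rule abs_summable_product)
    (use assms in \<open>simp_all add: ell2_def norm_mult power2_eq_square\<close>)

lemma ell2_inner_summable:
  assumes "\<phi> \<in> ell2" "\<psi> \<in> ell2"
  shows "(\<lambda>k. cnj (\<phi> k) * \<psi> k) summable_on UNIV"
  using abs_summable_summable[OF ell2_inner_abs_summable[OF assms]] .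

lemma ell2_Cauchy_Schwarz:
  assumes "\<phi> \<in> ell2" "\<psi> \<in> ell2"
  shows "cmod (ell2_inner \<phi> \<psi>) \<le> ell2_norm \<phi> * ell2_norm \<psi>"
proof -
  have "(\<Sum>k\<in>F. norm (cnj (\<phi> k) * \<psi> k)) \<le> ell2_norm \<phi> * ell2_norm \<psi>" if "finite F" for F
  proof -
    have "(\<Sum>k\<in>F. norm (cnj (\<phi> k) * \<psi> k)) \<le> L2_set (\<lambda>k. cmod (\<phi> k)) F * L2_set (\<lambda>k. cmod (\<psi> k)) F"
      using L2_set_mult_ineq[of "\<lambda>k. cmod (\<phi> k)" "\<lambda>k. cmod (\<psi> k)" F] by (simp add: norm_mult)
    also have "\<dots> \<le> ell2_norm \<phi> * ell2_norm \<psi>"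
      by (intro mult_mono L2_set_le_ell2_norm assms that) auto
    finally show ?thesis .
  qed
  then have "(\<Sum>\<^sub>\<infinity>k. norm (cnj (\<phi> k) * \<psi> k)) \<le> ell2_norm \<phi> * ell2_norm \<psi>"
    by (intro infsum_le_finite_sums ell2_inner_abs_summable assms)
  then show ?thesis
    using norm_infsum_bound[OF ell2_inner_abs_summable[OF assms]] by (simp add: ell2_inner_def)
qed

lemma ell2_inner_add_right:
  assumes "\<phi> \<in> ell2" "\<psi> \<in> ell2" "\<xi> \<in> ell2"
  shows "ell2_inner \<phi> (\<lambda>k. \<psi> k + \<xi> k) = ell2_inner \<phi> \<psi> + ell2_inner \<phi> \<xi>"
  using infsum_add[OF ell2_inner_summable[OF assms(1,2)] ell2_inner_summable[OF assms(1,3)]]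
  by (simp add: ell2_inner_def distrib_left)

lemma ell2_inner_scale_right: "ell2_inner \<phi> (\<lambda>k. c * \<psi> k) = c * ell2_inner \<phi> \<psi>"
  by (simp add: ell2_inner_def mult.left_commute[of _ c] infsum_cmult_right')

lemma ell2_inner_cnj: "cnj (ell2_inner \<phi> \<psi>) = ell2_inner \<psi> \<phi>"
  unfolding ell2_inner_def by (subst infsum_cnj[symmetric]) (simp add: mult.commute)

lemma ell2_inner_lincomb_right:
  assumes "\<phi> \<in> ell2" "\<psi> \<in> ell2" "\<xi> \<in> ell2"
  shows "ell2_inner \<phi> (\<lambda>k. c * \<psi> k + d * \<xi> k) = c * ell2_inner \<phi> \<psi> + d * ell2_inner \<phi> \<xi>"
  using ell2_inner_add_right[OF assms(1) ell2_scale(1)[OF assms(2)] ell2_scale(1)[OF assms(3)]]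
  by (simp add: ell2_inner_scale_right)

lemma ell2_inner_diff_right:
  assumes "\<phi> \<in> ell2" "\<psi> \<in> ell2" "\<xi> \<in> ell2"
  shows "ell2_inner \<phi> (\<lambda>k. \<psi> k - \<xi> k) = ell2_inner \<phi> \<psi> - ell2_inner \<phi> \<xi>"
  using ell2_inner_lincomb_right[OF assms, of 1 "-1"] by simp

lemma ell2_inner_diff_left:
  assumes "\<phi> \<in> ell2" "\<psi> \<in> ell2" "\<xi> \<in> ell2"
  shows "ell2_inner (\<lambda>k. \<phi> k - \<psi> k) \<xi> = ell2_inner \<phi> \<xi> - ell2_inner \<psi> \<xi>"
  using ell2_inner_diff_right[OF assms(3,1,2)] by (metis complex_cnj_diff ell2_inner_cnj)

lemma ell2_inner_scale_left: "ell2_inner (\<lambda>k. c * \<phi> k) \<psi> = cnj c * ell2_inner \<phi> \<psi>"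
  by (metis complex_cnj_mult ell2_inner_cnj ell2_inner_scale_right)

lemma ell2_inner_divide_right: "ell2_inner \<phi> (\<lambda>k. \<psi> k / c) = ell2_inner \<phi> \<psi> / c"
  using ell2_inner_scale_right[of \<phi> "inverse c" \<psi>] by (simp add: field_simps)

lemma ell2_inner_lincomb_left:
  assumes "finite F" "\<And>k. k \<in> F \<Longrightarrow> f k \<in> ell2" "\<psi> \<in> ell2"
  shows "ell2_inner (\<lambda>j. \<Sum>k\<in>F. c k * f k j) \<psi> = (\<Sum>k\<in>F. cnj (c k) * ell2_inner (f k) \<psi>)"
  using assms(1,2)
proof (induction F rule: finite_induct)
  case empty
  then show ?case by (simp add: ell2_inner_def)
next
  case (insert x F)
  have "ell2_inner (\<lambda>j. c x * f x j + 1 * (\<Sum>k\<in>F. c k * f k j)) \<psi>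
      = cnj (ell2_inner \<psi> (\<lambda>j. c x * f x j + 1 * (\<Sum>k\<in>F. c k * f k j)))"
    by (simp add: ell2_inner_cnj)
  also have "\<dots> = cnj (c x * ell2_inner \<psi> (f x) + 1 * ell2_inner \<psi> (\<lambda>j. \<Sum>k\<in>F. c k * f k j))"
    by (subst ell2_inner_lincomb_right) (intro assms ell2_sum(1) ell2_scale(1) insert | simp add: insert)+
  also have "\<dots> = cnj (c x) * ell2_inner (f x) \<psi> + (\<Sum>k\<in>F. cnj (c k) * ell2_inner (f k) \<psi>)"
    using insert by (simp add: ell2_inner_cnj)
  finally show ?case using insert by simp
qed

lemma ell2_inner_self:
  assumes "\<psi> \<in> ell2"
  shows "ell2_inner \<psi> \<psi> = of_real ((ell2_norm \<psi>)\<^sup>2)"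
proof -
  have "((\<lambda>k. (cmod (\<psi> k))\<^sup>2) has_sum (ell2_norm \<psi>)\<^sup>2) UNIV"
    using assms by (simp add: ell2_norm_sq ell2_def)
  from infsumI[OF has_sum_of_real[OF this, where 'a = complex]] show ?thesis
    by (simp add: ell2_inner_def complex_norm_square mult.commute del: of_real_power)
qed

lemma ell2_inner_finite_support:
  assumes "finite F" "\<And>k. k \<notin> F \<Longrightarrow> \<phi> k = 0"
  shows "ell2_inner \<phi> \<psi> = (\<Sum>k\<in>F. cnj (\<phi> k) * \<psi> k)"
proof -
  have "ell2_inner \<phi> \<psi> = infsum (\<lambda>k. cnj (\<phi> k) * \<psi> k) F"
    unfolding ell2_inner_def by (rule infsum_cong_neutral) (use assms in auto)
  then show ?thesis using assms by simp
qed

lemma ell2_inner_\<delta>_left [simp]: "ell2_inner (\<delta> a) \<psi> = \<psi> a"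
  using ell2_inner_finite_support[of "{a}" "\<delta> a"] by (auto simp: \<delta>_def)

lemma ell2_inner_\<delta>_right [simp]: "ell2_inner \<psi> (\<delta> a) = cnj (\<psi> a)"
  by (metis ell2_inner_\<delta>_left ell2_inner_cnj)

lemma ell2_truncation:
  assumes "\<psi> \<in> ell2" "\<epsilon> > 0"
  obtains F where "finite F" "ell2_norm (\<lambda>k. if k \<in> F then 0 else \<psi> k) < \<epsilon>"
    "(\<lambda>k. if k \<in> F then 0 else \<psi> k) \<in> ell2"
proof -
  let ?f = "\<lambda>k. (cmod (\<psi> k))\<^sup>2"
  have s: "?f summable_on UNIV" using assms by (simp add: ell2_def)
  \<comment> \<open>A partial sum within \<epsilon>-squared over 4 of the total leaves a tail of
    norm at most \<epsilon>/2, hence strictly below \<epsilon>.\<close>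
  have e: "\<epsilon>\<^sup>2/4 > 0" using assms by simp
  from tendstoD[OF infsum_tendsto[OF s] e] obtain F where
    F: "finite F" "dist (sum ?f F) (infsum ?f UNIV) < \<epsilon>\<^sup>2/4"
    unfolding eventually_finite_subsets_at_top by blast
  let ?g = "\<lambda>k. if k \<in> F then 0 else \<psi> k"
  have "cmod2_sum ?g G \<le> (\<epsilon>/2)\<^sup>2" if G: "finite G" for G
  proof -
    have "cmod2_sum ?g G = sum ?f (G - F)"
      by (rule sum.mono_neutral_cong_right) (use G in auto)
    also have "\<dots> = sum ?f (G \<union> F) - sum ?f F"
      using sum.union_disjoint[of "G - F" F ?f] G F by (simp add: Un_Diff_cancel2 Diff_Int_distrib2)
    also have "sum ?f (G \<union> F) \<le> infsum ?f UNIV"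
      by (rule finite_sum_le_infsum[OF s]) (use G F in auto)
    finally show ?thesis using F(2) by (simp add: dist_real_def power_divide) argo
  qed
  from ell2_boundI[OF _ this] have "?g \<in> ell2" "ell2_norm ?g \<le> \<epsilon>/2" using assms by auto
  then show ?thesis using that[OF F(1)] assms by auto
qed

text \<open>Norm-bounded coordinatewise convergence is weak convergence: on a finite set coordinates
  suffice, and outside it \<psi> has small norm while \<open>f x\<close> stays bounded. Difference
  quotients of solutions are handled in this way.\<close>

lemma ell2_inner_tendsto:
  fixes f :: "'a \<Rightarrow> int \<Rightarrow> complex"
  assumes G: "\<forall>\<^sub>F x in G. f x \<in> ell2 \<and> ell2_norm (f x) \<le> B"
    and c: "\<And>k. ((\<lambda>x. f x k) \<longlongrightarrow> g k) G" and g: "g \<in> ell2" and \<psi>: "\<psi> \<in> ell2"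
  shows "((\<lambda>x. ell2_inner \<psi> (f x)) \<longlongrightarrow> ell2_inner \<psi> g) G"
proof (rule tendstoI)
  fix e :: real assume e: "e > 0"
  \<comment> \<open>Bounds the norm of \<open>f x - g\<close>. The absolute value covers a negative
    \<open>B\<close>, and the summand 1 makes division by \<open>K\<close> safe.\<close>
  define K where "K = \<bar>B\<bar> + ell2_norm g + 1"
  have K: "K > 0" unfolding K_def using ell2_norm_nonneg[of g] by linarith
  obtain F where F: "finite F" "ell2_norm (\<lambda>k. if k \<in> F then 0 else \<psi> k) < e/2/K"
    "(\<lambda>k. if k \<in> F then 0 else \<psi> k) \<in> ell2"
    using ell2_truncation[OF \<psi>, of "e/2/K"] e K by auto
  let ?h = "\<lambda>k. if k \<in> F then 0 else \<psi> k"
  have "((\<lambda>x. \<Sum>k\<in>F. cnj (\<psi> k) * (f x k - g k)) \<longlongrightarrow> (\<Sum>k\<in>F. cnj (\<psi> k) * (g k - g k))) G"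
    by (intro tendsto_intros c)
  then have "\<forall>\<^sub>F x in G. cmod (\<Sum>k\<in>F. cnj (\<psi> k) * (f x k - g k)) < e/2"
    using e by (auto dest!: tendstoD[of _ _ _ "e/2"])
  with G show "\<forall>\<^sub>F x in G. dist (ell2_inner \<psi> (f x)) (ell2_inner \<psi> g) < e"
  proof eventually_elim
    case (elim x)
    let ?d = "\<lambda>k. f x k - g k"
    have d: "?d \<in> ell2" "ell2_norm ?d \<le> K"
      using ell2_diff[of "f x" g] elim(1) g by (auto simp: K_def)
    have t: "(\<lambda>k. if k \<in> F then \<psi> k else 0) \<in> ell2"
      using finite_support_ell2(1)[OF F(1)] by simp
    have "ell2_inner \<psi> (f x) - ell2_inner \<psi> g = ell2_inner \<psi> ?d"
      using ell2_inner_diff_right[OF \<psi> _ g] elim(1) by simp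
    also have "\<dots> = ell2_inner ?h ?d + ell2_inner (\<lambda>k. if k \<in> F then \<psi> k else 0) ?d"
    proof -
      have "(\<lambda>k. \<psi> k - (if k \<in> F then \<psi> k else 0)) = ?h" by auto
      then show ?thesis using ell2_inner_diff_left[OF \<psi> t d(1)] by simp
    qed
    also have "ell2_inner (\<lambda>k. if k \<in> F then \<psi> k else 0) ?d = (\<Sum>k\<in>F. cnj (\<psi> k) * (f x k - g k))"
      by (subst ell2_inner_finite_support[OF F(1)]) auto
    finally have "dist (ell2_inner \<psi> (f x)) (ell2_inner \<psi> g)
        \<le> cmod (ell2_inner ?h ?d) + cmod (\<Sum>k\<in>F. cnj (\<psi> k) * (f x k - g k))"
      by (simp add: dist_norm norm_triangle_ineq)
    also have "cmod (ell2_inner ?h ?d) \<le> ell2_norm ?h * ell2_norm ?d"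
      by (rule ell2_Cauchy_Schwarz[OF F(3) d(1)])
    also have "\<dots> \<le> e/2/K * K"
      using F(2) d(2) K e by (intro mult_mono) auto
    finally show ?case using elim(2) K by simp
  qed
qed

text \<open>Testing with \<psi> itself, cut off to \<open>F\<close>, bounds every finite partial
  norm. Membership in \<open>ell2\<close> is therefore part of the conclusion.\<close>

lemma ell2_dual_bound:
  assumes "B \<ge> 0" "\<And>\<xi> F. finite F \<Longrightarrow> (\<And>k. k \<notin> F \<Longrightarrow> \<xi> k = 0) \<Longrightarrow>
      cmod (\<Sum>k\<in>F. cnj (\<xi> k) * \<psi> k) \<le> B * ell2_norm \<xi>"
  shows "\<psi> \<in> ell2" "ell2_norm \<psi> \<le> B"
proof -
  have "L2_set (\<lambda>k. cmod (\<psi> k)) F \<le> B" if F: "finite F" for F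
  proof (cases "L2_set (\<lambda>k. cmod (\<psi> k)) F = 0")
    case False
    let ?\<xi> = "\<lambda>k. if k \<in> F then \<psi> k else 0"
    let ?L = "L2_set (\<lambda>k. cmod (\<psi> k)) F"
    have n: "ell2_norm ?\<xi> = ?L"
      using finite_support_ell2(2)[OF F, of ?\<xi>] by (simp cong: L2_set_cong)
    have "(\<Sum>k\<in>F. cnj (?\<xi> k) * \<psi> k) = of_real (cmod2_sum \<psi> F)"
      by (simp add: complex_norm_square mult.commute del: of_real_power)
    also have "cmod2_sum \<psi> F = ?L * ?L"
      by (simp add: L2_set_def sum_nonneg flip: power2_eq_square)
    finally have "?L * ?L \<le> B * ?L"
      using assms(2)[OF F, of ?\<xi>] n by (simp add: norm_mult)
    then show ?thesis using False L2_set_nonneg[of "\<lambda>k. cmod (\<psi> k)" F]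
      by (metis mult_le_cancel_right order_le_less)
  qed (use assms in simp)
  from ell2_boundI_L2_set[OF this] show "\<psi> \<in> ell2" "ell2_norm \<psi> \<le> B" by auto
qed

text \<open>Pairing with a finitely supported vector gives a scalar function, to which the mean
  value inequality applies; duality then yields the norm bound. Differentiability is required only
  coordinatewise.\<close>

lemma ell2_bounded_increment:
  assumes B: "B \<ge> 0" and d: "\<And>k s. s \<in> closed_segment a b \<Longrightarrow> ((\<lambda>t. u t k) has_vector_derivative u' s k) (at s)"
    and u': "\<And>s. s \<in> closed_segment a b \<Longrightarrow> u' s \<in> ell2 \<and> ell2_norm (u' s) \<le> B"
  shows "(\<lambda>k. u b k - u a k) \<in> ell2" "ell2_norm (\<lambda>k. u b k - u a k) \<le> B * \<bar>b - a\<bar>"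
proof -
  have "cmod (\<Sum>k\<in>F. cnj (\<xi> k) * (u b k - u a k)) \<le> (B * \<bar>b - a\<bar>) * ell2_norm \<xi>"
    if F: "finite F" and \<xi>: "\<And>k. k \<notin> F \<Longrightarrow> \<xi> k = 0" for \<xi> F
  proof -
    have \<xi>2: "\<xi> \<in> ell2" using finite_support_ell2[OF F \<xi>] by simp
    have "cmod ((\<Sum>k\<in>F. cnj (\<xi> k) * u b k) - (\<Sum>k\<in>F. cnj (\<xi> k) * u a k)) \<le> (ell2_norm \<xi> * B) * \<bar>b - a\<bar>"
    proof (rule has_vector_derivative_bounded_increment)
      fix s assume s: "s \<in> closed_segment a b"
      show "((\<lambda>s. \<Sum>k\<in>F. cnj (\<xi> k) * u s k) has_vector_derivative (\<Sum>k\<in>F. cnj (\<xi> k) * u' s k)) (at s)"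
        by (intro derivative_intros d s)
      have "(\<Sum>k\<in>F. cnj (\<xi> k) * u' s k) = ell2_inner \<xi> (u' s)"
        using ell2_inner_finite_support[OF F \<xi>] by simp
      then show "cmod (\<Sum>k\<in>F. cnj (\<xi> k) * u' s k) \<le> ell2_norm \<xi> * B"
        using ell2_Cauchy_Schwarz[OF \<xi>2] u'[OF s]
        by (metis ell2_norm_nonneg mult_left_mono order_trans)
    qed
    then show ?thesis by (simp add: right_diff_distrib sum_subtractf mult_ac)
  qed
  from ell2_dual_bound[OF _ this] B
  show "(\<lambda>k. u b k - u a k) \<in> ell2" "ell2_norm (\<lambda>k. u b k - u a k) \<le> B * \<bar>b - a\<bar>" by auto
qed

lemma has_vector_derivative_iff_quotient:
  fixes f :: "real \<Rightarrow> complex"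
  shows "(f has_vector_derivative f') (at x) \<longleftrightarrow>
    ((\<lambda>h. (f (x + h) - f x) / of_real h) \<longlongrightarrow> f') (at 0)"
proof -
  have "(f has_vector_derivative f') (at x) \<longleftrightarrow>
      ((\<lambda>h. norm (f (x + h) - f x - h *\<^sub>R f') / norm h) \<longlongrightarrow> 0) (at 0)"
    by (simp add: has_vector_derivative_def has_derivative_at bounded_linear_scaleR_left)
  also have "\<dots> \<longleftrightarrow> ((\<lambda>h. norm ((f (x + h) - f x) / of_real h - f')) \<longlongrightarrow> 0) (at 0)"
  proof (rule tendsto_cong)
    have "norm (f (x + h) - f x - h *\<^sub>R f') / norm h = norm ((f (x + h) - f x) / of_real h - f')"
      if "h \<noteq> 0" for h
    proof -
      have "(f (x + h) - f x) / of_real h - f' = (f (x + h) - f x - h *\<^sub>R f') / of_real h"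
        using that by (simp add: scaleR_conv_of_real field_simps)
      then show ?thesis by (simp add: norm_divide)
    qed
    then show "\<forall>\<^sub>F h in at 0. norm (f (x + h) - f x - h *\<^sub>R f') / norm h
        = norm ((f (x + h) - f x) / of_real h - f')"
      by (auto simp: eventually_at_filter)
  qed
  also have "\<dots> \<longleftrightarrow> ((\<lambda>h. (f (x + h) - f x) / of_real h) \<longlongrightarrow> f') (at 0)"
    using tendsto_norm_zero_iff[of "\<lambda>h. (f (x + h) - f x) / of_real h - f'"]
    by (simp add: LIM_zero_iff)
  finally show ?thesis .
qed

lemma has_vector_derivative_shift:
  fixes f :: "real \<Rightarrow> complex"
  assumes "(f has_vector_derivative f') (at (x + s))"
  shows "((\<lambda>t. f (t + s)) has_vector_derivative f') (at x)"
  using assms by (simp add: has_vector_derivative_iff_quotient add_ac)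

section \<open>Unitary groups generated by row-finite symmetric matrices\<close>

locale row_finite_symmetric =
  fixes m :: "int \<Rightarrow> int \<Rightarrow> real" and N :: "int \<Rightarrow> int set"
  assumes finite_N: "finite (N a)"
    and m_zero: "b \<notin> N a \<Longrightarrow> m a b = 0"
    and m_sym: "m a b = m b a"
begin

definition T :: "(int \<Rightarrow> complex) \<Rightarrow> int \<Rightarrow> complex" where
  "T \<psi> = (\<lambda>a. \<Sum>\<^sub>\<infinity>b. of_real (m a b) * \<psi> b)"

definition D :: "(int \<Rightarrow> complex) set" where
  "D = {\<psi>\<in>ell2. T \<psi> \<in> ell2}"

text \<open>The differential equation is imposed coordinatewise. The time-independent bound
  \<open>L\<close> is what makes a solution Lipschitz in norm.\<close>

definition solution :: "(real \<Rightarrow> int \<Rightarrow> complex) \<Rightarrow> bool" where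
  "solution u \<longleftrightarrow> (\<exists>L. \<forall>t. u t \<in> D \<and> ell2_norm (T (u t)) \<le> L \<and>
     (\<forall>k. ((\<lambda>s. u s k) has_vector_derivative - \<i> * T (u t) k) (at t)))"

text \<open>The condition under the choice operator in \<open>exp_group\<close>, for the maximal
  operator \<open>T\<close> on \<open>D\<close>.\<close>

definition generates :: "(real \<Rightarrow> (int \<Rightarrow> complex) \<Rightarrow> int \<Rightarrow> complex) \<Rightarrow> bool" where
  "generates U \<longleftrightarrow> unitary_group U \<and>
     (\<forall>\<psi>\<in>ell2. \<forall>\<phi>\<in>ell2.
        \<psi> \<in> D \<and> T \<psi> = \<phi> \<longleftrightarrow>
        ((\<lambda>t. ell2_norm (\<lambda>k. (U t \<psi> k - \<psi> k) / of_real t - (- \<i>) * \<phi> k)) \<longlongrightarrow> 0) (at 0))"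

lemma T_finite_sum: "T \<psi> a = (\<Sum>b\<in>N a. of_real (m a b) * \<psi> b)"
proof -
  have "T \<psi> a = infsum (\<lambda>b. of_real (m a b) * \<psi> b) (N a)"
    unfolding T_def by (rule infsum_cong_neutral) (auto simp: m_zero)
  then show ?thesis using finite_N by simp
qed

lemma T_\<delta>: "T (\<delta> b) a = of_real (m a b)"
  using finite_N[of a] m_zero[of b a]
  by (auto simp: T_finite_sum \<delta>_def if_distrib[of "(*) _"] cong: if_cong)

lemma T_\<delta>_support: "k \<notin> N b \<Longrightarrow> T (\<delta> b) k = 0"
  by (simp add: T_\<delta> m_sym[of k b] m_zero)

lemma T_\<delta>_ell2: "T (\<delta> b) \<in> ell2"
  using finite_support_ell2(1)[OF finite_N T_\<delta>_support] .

lemma \<delta>_in_D: "\<delta> b \<in> D"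
  by (simp add: D_def T_\<delta>_ell2)

text \<open>Row \<open>k\<close> of the symmetric matrix has finite support, so this pairing makes
  sense for every sequence \<psi>, also outside the domain.\<close>

lemma inner_T_\<delta>: "ell2_inner (T (\<delta> k)) \<psi> = T \<psi> k"
proof -
  have "ell2_inner (T (\<delta> k)) \<psi> = (\<Sum>b\<in>N k. cnj (T (\<delta> k) b) * \<psi> b)"
    by (rule ell2_inner_finite_support[OF finite_N T_\<delta>_support])
  then show ?thesis by (simp add: T_\<delta> m_sym[of _ k] T_finite_sum[of \<psi>])
qed

lemma D_ell2: "\<psi> \<in> D \<Longrightarrow> \<psi> \<in> ell2" and T_D_ell2: "\<psi> \<in> D \<Longrightarrow> T \<psi> \<in> ell2"
  by (auto simp: D_def)

lemma solution_shift:
  assumes "solution u" shows "solution (\<lambda>t. u (t + s))"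
proof -
  from assms obtain L where L: "\<And>t. u t \<in> D" "\<And>t. ell2_norm (T (u t)) \<le> L"
    "\<And>t k. ((\<lambda>s. u s k) has_vector_derivative - \<i> * T (u t) k) (at t)"
    unfolding solution_def by auto
  have "((\<lambda>t. u (t + s) k) has_vector_derivative - \<i> * T (u (t + s)) k) (at t)" for t k
    using has_vector_derivative_shift[OF L(3)[of k "t + s"]] .
  then show ?thesis unfolding solution_def by (intro exI[of _ L] allI conjI L)
qed

lemma solution_ell2: "solution u \<Longrightarrow> u t \<in> ell2"
  unfolding solution_def using D_ell2 by blast

text \<open>Collects what weak differentiability needs: the bound on \<open>T (u t)\<close> bounds
  the difference quotients in norm, and the differential equation gives their coordinatewise
  limits.\<close>

lemma solution_quotient:
  assumes "solution u"
  obtains L where "L \<ge> 0"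
    "\<And>t h. (\<lambda>k. (u (t + h) k - u t k) / of_real h) \<in> ell2"
    "\<And>t h. ell2_norm (\<lambda>k. (u (t + h) k - u t k) / of_real h) \<le> L"
    "\<And>t h. ell2_norm (\<lambda>k. u (t + h) k - u t k) \<le> L * \<bar>h\<bar>"
    "\<And>t k. ((\<lambda>h. (u (t + h) k - u t k) / of_real h) \<longlongrightarrow> - \<i> * T (u t) k) (at 0)"
proof -
  from assms obtain L where L: "\<And>t. u t \<in> D" "\<And>t. ell2_norm (T (u t)) \<le> L"
    "\<And>t k. ((\<lambda>s. u s k) has_vector_derivative - \<i> * T (u t) k) (at t)"
    unfolding solution_def by auto
  have L0: "L \<ge> 0" using L(2)[of 0] ell2_norm_nonneg order_trans by blast
  have d: "(\<lambda>k. - \<i> * T (u t) k) \<in> ell2 \<and> ell2_norm (\<lambda>k. - \<i> * T (u t) k) \<le> L" for t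
    using ell2_scale[OF T_D_ell2[OF L(1)[of t]], of "- \<i>"] L(2)[of t] by auto
  have inc: "(\<lambda>k. u (t + h) k - u t k) \<in> ell2" "ell2_norm (\<lambda>k. u (t + h) k - u t k) \<le> L * \<bar>h\<bar>" for t h
    using ell2_bounded_increment[OF L0, of t "t + h" u "\<lambda>s k. - \<i> * T (u s) k"] L(3) d by auto
  show thesis
  proof
    fix t h k
    show "(\<lambda>k. (u (t + h) k - u t k) / of_real h) \<in> ell2"
      using ell2_divide(1)[OF inc(1)] .
    show "ell2_norm (\<lambda>k. (u (t + h) k - u t k) / of_real h) \<le> L"
    \<comment> \<open>For \<open>h = 0\<close> division by zero makes the quotient the zero
      sequence.\<close>
    proof (cases "h = 0")
      case False
      have "ell2_norm (\<lambda>k. (u (t + h) k - u t k) / of_real h) \<le> L * \<bar>h\<bar> / \<bar>h\<bar>"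
        using ell2_divide(2)[OF inc(1)[of t h], of "of_real h"]
          divide_right_mono[OF inc(2)[of t h], of "\<bar>h\<bar>"] by simp
      then show ?thesis using False by simp
    qed (simp add: ell2_norm_def L0)
    show "((\<lambda>h. (u (t + h) k - u t k) / of_real h) \<longlongrightarrow> - \<i> * T (u t) k) (at 0)"
      using L(3)[of k t] by (simp add: has_vector_derivative_iff_quotient)
  qed (use L0 inc in auto)
qed

text \<open>Weak differentiability: bounded quotients that converge coordinatewise converge against
  every \<psi> in \<open>ell2\<close>.\<close>

lemma solution_inner_derivative:
  assumes u: "solution u" and \<psi>: "\<psi> \<in> ell2"
  shows "((\<lambda>s. ell2_inner \<psi> (u s)) has_vector_derivative - \<i> * ell2_inner \<psi> (T (u t))) (at t)"
proof -
  from solution_quotient[OF u] obtain L where L: "L \<ge> 0"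
    "\<And>t h. (\<lambda>k. (u (t + h) k - u t k) / of_real h) \<in> ell2"
    "\<And>t h. ell2_norm (\<lambda>k. (u (t + h) k - u t k) / of_real h) \<le> L"
    "\<And>t k. ((\<lambda>h. (u (t + h) k - u t k) / of_real h) \<longlongrightarrow> - \<i> * T (u t) k) (at 0)" by metis
  have Tu: "T (u t) \<in> ell2" using u unfolding solution_def using T_D_ell2 by blast
  have "((\<lambda>h. ell2_inner \<psi> (\<lambda>k. (u (t + h) k - u t k) / of_real h)) \<longlongrightarrow>
      ell2_inner \<psi> (\<lambda>k. - \<i> * T (u t) k)) (at 0)"
    by (rule ell2_inner_tendsto[where B = L]) (intro always_eventually allI conjI L \<psi> ell2_scale(1)[OF Tu])+
  then have "((\<lambda>h. ell2_inner \<psi> (\<lambda>k. (u (t + h) k - u t k) / of_real h)) \<longlongrightarrow>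
      - \<i> * ell2_inner \<psi> (T (u t))) (at 0)"
    by (simp only: ell2_inner_scale_right)
  moreover have "ell2_inner \<psi> (\<lambda>k. (u (t + h) k - u t k) / of_real h) =
      (ell2_inner \<psi> (u (t + h)) - ell2_inner \<psi> (u t)) / of_real h" for h
    by (simp add: ell2_inner_divide_right ell2_inner_diff_right \<psi> solution_ell2[OF u])
  ultimately show ?thesis by (simp add: has_vector_derivative_iff_quotient)
qed

end

text \<open>The maximal operator is the adjoint of its restriction to finitely supported sequences,
  so symmetry on \<open>D\<close> amounts to self-adjointness. Symmetry is the form in which it
  enters the conservation law below.\<close>

locale row_finite_self_adjoint = row_finite_symmetric +
  assumes T_sym: "\<phi> \<in> D \<Longrightarrow> \<psi> \<in> D \<Longrightarrow> ell2_inner \<phi> (T \<psi>) = ell2_inner (T \<phi>) \<psi>"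
begin

text \<open>A product rule for weakly differentiable curves: the difference quotient splits into a
  cross term, which vanishes, and two terms whose limits cancel by symmetry.\<close>

lemma solution_inner_const:
  assumes u: "solution u" and w: "solution w"
  shows "ell2_inner (u t) (w t) = ell2_inner (u s) (w s)"
proof -
  from solution_quotient[OF u] obtain L where L: "L \<ge> 0"
    "\<And>t h. (\<lambda>k. (u (t + h) k - u t k) / of_real h) \<in> ell2"
    "\<And>t h. ell2_norm (\<lambda>k. (u (t + h) k - u t k) / of_real h) \<le> L"
    "\<And>t k. ((\<lambda>h. (u (t + h) k - u t k) / of_real h) \<longlongrightarrow> - \<i> * T (u t) k) (at 0)" by metis
  from solution_quotient[OF w] obtain K where K: "K \<ge> 0"
    "\<And>t h. ell2_norm (\<lambda>k. w (t + h) k - w t k) \<le> K * \<bar>h\<bar>" by metis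
  note e = solution_ell2[OF u] solution_ell2[OF w]
  have uD: "u t \<in> D" and wD: "w t \<in> D" for t using u w unfolding solution_def by auto
  have "((\<lambda>t. ell2_inner (u t) (w t)) has_vector_derivative 0) (at t)" for t
  proof -
    let ?q = "\<lambda>h k. (u (t + h) k - u t k) / of_real h"
    let ?d = "\<lambda>h k. w (t + h) k - w t k"
    have d: "?d h \<in> ell2" for h by (rule ell2_diff(1)) (use e in auto)
    have b: "cmod (ell2_inner (?q h) (?d h)) \<le> L * (K * \<bar>h\<bar>)" for h
      by (rule order_trans[OF ell2_Cauchy_Schwarz[OF L(2) d]])
        (intro mult_mono L(3) K(2) L(1) ell2_norm_nonneg)
    \<comment> \<open>Quotients of \<open>u\<close> converge only weakly, so the cross term needs
      more than weak limits: they are bounded in norm, and the increments of \<open>w\<close> tend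
      to 0 in norm.\<close>
    have 1: "((\<lambda>h. ell2_inner (?q h) (?d h)) \<longlongrightarrow> 0) (at 0)"
    proof (rule Lim_null_comparison)
      show "\<forall>\<^sub>F h in at 0. norm (ell2_inner (?q h) (?d h)) \<le> L * (K * \<bar>h\<bar>)"
        using b by (intro always_eventually allI)
      show "((\<lambda>h. L * (K * \<bar>h\<bar>)) \<longlongrightarrow> 0) (at 0)" by (auto intro!: tendsto_eq_intros)
    qed
    have 2: "((\<lambda>h. ell2_inner (?q h) (w t)) \<longlongrightarrow> cnj (- \<i> * ell2_inner (w t) (T (u t)))) (at 0)"
    proof -
      have "ell2_inner (?q h) (w t) =
          cnj ((ell2_inner (w t) (u (t + h)) - ell2_inner (w t) (u t)) / of_real h)" for h
        using e by (subst ell2_inner_cnj[symmetric]) (simp add: ell2_inner_divide_right ell2_inner_diff_right)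
      then show ?thesis
        using tendsto_cnj[OF solution_inner_derivative[OF u e(2), of t t,
            unfolded has_vector_derivative_iff_quotient]] by simp
    qed
    have 3: "((\<lambda>h. (ell2_inner (u t) (w (t + h)) - ell2_inner (u t) (w t)) / of_real h) \<longlongrightarrow>
        - \<i> * ell2_inner (u t) (T (w t))) (at 0)"
      using solution_inner_derivative[OF w e(1), of t t, unfolded has_vector_derivative_iff_quotient] .
    \<comment> \<open>Symmetry on \<open>D\<close> enters here, and makes the limits 2 and 3
      cancel.\<close>
    have "ell2_inner (w t) (T (u t)) = cnj (ell2_inner (u t) (T (w t)))"
      using T_sym[OF uD wD] by (metis ell2_inner_cnj)
    then have 4: "0 + cnj (- \<i> * ell2_inner (w t) (T (u t))) + - \<i> * ell2_inner (u t) (T (w t)) = 0"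
      by simp
    have "(ell2_inner (u (t + h)) (w (t + h)) - ell2_inner (u t) (w t)) / of_real h =
      ell2_inner (?q h) (?d h) + ell2_inner (?q h) (w t) +
        (ell2_inner (u t) (w (t + h)) - ell2_inner (u t) (w t)) / of_real h" for h
    proof -
      have "ell2_inner (?q h) (?d h) + ell2_inner (?q h) (w t) = ell2_inner (?q h) (w (t + h))"
        by (subst ell2_inner_diff_right) (use L(2) e in auto)
      also have "\<dots> = (ell2_inner (u (t + h)) (w (t + h)) - ell2_inner (u t) (w (t + h))) / of_real h"
        using ell2_inner_scale_left[of "1 / of_real h" "\<lambda>k. u (t + h) k - u t k"]
        by (simp add: ell2_inner_diff_left e)
      finally show ?thesis by (simp add: diff_divide_distrib)
    qed
    then show ?thesis
      using tendsto_add[OF tendsto_add[OF 1 2] 3]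
      unfolding has_vector_derivative_iff_quotient 4 by simp
  qed
  from has_vector_derivative_bounded_increment[of s t "\<lambda>t. ell2_inner (u t) (w t)" "\<lambda>_. 0" 0, OF this]
  show ?thesis by simp
qed

end

section \<open>The unitary group built from the solutions that start at basis vectors\<close>

locale fundamental_solutions = row_finite_self_adjoint +
  fixes r :: "int \<Rightarrow> real \<Rightarrow> int \<Rightarrow> complex"
  assumes r_solution: "solution (r a)" and r_0: "r a 0 = \<delta> a"
begin

text \<open>\<open>r k (-t)\<close> is row \<open>k\<close> of \<open>exp(-itM)\<close>, conjugated.\<close>

definition W :: "real \<Rightarrow> (int \<Rightarrow> complex) \<Rightarrow> int \<Rightarrow> complex" where
  "W t \<psi> = (\<lambda>k. ell2_inner (r k (- t)) \<psi>)"

lemma r_ell2: "r a t \<in> ell2"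
  using solution_ell2[OF r_solution] .

text \<open>Conservation carries the orthonormality of the basis vectors from time 0 to time
  \<open>t\<close>.\<close>

lemma r_inner: "ell2_inner (r a t) (r b t) = \<delta> b a"
  using solution_inner_const[OF r_solution[of a] r_solution[of b], of t 0]
  by (simp add: r_0) (simp add: \<delta>_def)

lemma r_lincomb_norm:
  assumes F: "finite F" and \<xi>: "\<And>k. k \<notin> F \<Longrightarrow> \<xi> k = 0"
  shows "ell2_norm (\<lambda>j. \<Sum>k\<in>F. \<xi> k * r k t j) = ell2_norm \<xi>"
proof -
  let ?v = "\<lambda>j. \<Sum>k\<in>F. \<xi> k * r k t j"
  have v: "?v \<in> ell2" by (intro ell2_sum(1) ell2_scale(1) r_ell2 F)
  have \<xi>2: "\<xi> \<in> ell2" using finite_support_ell2(1)[OF F \<xi>] .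
  have rv: "ell2_inner (r k t) ?v = \<xi> k" if "k \<in> F" for k
  proof -
    have "ell2_inner (r k t) ?v = cnj (ell2_inner ?v (r k t))" by (simp add: ell2_inner_cnj)
    also have "\<dots> = (\<Sum>i\<in>F. \<xi> i * ell2_inner (r k t) (r i t))"
      by (subst ell2_inner_lincomb_left) (simp_all add: F r_ell2 ell2_inner_cnj)
    also have "\<dots> = (\<Sum>i\<in>F. if i = k then \<xi> i else 0)"
      by (rule sum.cong) (auto simp: r_inner \<delta>_def)
    finally show ?thesis using F that by simp
  qed
  have "ell2_inner ?v ?v = (\<Sum>k\<in>F. cnj (\<xi> k) * \<xi> k)"
    by (subst ell2_inner_lincomb_left) (use F r_ell2 v rv in auto)
  also have "\<dots> = ell2_inner \<xi> \<xi>" by (rule ell2_inner_finite_support[OF F \<xi>, symmetric])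
  finally have "complex_of_real ((ell2_norm ?v)\<^sup>2) = of_real ((ell2_norm \<xi>)\<^sup>2)"
    by (simp add: ell2_inner_self v \<xi>2 del: of_real_power)
  then have "(ell2_norm ?v)\<^sup>2 = (ell2_norm \<xi>)\<^sup>2" by (simp only: of_real_eq_iff)
  then show ?thesis by (simp add: power2_eq_iff_nonneg)
qed

text \<open>Pairing \<open>W t \<psi>\<close> with a finitely supported \<xi> pairs \<psi> with a
  finite combination of orthonormal rows, of the same norm as \<xi>. Duality then gives the
  bound.\<close>

lemma W_contraction:
  assumes \<psi>: "\<psi> \<in> ell2"
  shows "W t \<psi> \<in> ell2" "ell2_norm (W t \<psi>) \<le> ell2_norm \<psi>"
proof -
  have "cmod (\<Sum>k\<in>F. cnj (\<xi> k) * W t \<psi> k) \<le> ell2_norm \<psi> * ell2_norm \<xi>"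
    if F: "finite F" and \<xi>: "\<And>k. k \<notin> F \<Longrightarrow> \<xi> k = 0" for \<xi> F
  proof -
    let ?v = "\<lambda>j. \<Sum>k\<in>F. \<xi> k * r k (- t) j"
    have "(\<Sum>k\<in>F. cnj (\<xi> k) * W t \<psi> k) = ell2_inner ?v \<psi>"
      by (subst ell2_inner_lincomb_left) (use F r_ell2 \<psi> in \<open>auto simp: W_def\<close>)
    also have "cmod \<dots> \<le> ell2_norm ?v * ell2_norm \<psi>"
      by (intro ell2_Cauchy_Schwarz ell2_sum(1) ell2_scale(1) r_ell2 F \<psi>)
    finally show ?thesis using r_lincomb_norm[OF F \<xi>] by (simp add: mult.commute)
  qed
  from ell2_dual_bound[OF ell2_norm_nonneg this]
  show "W t \<psi> \<in> ell2" "ell2_norm (W t \<psi>) \<le> ell2_norm \<psi>" by auto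
qed

lemma W_lincomb:
  assumes "\<phi> \<in> ell2" "\<psi> \<in> ell2"
  shows "W t (\<lambda>k. c * \<phi> k + d * \<psi> k) = (\<lambda>k. c * W t \<phi> k + d * W t \<psi> k)"
  unfolding W_def using ell2_inner_lincomb_right[OF r_ell2 assms] by simp

lemma W_diff:
  assumes "\<phi> \<in> ell2" "\<psi> \<in> ell2"
  shows "W t (\<lambda>k. \<phi> k - \<psi> k) = (\<lambda>k. W t \<phi> k - W t \<psi> k)"
  using W_lincomb[OF assms, of t 1 "-1"] by simp

lemma W_0: "W 0 \<psi> = \<psi>"
  by (simp add: W_def r_0)

text \<open>The conservation law for \<open>r a\<close> and the time shift of \<open>r k\<close> by
  \<open>t + s\<close>, compared at the times \<open>- t\<close> and 0, where \<open>r a 0\<close>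
  reads off the coordinate.\<close>

lemma W_r: "W t (r k s) = r k (t + s)"
proof
  fix a
  have "ell2_inner (r a (- t)) (r k s) = ell2_inner (r a 0) (r k (t + s))"
    using solution_inner_const[OF r_solution[of a] solution_shift[OF r_solution[of k], of "t + s"], of "- t" 0]
    by simp
  then show "W t (r k s) a = r k (t + s) a" by (simp add: W_def r_0)
qed

text \<open>For finitely supported \<phi> this is a finite computation with the kernel. Both sides
  are bounded in the norm of \<phi>, so their difference \<open>?L\<close> vanishes by truncation
  for all \<phi>.\<close>

lemma W_adjoint:
  assumes \<phi>: "\<phi> \<in> ell2" and \<psi>: "\<psi> \<in> ell2"
  shows "ell2_inner \<phi> (W t \<psi>) = ell2_inner (W (- t) \<phi>) \<psi>"
proof -
  let ?L = "\<lambda>\<phi>. ell2_inner \<phi> (W t \<psi>) - ell2_inner (W (- t) \<phi>) \<psi>"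
  note W = W_contraction[OF \<psi>, of t]
  have diff: "?L (\<lambda>k. \<phi> k - \<xi> k) = ?L \<phi> - ?L \<xi>" if "\<xi> \<in> ell2" for \<xi>
    using W_contraction[OF that, of "-t"] W_contraction[OF \<phi>, of "-t"]
    by (simp add: ell2_inner_diff_left W_diff \<phi> that W \<psi>)
  have bound: "cmod (?L \<xi>) \<le> 2 * ell2_norm \<xi> * ell2_norm \<psi>" if x: "\<xi> \<in> ell2" for \<xi>
  proof -
    have "cmod (ell2_inner \<xi> (W t \<psi>)) \<le> ell2_norm \<xi> * ell2_norm \<psi>"
      using ell2_Cauchy_Schwarz[OF x W(1)] W(2) by (meson ell2_norm_nonneg mult_left_mono order_trans)
    moreover have "cmod (ell2_inner (W (- t) \<xi>) \<psi>) \<le> ell2_norm \<xi> * ell2_norm \<psi>"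
      using ell2_Cauchy_Schwarz[OF W_contraction(1)[OF x] \<psi>, of "-t"] W_contraction(2)[OF x, of "-t"]
      by (meson ell2_norm_nonneg mult_right_mono order_trans)
    ultimately show ?thesis
      using norm_triangle_ineq4[of "ell2_inner \<xi> (W t \<psi>)" "ell2_inner (W (- t) \<xi>) \<psi>"] by linarith
  qed
  have fin: "?L \<xi> = 0" if F: "finite F" and \<xi>: "\<And>k. k \<notin> F \<Longrightarrow> \<xi> k = 0" for \<xi> F
  proof -
    have \<xi>2: "\<xi> \<in> ell2" using finite_support_ell2(1)[OF F \<xi>] .
    have "W (- t) \<xi> j = (\<Sum>k\<in>F. \<xi> k * r k (- t) j)" for j
    proof -
      have "W (- t) \<xi> j = cnj (ell2_inner \<xi> (r j t))" by (simp add: W_def ell2_inner_cnj)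
      also have "\<dots> = (\<Sum>k\<in>F. \<xi> k * cnj (r j t k))" by (simp add: ell2_inner_finite_support[OF F \<xi>])
      also have "\<dots> = (\<Sum>k\<in>F. \<xi> k * r k (- t) j)"
      proof (rule sum.cong)
        fix k
        \<comment> \<open>Since \<open>r k 0\<close> is the basis vector at \<open>k\<close>, the
          left side is by definition the conjugate of \<open>r j t k\<close>: the kernel is
          Hermitian up to time reversal.\<close>
        have "W (- t) (r k 0) j = r k (- t) j" using W_r[of "- t" k 0] by simp
        then show "\<xi> k * cnj (r j t k) = \<xi> k * r k (- t) j" by (simp add: W_def r_0)
      qed simp
      finally show ?thesis .
    qed
    then have "W (- t) \<xi> = (\<lambda>j. \<Sum>k\<in>F. \<xi> k * r k (- t) j)" by auto
    then have "ell2_inner (W (- t) \<xi>) \<psi> = (\<Sum>k\<in>F. cnj (\<xi> k) * W t \<psi> k)"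
      by (simp add: ell2_inner_lincomb_left[OF F] r_ell2 \<psi> W_def)
    then show ?thesis by (simp add: ell2_inner_finite_support[OF F \<xi>])
  qed
  have "cmod (?L \<phi>) \<le> e" if e: "e > 0" for e
  proof -
    have p: "2 * ell2_norm \<psi> + 1 > 0" by (rule add_nonneg_pos) auto
    then obtain F where F: "finite F" "ell2_norm (\<lambda>k. if k \<in> F then 0 else \<phi> k) < e / (2 * ell2_norm \<psi> + 1)"
      "(\<lambda>k. if k \<in> F then 0 else \<phi> k) \<in> ell2" (is "?t \<in> ell2")
      using ell2_truncation[OF \<phi>, of "e / (2 * ell2_norm \<psi> + 1)"] e by auto
    let ?f = "\<lambda>k. if k \<in> F then \<phi> k else 0"
    have f: "?f \<in> ell2" "?L ?f = 0" using finite_support_ell2(1)[OF F(1), of ?f] fin[OF F(1), of ?f] by auto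
    have "(\<lambda>k. \<phi> k - ?f k) = ?t" by auto
    then have "?L \<phi> = ?L ?t" using diff[OF f(1)] f(2) by simp
    also have "cmod \<dots> \<le> ell2_norm ?t * (2 * ell2_norm \<psi>)" using bound[OF F(3)] by (simp add: mult_ac)
    also have "\<dots> \<le> ell2_norm ?t * (2 * ell2_norm \<psi> + 1)" by (intro mult_left_mono) auto
    also have "\<dots> \<le> e" using F(2) p by (simp add: pos_less_divide_eq)
    finally show ?thesis .
  qed
  then have "cmod (?L \<phi>) \<le> 0" by (rule field_le_epsilon[of _ 0, simplified])
  then show ?thesis by simp
qed

text \<open>\<open>W t\<close> moves to the other side of the inner product, where it acts on a row
  and \<open>W_r\<close> adds the times.\<close>

lemma W_group:
  assumes \<psi>: "\<psi> \<in> ell2" shows "W (s + t) \<psi> = W s (W t \<psi>)"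
proof
  fix k
  have "W s (W t \<psi>) k = ell2_inner (W (- t) (r k (- s))) \<psi>"
    unfolding W_def[of s] using W_adjoint[OF r_ell2 \<psi>] .
  also have "\<dots> = ell2_inner (r k (- (s + t))) \<psi>" by (simp add: W_r algebra_simps)
  finally show "W (s + t) \<psi> k = W s (W t \<psi>) k" by (simp add: W_def)
qed

lemma W_unitary: "unitary_on_ell2 (W t)"
  unfolding unitary_on_ell2_def
proof (intro conjI ballI allI)
  show "W t ` ell2 = ell2"
  proof (intro equalityI subsetI)
    fix \<psi> assume "\<psi> \<in> ell2"
    then have "W (- t) \<psi> \<in> ell2" "\<psi> = W t (W (- t) \<psi>)"
      using W_contraction W_group[of \<psi> t "- t"] by (auto simp: W_0)
    then show "\<psi> \<in> W t ` ell2" by blast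
  qed (use W_contraction in auto)
  show "ell2_inner (W t \<phi>) (W t \<psi>) = ell2_inner \<phi> \<psi>" if "\<phi> \<in> ell2" "\<psi> \<in> ell2" for \<phi> \<psi>
    using W_adjoint[OF W_contraction(1)[OF that(1)] that(2)] W_group[OF that(1), of "- t" t]
    by (simp add: W_0)
qed (rule W_lincomb)

lemma W_norm: "\<psi> \<in> ell2 \<Longrightarrow> ell2_norm (W t \<psi>) = ell2_norm \<psi>"
  using W_contraction[of \<psi> t] W_contraction[of "W t \<psi>" "- t"] W_group[of \<psi> "- t" t] W_0[of \<psi>]
  by fastforce

text \<open>Coordinates are continuous, so \<open>W t \<psi>\<close> converges weakly. As
  \<open>W t\<close> preserves norms, expanding the square of the norm of the difference turns this
  into norm convergence.\<close>

lemma W_tendsto: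
  assumes \<psi>: "\<psi> \<in> ell2"
  shows "((\<lambda>t. ell2_norm (\<lambda>k. W t \<psi> k - \<psi> k)) \<longlongrightarrow> 0) (at 0)"
proof -
  have c: "((\<lambda>t. W t \<psi> k) \<longlongrightarrow> \<psi> k) (at 0)" for k
  proof -
    have "isCont (\<lambda>t. ell2_inner \<psi> (r k t)) 0"
      using has_vector_derivative_continuous[OF solution_inner_derivative[OF r_solution \<psi>]] .
    then have "((\<lambda>t. cnj (ell2_inner \<psi> (r k t))) \<longlongrightarrow> cnj (ell2_inner \<psi> (r k 0))) (at 0)"
      by (intro tendsto_cnj) (simp add: isCont_def)
    moreover have "filterlim (uminus :: real \<Rightarrow> real) (at 0) (at 0)"
      using filtermap_at_minus[of "0::real"] by (simp add: filterlim_def)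
    ultimately have "((\<lambda>t. cnj (ell2_inner \<psi> (r k (- t)))) \<longlongrightarrow> cnj (ell2_inner \<psi> (r k 0))) (at 0)"
      by (rule filterlim_compose)
    then show ?thesis by (simp add: W_def ell2_inner_cnj r_0)
  qed
  have "((\<lambda>t. ell2_inner \<psi> (W t \<psi>)) \<longlongrightarrow> ell2_inner \<psi> \<psi>) (at 0)"
    by (rule ell2_inner_tendsto[where B = "ell2_norm \<psi>"]) (use W_contraction[OF \<psi>] c \<psi> in auto)
  then have "((\<lambda>t. 2 * (ell2_norm \<psi>)\<^sup>2 - 2 * Re (ell2_inner \<psi> (W t \<psi>))) \<longlongrightarrow>
      2 * (ell2_norm \<psi>)\<^sup>2 - 2 * Re (ell2_inner \<psi> \<psi>)) (at 0)"
    by (intro tendsto_intros)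
  moreover have "2 * (ell2_norm \<psi>)\<^sup>2 - 2 * Re (ell2_inner \<psi> (W t \<psi>)) =
      (ell2_norm (\<lambda>k. W t \<psi> k - \<psi> k))\<^sup>2" for t
  proof -
    let ?d = "\<lambda>k. W t \<psi> k - \<psi> k"
    have W: "W t \<psi> \<in> ell2" and d: "?d \<in> ell2" using W_contraction[OF \<psi>] \<psi> ell2_diff(1) by auto
    have "complex_of_real ((ell2_norm ?d)\<^sup>2) = ell2_inner ?d ?d" by (simp add: ell2_inner_self[OF d])
    also have "\<dots> = ell2_inner (W t \<psi>) (W t \<psi>) - ell2_inner \<psi> (W t \<psi>) - (ell2_inner (W t \<psi>) \<psi> - ell2_inner \<psi> \<psi>)"
      by (simp add: ell2_inner_diff_right[OF d W \<psi>] ell2_inner_diff_left[OF W \<psi>] W \<psi>)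
    also have "ell2_inner (W t \<psi>) \<psi> = cnj (ell2_inner \<psi> (W t \<psi>))" by (simp add: ell2_inner_cnj)
    finally have "Re (complex_of_real ((ell2_norm ?d)\<^sup>2)) =
        Re (ell2_inner (W t \<psi>) (W t \<psi>) - ell2_inner \<psi> (W t \<psi>) - (cnj (ell2_inner \<psi> (W t \<psi>)) - ell2_inner \<psi> \<psi>))"
      by simp
    then show ?thesis by (simp add: ell2_inner_self W \<psi> W_norm del: of_real_power)
  qed
  ultimately have "((\<lambda>t. (ell2_norm (\<lambda>k. W t \<psi> k - \<psi> k))\<^sup>2) \<longlongrightarrow> 0) (at 0)"
    by (simp add: ell2_inner_self \<psi> del: of_real_power)
  from tendsto_real_sqrt[OF this] show ?thesis by simp
qed

lemma W_unitary_group: "unitary_group W"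
  unfolding unitary_group_def using W_unitary W_0 W_group W_tendsto by auto

text \<open>The derivative falls on the row, which is a solution, so \<psi> may be any element of
  \<open>ell2\<close>.\<close>

lemma W_derivative:
  assumes \<psi>: "\<psi> \<in> ell2"
  shows "((\<lambda>t. W t \<psi> k) has_vector_derivative - \<i> * ell2_inner (T (r k (- t))) \<psi>) (at t)"
proof -
  have "((\<lambda>s. ell2_inner \<psi> (r k s)) has_vector_derivative - \<i> * ell2_inner \<psi> (T (r k (- t)))) (at (- t))"
    by (rule solution_inner_derivative[OF r_solution \<psi>])
  then have "((\<lambda>t. ell2_inner \<psi> (r k (- t))) has_vector_derivative \<i> * ell2_inner \<psi> (T (r k (- t)))) (at t)"
    using vector_diff_chain_at[of uminus "-1" t "\<lambda>s. ell2_inner \<psi> (r k s)" "- \<i> * ell2_inner \<psi> (T (r k (- t)))"]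
    by (simp add: o_def has_vector_derivative_minus)
  from bounded_linear.has_vector_derivative[OF bounded_linear_cnj this]
  show ?thesis by (simp add: ell2_inner_cnj W_def)
qed

text \<open>For \<psi> in the domain, symmetry moves \<open>T\<close> from the row onto
  \<psi>.\<close>

lemma W_derivative_D:
  assumes \<psi>: "\<psi> \<in> D"
  shows "((\<lambda>t. W t \<psi> k) has_vector_derivative - \<i> * W t (T \<psi>) k) (at t)"
proof -
  have "r k (- t) \<in> D" using r_solution unfolding solution_def by auto
  from T_sym[OF this \<psi>] W_derivative[OF D_ell2[OF \<psi>], of k t]
  show ?thesis by (simp add: W_def)
qed

text \<open>On the domain, the error of the difference quotient is an increment with small
  derivative. Conversely, a norm limit fixes every coordinate of \<open>T \<psi>\<close>; then
  \<open>T \<psi> = \<phi>\<close> lies in \<open>ell2\<close>, which is membership in the maximal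
  domain.\<close>

lemma W_generates: "generates W"
  unfolding generates_def
proof (rule conjI[OF W_unitary_group], intro ballI, rule iffI)
  fix \<psi> \<phi> assume \<psi>: "\<psi> \<in> ell2" and \<phi>: "\<phi> \<in> ell2"
  let ?Q = "\<lambda>t k. (W t \<psi> k - \<psi> k) / of_real t - (- \<i>) * \<phi> k"
  { assume as: "\<psi> \<in> D \<and> T \<psi> = \<phi>"
    show "((\<lambda>t. ell2_norm (?Q t)) \<longlongrightarrow> 0) (at 0)"
    proof (rule tendstoI)
      fix e :: real assume e: "e > 0"
      from tendstoD[OF W_tendsto[OF \<phi>], of "e/2"] e
      obtain d where d: "d > 0" "\<And>t. t \<noteq> 0 \<Longrightarrow> \<bar>t\<bar> < d \<Longrightarrow> ell2_norm (\<lambda>k. W t \<phi> k - \<phi> k) < e/2"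
        by (auto simp: eventually_at)
      have "ell2_norm (?Q t) \<le> e/2" if t: "t \<noteq> 0" "\<bar>t\<bar> < d" for t
      proof -
        \<comment> \<open>\<open>W t \<psi>\<close> minus the linear part of its expansion at 0. Its
          derivative \<open>?u'\<close> is small near 0 by strong continuity at \<phi>, and
          \<open>?Q t\<close> is its increment from 0 divided by \<open>t\<close>.\<close>
        let ?u = "\<lambda>t k. W t \<psi> k + \<i> * (of_real t * \<phi> k)"
        let ?u' = "\<lambda>t k. - \<i> * (W t \<phi> k - \<phi> k)"
        have "((\<lambda>t. ?u t k) has_vector_derivative ?u' s k) (at s)" for s k
          by (auto intro!: derivative_eq_intros W_derivative_D[of \<psi> k s] simp: as algebra_simps)
        moreover have "?u' s \<in> ell2 \<and> ell2_norm (?u' s) \<le> e/2" if s: "s \<in> closed_segment 0 t" for s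
        proof -
          have "\<bar>s\<bar> < d" using s t by (auto simp: closed_segment_eq_real_ivl split: if_splits)
          then have "ell2_norm (\<lambda>k. W s \<phi> k - \<phi> k) \<le> e/2"
            using d(2)[of s] e by (cases "s = 0") (auto simp: W_0 ell2_norm_def)
          then show ?thesis
            using ell2_scale[OF ell2_diff(1)[OF W_contraction(1)[OF \<phi>] \<phi>], of "- \<i>" s]
            by (auto intro: order_trans)
        qed
        ultimately have inc: "(\<lambda>k. ?u t k - ?u 0 k) \<in> ell2" "ell2_norm (\<lambda>k. ?u t k - ?u 0 k) \<le> e/2 * \<bar>t - 0\<bar>"
          using ell2_bounded_increment[of "e/2" 0 t ?u ?u'] e by auto
        have "?Q t = (\<lambda>k. (?u t k - ?u 0 k) / of_real t)"
          using t by (auto simp: W_0 field_simps)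
        then have "ell2_norm (?Q t) \<le> (e/2 * \<bar>t\<bar>) / \<bar>t\<bar>"
          using ell2_divide(2)[OF inc(1), of "of_real t"] divide_right_mono[OF inc(2), of "\<bar>t\<bar>"] by simp
        then show ?thesis using t by simp
      qed
      note bound = this
      show "\<forall>\<^sub>F t in at 0. dist (ell2_norm (?Q t)) 0 < e"
        unfolding eventually_at
      proof (intro exI[of _ d] conjI ballI impI d(1))
        fix t :: real assume "t \<noteq> 0 \<and> dist t 0 < d"
        then have "ell2_norm (?Q t) \<le> e/2" using bound by simp
        then show "dist (ell2_norm (?Q t)) 0 < e"
          using e ell2_norm_nonneg[of "?Q t"] by (simp del: ell2_norm_nonneg)
      qed
    qed
  }
  { assume lim: "((\<lambda>t. ell2_norm (?Q t)) \<longlongrightarrow> 0) (at 0)"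
    have "T \<psi> k = \<phi> k" for k
    proof -
      have Q: "?Q t \<in> ell2" for t
        by (intro ell2_diff(1) ell2_divide(1) ell2_scale(1) W_contraction \<psi> \<phi>)
      have "((\<lambda>t. ?Q t k) \<longlongrightarrow> 0) (at 0)"
        by (rule Lim_null_comparison[OF always_eventually lim]) (use cmod_le_ell2_norm[OF Q] in auto)
      then have "((\<lambda>t. (W t \<psi> k - \<psi> k) / of_real t) \<longlongrightarrow> (- \<i>) * \<phi> k) (at 0)"
        by (simp only: LIM_zero_iff)
      \<comment> \<open>At time 0 the row is the basis vector at \<open>k\<close>, and pairing
        \<open>T\<close> of it with \<psi> gives \<open>T \<psi> k\<close>, even before \<psi> is
        known to lie in the domain.\<close>
      moreover have "((\<lambda>t. (W t \<psi> k - \<psi> k) / of_real t) \<longlongrightarrow> - \<i> * T \<psi> k) (at 0)"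
        using W_derivative[OF \<psi>, of k 0, unfolded has_vector_derivative_iff_quotient]
        by (simp add: W_0 r_0 inner_T_\<delta>)
      ultimately show ?thesis using tendsto_unique[OF trivial_limit_at] by fastforce
    qed
    then have "T \<psi> = \<phi>" by auto
    then show "\<psi> \<in> D \<and> T \<psi> = \<phi>" using \<psi> \<phi> by (simp add: D_def)
  }
qed

text \<open>The isometry \<open>U t\<close> transports the derivative at time 0 to time
  \<open>t\<close>. It also gives \<open>T (u t) = U t (T (\<delta> b))\<close>, whose norm is
  constant in time and serves as the bound \<open>L\<close>.\<close>

lemma generates_solution:
  assumes U: "generates U"
  shows "solution (\<lambda>t. U t (\<delta> b))"
proof -
  have ug: "unitary_group U" and
    gen: "\<And>\<psi> \<phi>. \<psi> \<in> ell2 \<Longrightarrow> \<phi> \<in> ell2 \<Longrightarrow> \<psi> \<in> D \<and> T \<psi> = \<phi> \<longleftrightarrow>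
        ((\<lambda>t. ell2_norm (\<lambda>k. (U t \<psi> k - \<psi> k) / of_real t - (- \<i>) * \<phi> k)) \<longlongrightarrow> 0) (at 0)"
    using U unfolding generates_def by auto
  have Uell2: "U t \<psi> \<in> ell2" if "\<psi> \<in> ell2" for t \<psi>
    using ug that unfolding unitary_group_def unitary_on_ell2_def by blast
  have lin: "U t (\<lambda>k. c * \<phi> k + d * \<psi> k) = (\<lambda>k. c * U t \<phi> k + d * U t \<psi> k)"
    if "\<phi> \<in> ell2" "\<psi> \<in> ell2" for t \<phi> \<psi> c d
    using ug that unfolding unitary_group_def unitary_on_ell2_def by blast
  have iso: "ell2_norm (U t \<psi>) = ell2_norm \<psi>" if \<psi>: "\<psi> \<in> ell2" for t \<psi>
  proof -
    have "ell2_inner (U t \<psi>) (U t \<psi>) = ell2_inner \<psi> \<psi>"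
      using ug \<psi> unfolding unitary_group_def unitary_on_ell2_def by blast
    then show ?thesis using ell2_inner_self[OF \<psi>] ell2_inner_self[OF Uell2[OF \<psi>, of t]]
      by (metis ell2_norm_nonneg of_real_eq_iff power2_eq_iff_nonneg)
  qed
  let ?\<phi> = "T (\<delta> b)"
  have lim: "((\<lambda>h. ell2_norm (\<lambda>k. (U h (\<delta> b) k - \<delta> b k) / of_real h - (- \<i>) * ?\<phi> k)) \<longlongrightarrow> 0) (at 0)"
    using gen[OF \<delta>_ell2 T_\<delta>_ell2] \<delta>_in_D by blast
  define u where "u = (\<lambda>t. U t (\<delta> b))"
  have u: "u t \<in> ell2" for t unfolding u_def by (rule Uell2) simp
  have eq: "ell2_norm (\<lambda>k. (u (t + h) k - u t k) / of_real h - (- \<i>) * U t ?\<phi> k) =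
      ell2_norm (\<lambda>k. (U h (\<delta> b) k - \<delta> b k) / of_real h - (- \<i>) * ?\<phi> k)" for t h
  proof -
    \<comment> \<open>The quotient is written as a two-term linear combination, the form in which
      linearity of \<open>U t\<close> is available. \<open>?v\<close> subtracts the candidate
      derivative.\<close>
    let ?q = "\<lambda>k. (1 / of_real h) * U h (\<delta> b) k + (- 1 / of_real h) * \<delta> b k"
    let ?v = "\<lambda>k. 1 * ?q k + \<i> * ?\<phi> k"
    have q: "?q \<in> ell2" by (intro ell2_lincomb Uell2 \<delta>_ell2)
    have v: "?v \<in> ell2" by (rule ell2_lincomb[OF q T_\<delta>_ell2])
    have "U (t + h) (\<delta> b) = U t (U h (\<delta> b))" using ug \<delta>_ell2 unfolding unitary_group_def by blast
    then have "U t ?v = (\<lambda>k. (u (t + h) k - u t k) / of_real h - (- \<i>) * U t ?\<phi> k)"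
      by (simp only: lin[OF q T_\<delta>_ell2] lin[OF Uell2[OF \<delta>_ell2] \<delta>_ell2])
        (auto simp: u_def diff_divide_distrib)
    moreover have "?v = (\<lambda>k. (U h (\<delta> b) k - \<delta> b k) / of_real h - (- \<i>) * ?\<phi> k)"
      by (auto simp: diff_divide_distrib)
    ultimately show ?thesis using iso[OF v, of t] by simp
  qed
  \<comment> \<open>The generator condition is an equivalence, so the limit at \<open>u t\<close>
    itself puts \<open>u t\<close> into the domain and identifies \<open>T (u t)\<close>.\<close>
  have Dt: "u t \<in> D \<and> T (u t) = U t ?\<phi>" for t
  proof -
    have "u (t + h) = U h (u t)" for h
      using ug \<delta>_ell2 unfolding unitary_group_def u_def by (metis add.commute)
    then show ?thesis
      using gen[OF u Uell2[OF T_\<delta>_ell2], of t t b] lim eq[of t] by simp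
  qed
  have "((\<lambda>s. u s k) has_vector_derivative - \<i> * T (u t) k) (at t)" for t k
  proof -
    let ?Q = "\<lambda>h k. (u (t + h) k - u t k) / of_real h - (- \<i>) * U t ?\<phi> k"
    have Q: "?Q h \<in> ell2" for h
      by (intro ell2_diff(1) ell2_divide(1) ell2_scale(1) u Uell2 T_\<delta>_ell2)
    have "((\<lambda>h. ?Q h k) \<longlongrightarrow> 0) (at 0)"
      by (rule Lim_null_comparison[OF always_eventually lim])
        (use cmod_le_ell2_norm[OF Q] eq in \<open>simp del: mult_minus_left\<close>)
    then show ?thesis
      unfolding has_vector_derivative_iff_quotient using Dt[of t] by (simp only: LIM_zero_iff)
  qed
  then show ?thesis
    unfolding solution_def u_def[symmetric] using Dt iso[OF T_\<delta>_ell2[of b]]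
    by (intro exI[of _ "ell2_norm ?\<phi>"]) auto
qed

text \<open>Conservation between an arbitrary generated group and the known rows: shifting
  \<open>r a\<close> by \<open>- t\<close> makes it the basis vector at time \<open>t\<close>, where
  it reads off the entry, and \<open>r a (- t)\<close> at time 0.\<close>

lemma generates_entry:
  assumes U: "generates U"
  shows "U t (\<delta> b) a = cnj (r a (- t) b)"
proof -
  have "unitary_group U" using U unfolding generates_def by auto
  then have "U 0 (\<delta> b) = \<delta> b" unfolding unitary_group_def by simp
  then show ?thesis
    using solution_inner_const[OF solution_shift[OF r_solution[of a], of "- t"] generates_solution[OF U], of t b 0]
    by (simp add: r_0)
qed

end

section \<open>Matrices indexed by spin configurations\<close>

lemma finite_config [simp]: "finite S \<Longrightarrow> finite (config S)"
  unfolding config_def by (rule finite_PiE) auto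

lemma config_nonempty: "config S \<noteq> {}"
  by (simp add: config_def PiE_eq_empty_iff)

lemma spin_alg_zero: "A \<in> spin_alg S \<Longrightarrow> s \<notin> config S \<or> s' \<notin> config S \<Longrightarrow> A s s' = 0"
  by (auto simp: spin_alg_def)

lemma op_mult_assoc: "op_mult S (op_mult S A B) C = op_mult S A (op_mult S B C)"
  unfolding op_mult_def
  by (intro ext) (simp add: sum_distrib_left sum_distrib_right mult.assoc, rule sum.swap)

lemma op_mult_add_left: "op_mult S (\<lambda>s s'. A s s' + B s s') C s s' = op_mult S A C s s' + op_mult S B C s s'"
  by (simp add: op_mult_def distrib_right sum.distrib)

lemma op_mult_add_right: "op_mult S C (\<lambda>s s'. A s s' + B s s') s s' = op_mult S C A s s' + op_mult S C B s s'"
  by (simp add: op_mult_def distrib_left sum.distrib)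

lemma op_mult_scale_left: "op_mult S (\<lambda>s s'. c * A s s') B s s' = c * op_mult S A B s s'"
  by (simp add: op_mult_def sum_distrib_left mult_ac)

lemma op_mult_scale_right: "op_mult S A (\<lambda>s s'. c * B s s') s s' = c * op_mult S A B s s'"
  by (simp add: op_mult_def sum_distrib_left mult_ac)

lemma op_mult_sum_left: "op_mult S (\<lambda>s s'. \<Sum>j\<in>J. A j s s') B s s' = (\<Sum>j\<in>J. op_mult S (A j) B s s')"
  unfolding op_mult_def by (simp add: sum_distrib_right, rule sum.swap)

lemma op_mult_sum_right: "op_mult S A (\<lambda>s s'. \<Sum>j\<in>J. B j s s') s s' = (\<Sum>j\<in>J. op_mult S A (B j) s s')"
  unfolding op_mult_def by (simp add: sum_distrib_left, rule sum.swap)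

lemma op_mult_diff_left: "op_mult S (\<lambda>s s'. A s s' - B s s') C s s' = op_mult S A C s s' - op_mult S B C s s'"
  by (simp add: op_mult_def left_diff_distrib sum_subtractf)

lemma op_mult_diff_right: "op_mult S C (\<lambda>s s'. A s s' - B s s') s s' = op_mult S C A s s' - op_mult S C B s s'"
  by (simp add: op_mult_def right_diff_distrib sum_subtractf)

lemma op_mult_id_left:
  assumes "finite S" "A \<in> spin_alg S" shows "op_mult S (op_id S) A = A"
proof (intro ext)
  fix s s'
  have "op_mult S (op_id S) A s s' = (\<Sum>s''\<in>config S. if s'' = s then A s s' else 0)"
    unfolding op_mult_def by (rule sum.cong) (auto simp: op_id_def)
  then show "op_mult S (op_id S) A s s' = A s s'"
    using assms by (auto simp: spin_alg_zero)
qed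

lemma op_mult_id_right:
  assumes "finite S" "A \<in> spin_alg S" shows "op_mult S A (op_id S) = A"
proof (intro ext)
  fix s s'
  have "op_mult S A (op_id S) s s' = (\<Sum>s''\<in>config S. if s'' = s' then A s s' else 0)"
    unfolding op_mult_def by (rule sum.cong) (auto simp: op_id_def)
  then show "op_mult S A (op_id S) s s' = A s s'"
    using assms by (auto simp: spin_alg_zero)
qed

lemma op_mult_spin_alg: "A \<in> spin_alg S \<Longrightarrow> B \<in> spin_alg S \<Longrightarrow> op_mult S A B \<in> spin_alg S"
  unfolding spin_alg_def op_mult_def
  by (auto elim!: sum.not_neutral_contains_not_neutral)

lemma op_id_spin_alg: "op_id S \<in> spin_alg S"
  by (auto simp: spin_alg_def op_id_def)

subsection \<open>The exponential\<close>

definition op_power :: "int set \<Rightarrow> spin_op \<Rightarrow> nat \<Rightarrow> spin_op" where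
  "op_power S A k = (op_mult S A ^^ k) (op_id S)"

lemma op_power_0: "op_power S A 0 = op_id S"
  and op_power_Suc: "op_power S A (Suc k) = op_mult S A (op_power S A k)"
  by (simp_all add: op_power_def)

lemma op_power_Suc_right:
  assumes "finite S" "A \<in> spin_alg S"
  shows "op_power S A (Suc k) = op_mult S (op_power S A k) A"
proof (induction k)
  case 0
  then show ?case using assms by (simp add: op_power_Suc op_power_0 op_mult_id_left op_mult_id_right)
next
  case (Suc k)
  then show ?case by (metis op_mult_assoc op_power_Suc)
qed

lemma op_power_scale: "op_power S (op_scale c A) k s s' = c ^ k * op_power S A k s s'"
proof (induction k arbitrary: s s')
  case (Suc k)
  then show ?case
    by (simp add: op_power_Suc op_mult_def op_scale_def sum_distrib_left mult_ac)
qed (simp add: op_power_0)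

text \<open>The sum of the moduli of all entries dominates each row sum. This crude constant
  suffices for the exponential series.\<close>

lemma op_power_bound:
  assumes "finite S" "A \<in> spin_alg S"
  shows "cmod (op_power S A k s s') \<le> (\<Sum>u\<in>config S. \<Sum>v\<in>config S. cmod (A u v)) ^ k"
proof (induction k arbitrary: s s')
  case 0
  then show ?case by (simp add: op_power_0 op_id_def)
next
  case (Suc k)
  let ?R = "\<Sum>u\<in>config S. \<Sum>v\<in>config S. cmod (A u v)"
  have R: "?R \<ge> 0" by (intro sum_nonneg) auto
  have row: "(\<Sum>v\<in>config S. cmod (A s v)) \<le> ?R"
  proof (cases "s \<in> config S")
    case True
    then show ?thesis
      using assms by (intro member_le_sum[of s _ "\<lambda>u. \<Sum>v\<in>config S. cmod (A u v)"]) (auto intro: sum_nonneg)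
  next
    case False
    then have "(\<Sum>v\<in>config S. cmod (A s v)) = 0"
      using assms(2) by (intro sum.neutral) (auto simp: spin_alg_zero)
    then show ?thesis using R by linarith
  qed
  have "cmod (op_power S A (Suc k) s s') \<le> (\<Sum>v\<in>config S. cmod (A s v) * cmod (op_power S A k v s'))"
    unfolding op_power_Suc op_mult_def by (rule sum_norm_le) (simp add: norm_mult)
  also have "\<dots> \<le> (\<Sum>v\<in>config S. cmod (A s v) * ?R ^ k)"
    by (intro sum_mono mult_left_mono Suc.IH) auto
  also have "\<dots> = (\<Sum>v\<in>config S. cmod (A s v)) * ?R ^ k" by (simp add: sum_distrib_right)
  also have "\<dots> \<le> ?R * ?R ^ k" by (intro mult_right_mono row zero_le_power R)
  finally show ?case by simp
qed

lemma op_exp_summable: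
  assumes "finite S" "A \<in> spin_alg S"
  shows "summable (\<lambda>k. op_power S A k s s' / fact k * z ^ k)"
proof (rule summable_comparison_test')
  let ?R = "\<Sum>u\<in>config S. \<Sum>v\<in>config S. cmod (A u v)"
  show "summable (\<lambda>k. (?R * cmod z) ^ k /\<^sub>R fact k)"
    by (rule summable_exp_generic)
  fix k :: nat
  have "cmod (op_power S A k s s') * cmod z ^ k / fact k \<le> ?R ^ k * cmod z ^ k / fact k"
    by (intro divide_right_mono mult_right_mono op_power_bound assms) auto
  also have "\<dots> = (?R * cmod z) ^ k /\<^sub>R fact k"
    by (simp add: power_mult_distrib divide_inverse mult.commute)
  finally show "norm (op_power S A k s s' / fact k * z ^ k) \<le> (?R * cmod z) ^ k /\<^sub>R fact k"
    by (simp add: norm_mult norm_divide norm_power)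
qed

lemma op_exp_series:
  "op_exp S (op_scale z A) s s' = (\<Sum>k. op_power S A k s s' / fact k * z ^ k)"
  unfolding op_exp_def op_power_def[symmetric] op_power_scale by (simp add: mult.commute)

text \<open>Termwise differentiation shifts the powers by one. Splitting the extra factor off on the
  left or on the right gives the same series, hence the commutation.\<close>

lemma op_exp_derivative:
  assumes S: "finite S" and A: "A \<in> spin_alg S"
  shows "((\<lambda>z. op_exp S (op_scale z A) s s') has_field_derivative
      op_mult S A (op_exp S (op_scale z A)) s s') (at z)"
    and "op_mult S A (op_exp S (op_scale z A)) = op_mult S (op_exp S (op_scale z A)) A"
proof -
  let ?c = "\<lambda>s s' k. op_power S A k s s' / fact k"
  have d: "diffs (?c s s') k = op_power S A (Suc k) s s' / fact k" for s s' k
    by (simp add: diffs_def field_simps del: of_nat_Suc)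
  have l: "(\<lambda>k. op_power S A (Suc k) s s' / fact k * z ^ k) sums op_mult S A (op_exp S (op_scale z A)) s s'" for s s'
  proof -
    have "(\<lambda>k. \<Sum>v\<in>config S. A s v * (?c v s' k * z ^ k)) sums
        (\<Sum>v\<in>config S. A s v * (\<Sum>k. ?c v s' k * z ^ k))"
      by (intro sums_sum sums_mult summable_sums op_exp_summable S A)
    then show ?thesis
      by (simp add: op_mult_def op_exp_series op_power_Suc sum_distrib_right sum_divide_distrib mult.assoc)
  qed
  have r: "(\<lambda>k. op_power S A (Suc k) s s' / fact k * z ^ k) sums op_mult S (op_exp S (op_scale z A)) A s s'" for s s'
  proof -
    have "(\<lambda>k. \<Sum>v\<in>config S. (?c s v k * z ^ k) * A v s') sums
        (\<Sum>v\<in>config S. (\<Sum>k. ?c s v k * z ^ k) * A v s')"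
      by (intro sums_sum sums_mult2 summable_sums op_exp_summable S A)
    then show ?thesis
      by (simp add: op_mult_def op_exp_series op_power_Suc_right[OF S A] sum_distrib_left sum_divide_distrib mult_ac)
  qed
  have "((\<lambda>z. \<Sum>k. ?c s s' k * z ^ k) has_field_derivative (\<Sum>k. diffs (?c s s') k * z ^ k)) (at z)"
    by (rule termdiffs_strong_converges_everywhere) (rule op_exp_summable[OF S A])
  then show "((\<lambda>z. op_exp S (op_scale z A) s s') has_field_derivative
      op_mult S A (op_exp S (op_scale z A)) s s') (at z)"
    by (simp only: d op_exp_series[symmetric] sums_unique[OF l, symmetric])
  show "op_mult S A (op_exp S (op_scale z A)) = op_mult S (op_exp S (op_scale z A)) A"
    using sums_unique2[OF l r] by auto
qed

lemma op_exp_0: "op_exp S (op_scale 0 A) = op_id S"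
  unfolding op_exp_series powser_zero by (simp add: op_power_0)

lemma op_exp_vector_derivative:
  assumes S: "finite S" and A: "A \<in> spin_alg S"
  shows "((\<lambda>t::real. op_exp S (op_scale (c * of_real t) A) s s') has_vector_derivative
      c * op_mult S A (op_exp S (op_scale (c * of_real t) A)) s s') (at t)"
proof -
  have "((\<lambda>t::real. c * of_real t) has_vector_derivative c) (at t)"
    by (auto intro!: derivative_eq_intros)
  from field_vector_diff_chain_at[OF this op_exp_derivative(1)[OF S A]]
  show ?thesis by (simp add: o_def)
qed

subsection \<open>The Hilbert-Schmidt inner product\<close>

definition hs_inner :: "int set \<Rightarrow> spin_op \<Rightarrow> spin_op \<Rightarrow> complex" where
  "hs_inner S B X = (\<Sum>s\<in>config S. \<Sum>s'\<in>config S. cnj (B s s') * X s s')"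

definition hermitian :: "spin_op \<Rightarrow> bool" where
  "hermitian A \<longleftrightarrow> (\<forall>s s'. cnj (A s s') = A s' s)"

lemma hs_inner_mult_left:
  assumes "hermitian A"
  shows "hs_inner S B (op_mult S A X) = hs_inner S (op_mult S A B) X"
proof -
  have h: "cnj (A v s) = A s v" for s v using assms unfolding hermitian_def by blast
  let ?f = "\<lambda>s s' v. cnj (B s s') * A s v * X v s'"
  have c: "cnj (op_mult S A B v s') * X v s' = (\<Sum>s\<in>config S. ?f s s' v)" for v s'
    by (simp add: op_mult_def h sum_distrib_right) (simp only: mult_ac)
  have "hs_inner S B (op_mult S A X) = (\<Sum>s\<in>config S. \<Sum>s'\<in>config S. \<Sum>v\<in>config S. ?f s s' v)"
    by (simp only: hs_inner_def op_mult_def sum_distrib_left mult.assoc)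
  also have "\<dots> = (\<Sum>s\<in>config S. \<Sum>v\<in>config S. \<Sum>s'\<in>config S. ?f s s' v)"
    by (rule sum.cong[OF refl], rule sum.swap)
  also have "\<dots> = (\<Sum>v\<in>config S. \<Sum>s\<in>config S. \<Sum>s'\<in>config S. ?f s s' v)"
    by (rule sum.swap)
  also have "\<dots> = (\<Sum>v\<in>config S. \<Sum>s'\<in>config S. \<Sum>s\<in>config S. ?f s s' v)"
    by (rule sum.cong[OF refl], rule sum.swap)
  also have "\<dots> = hs_inner S (op_mult S A B) X"
    by (simp only: hs_inner_def c)
  finally show ?thesis .
qed

lemma hs_inner_mult_right:
  assumes "hermitian A"
  shows "hs_inner S B (op_mult S X A) = hs_inner S (op_mult S B A) X"
proof -
  have h: "cnj (A v s) = A s v" for s v using assms unfolding hermitian_def by blast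
  let ?f = "\<lambda>s s' v. cnj (B s s') * A v s' * X s v"
  have c: "cnj (op_mult S B A s v) * X s v = (\<Sum>s'\<in>config S. ?f s s' v)" for s v
    by (simp add: op_mult_def h sum_distrib_right)
  have d: "cnj (B s s') * op_mult S X A s s' = (\<Sum>v\<in>config S. ?f s s' v)" for s s'
    by (simp add: op_mult_def sum_distrib_left) (simp only: mult_ac)
  have "hs_inner S B (op_mult S X A) = (\<Sum>s\<in>config S. \<Sum>s'\<in>config S. \<Sum>v\<in>config S. ?f s s' v)"
    by (simp only: hs_inner_def d)
  also have "\<dots> = (\<Sum>s\<in>config S. \<Sum>v\<in>config S. \<Sum>s'\<in>config S. ?f s s' v)"
    by (rule sum.cong[OF refl], rule sum.swap)
  also have "\<dots> = hs_inner S (op_mult S B A) X"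
    by (simp only: hs_inner_def c)
  finally show ?thesis .
qed

lemma hs_inner_diff_right: "hs_inner S B (\<lambda>s s'. X s s' - Y s s') = hs_inner S B X - hs_inner S B Y"
  by (simp add: hs_inner_def right_diff_distrib sum_subtractf)

lemma hs_inner_diff_left: "hs_inner S (\<lambda>s s'. X s s' - Y s s') B = hs_inner S X B - hs_inner S Y B"
  by (simp add: hs_inner_def left_diff_distrib sum_subtractf)

lemma hs_inner_scale_right: "hs_inner S B (\<lambda>s s'. c * X s s') = c * hs_inner S B X"
  by (simp add: hs_inner_def sum_distrib_left mult_ac)

lemma hs_inner_sum_right: "hs_inner S B (\<lambda>s s'. \<Sum>j\<in>J. X j s s') = (\<Sum>j\<in>J. hs_inner S B (X j))"
proof -
  have "(\<Sum>s'\<in>config S. cnj (B s s') * (\<Sum>j\<in>J. X j s s'))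
      = (\<Sum>j\<in>J. \<Sum>s'\<in>config S. cnj (B s s') * X j s s')" for s
    unfolding sum_distrib_left by (rule sum.swap)
  then have "hs_inner S B (\<lambda>s s'. \<Sum>j\<in>J. X j s s')
      = (\<Sum>s\<in>config S. \<Sum>j\<in>J. \<Sum>s'\<in>config S. cnj (B s s') * X j s s')"
    unfolding hs_inner_def by simp
  also have "\<dots> = (\<Sum>j\<in>J. hs_inner S B (X j))"
    unfolding hs_inner_def by (rule sum.swap)
  finally show ?thesis .
qed

lemma hs_inner_cnj: "cnj (hs_inner S B X) = hs_inner S X B"
  by (simp add: hs_inner_def mult.commute)

text \<open>Taking the commutator with a Hermitian matrix is a self-adjoint map for the
  Hilbert-Schmidt inner product. Both the conservation of the norm and the equation in the second
  index come from this.\<close>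

lemma hs_inner_commutator:
  assumes "hermitian A"
  shows "hs_inner S B (op_commutator S A X) = hs_inner S (op_commutator S A B) X"
  unfolding op_commutator_def
  by (simp add: hs_inner_diff_left hs_inner_diff_right hs_inner_mult_left hs_inner_mult_right assms)

lemma hs_inner_self: "hs_inner S X X = of_real (\<Sum>s\<in>config S. \<Sum>s'\<in>config S. (cmod (X s s'))\<^sup>2)"
  by (simp add: hs_inner_def complex_norm_square mult.commute del: of_real_power)

section \<open>The Jordan-Wigner transformation\<close>

definition swap2 :: "2 \<Rightarrow> 2" where
  "swap2 x = (if x = 1 then 2 else 1)"

definition zsign :: "2 \<Rightarrow> real" where
  "zsign x = (if x = 1 then 1 else - 1)"

definition flip :: "int \<Rightarrow> configuration \<Rightarrow> configuration" where
  "flip i s = s(i := swap2 (s i))"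

text \<open>Row \<open>s\<close> has at most one nonzero entry, with value \<open>w s\<close> in
  column \<open>f s\<close>. Pauli matrices, the terms of the Hamiltonian and the Jordan-Wigner
  operators have this shape, and products keep it, so that commutators reduce to identities between
  scalar weights.\<close>

definition monomial_op :: "int set \<Rightarrow> (configuration \<Rightarrow> configuration) \<Rightarrow> (configuration \<Rightarrow> complex) \<Rightarrow> spin_op" where
  "monomial_op S f w = (\<lambda>s s'. if s \<in> config S \<and> s' = f s then w s else 0)"

lemma two_neq_one [simp]: "(2::2) \<noteq> 1" "(1::2) \<noteq> 2"
  by auto

lemma two_cases: obtains "x = (1::2)" | "x = 2"
  using exhaust_2 by blast

lemma swap2_1 [simp]: "swap2 1 = 2" and swap2_2 [simp]: "swap2 2 = 1"
  by (simp_all add: swap2_def)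

lemma swap2_swap2 [simp]: "swap2 (swap2 x) = x"
  by (cases x rule: two_cases) simp_all

lemma swap2_neq [simp]: "swap2 x \<noteq> x" "x \<noteq> swap2 x"
  by (cases x rule: two_cases; simp)+

lemma zsign_swap2 [simp]: "zsign (swap2 x) = - zsign x"
  by (cases x rule: two_cases) (simp_all add: zsign_def)

lemma abs_zsign [simp]: "\<bar>zsign x\<bar> = 1"
  by (simp add: zsign_def)

lemma neq_iff_swap2: "x \<noteq> y \<longleftrightarrow> y = swap2 x"
  by (cases x rule: two_cases; cases y rule: two_cases) simp_all

lemma flip_apply: "flip i s k = (if k = i then swap2 (s i) else s k)"
  by (simp add: flip_def)

lemma flip_flip [simp]: "flip i (flip i s) = s"
  by (auto simp: flip_def)

lemma flip_commute: "flip i (flip j s) = flip j (flip i s)"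
  by (auto simp: flip_def)

lemma flip_config [simp]: "i \<in> S \<Longrightarrow> flip i s \<in> config S \<longleftrightarrow> s \<in> config S"
  by (auto simp: config_def flip_def PiE_iff extensional_def)

lemma flip_eq_iff: "flip i s = flip j s \<longleftrightarrow> i = j"
  by (auto simp: flip_def fun_eq_iff)

lemma config_eqI:
  assumes "s \<in> config S" "s' \<in> config S" "\<And>k. k \<in> S \<Longrightarrow> s k = s' k"
  shows "s = s'"
  using assms by (auto simp: config_def intro: PiE_ext)

lemma monomial_op_spin_alg: "(\<And>s. s \<in> config S \<Longrightarrow> f s \<in> config S) \<Longrightarrow> monomial_op S f w \<in> spin_alg S"
  by (auto simp: spin_alg_def monomial_op_def)

lemma monomial_op_mult:
  assumes "finite S" "\<And>s. s \<in> config S \<Longrightarrow> f s \<in> config S"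
  shows "op_mult S (monomial_op S f w) (monomial_op S g v) = monomial_op S (\<lambda>s. g (f s)) (\<lambda>s. w s * v (f s))"
proof (intro ext)
  fix s s'
  have "op_mult S (monomial_op S f w) (monomial_op S g v) s s' =
      (\<Sum>u\<in>config S. if u = f s then (if s \<in> config S \<and> s' = g (f s) then w s * v (f s) else 0) else 0)"
    unfolding op_mult_def by (rule sum.cong) (auto simp: monomial_op_def)
  then show "op_mult S (monomial_op S f w) (monomial_op S g v) s s' = monomial_op S (\<lambda>s. g (f s)) (\<lambda>s. w s * v (f s)) s s'"
    using assms by (auto simp: monomial_op_def)
qed

lemma site_op_offdiag:
  assumes "j \<in> S" "a $ 1 $ 1 = 0" "a $ 2 $ 2 = 0"
  shows "site_op S j a = monomial_op S (flip j) (\<lambda>s. a $ s j $ swap2 (s j))"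
proof (intro ext)
  fix s s'
  show "site_op S j a s s' = monomial_op S (flip j) (\<lambda>s. a $ s j $ swap2 (s j)) s s'"
  proof (cases "s' = flip j s")
    case True
    then show ?thesis using assms by (auto simp: site_op_def monomial_op_def flip_apply)
  next
    case False
    have "a $ s j $ s' j = 0" if "s \<in> config S" "s' \<in> config S" "\<forall>i\<in>S - {j}. s i = s' i"
    proof (rule ccontr)
      assume "a $ s j $ s' j \<noteq> 0"
      then have j: "s' j = swap2 (s j)" using assms(2,3)
        by (cases "s j" rule: two_cases; cases "s' j" rule: two_cases) simp_all
      have "s' k = flip j s k" if "k \<in> S" for k
        using \<open>\<forall>i\<in>S - {j}. s i = s' i\<close> that j by (cases "k = j") (simp_all add: flip_apply)
      then have "s' = flip j s" using that assms by (intro config_eqI[of _ S]) simp_all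
      with False show False ..
    qed
    then show ?thesis using False by (auto simp: site_op_def monomial_op_def)
  qed
qed

lemma site_op_diag:
  assumes "j \<in> S" "a $ 1 $ 2 = 0" "a $ 2 $ 1 = 0"
  shows "site_op S j a = monomial_op S (\<lambda>s. s) (\<lambda>s. a $ s j $ s j)"
proof (intro ext)
  fix s s'
  show "site_op S j a s s' = monomial_op S (\<lambda>s. s) (\<lambda>s. a $ s j $ s j) s s'"
  proof (cases "s' = s")
    case True
    then show ?thesis by (auto simp: site_op_def monomial_op_def)
  next
    case False
    have "a $ s j $ s' j = 0" if "s \<in> config S" "s' \<in> config S" "\<forall>i\<in>S - {j}. s i = s' i"
    proof (rule ccontr)
      assume "a $ s j $ s' j \<noteq> 0"
      then have "s' j = s j" using assms(2,3)
        by (cases "s j" rule: two_cases; cases "s' j" rule: two_cases) simp_all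
      then have "s' k = s k" if "k \<in> S" for k
        using \<open>\<forall>i\<in>S - {j}. s i = s' i\<close> that by (cases "k = j") auto
      then have "s' = s" using that by (intro config_eqI[of _ S]) auto
      with False show False ..
    qed
    then show ?thesis using False by (auto simp: site_op_def monomial_op_def)
  qed
qed

lemma site_op_pauli:
  assumes "j \<in> S"
  shows "site_op S j pauli_x = monomial_op S (flip j) (\<lambda>s. 1)"
    "site_op S j pauli_y = monomial_op S (flip j) (\<lambda>s. - \<i> * of_real (zsign (s j)))"
    "site_op S j pauli_z = monomial_op S (\<lambda>s. s) (\<lambda>s. of_real (zsign (s j)))"
proof -
  have "pauli_x $ x $ swap2 x = 1" "pauli_y $ x $ swap2 x = - \<i> * of_real (zsign x)"
    "pauli_z $ x $ x = of_real (zsign x)" for x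
    by (cases x rule: two_cases; simp add: pauli_x_def pauli_y_def pauli_z_def zsign_def)+
  then show "site_op S j pauli_x = monomial_op S (flip j) (\<lambda>s. 1)"
    "site_op S j pauli_y = monomial_op S (flip j) (\<lambda>s. - \<i> * of_real (zsign (s j)))"
    "site_op S j pauli_z = monomial_op S (\<lambda>s. s) (\<lambda>s. of_real (zsign (s j)))"
    using assms
    by (simp_all add: site_op_offdiag site_op_diag) (simp_all add: pauli_x_def pauli_y_def pauli_z_def site_op_offdiag site_op_diag)
qed

section \<open>The XY Hamiltonian and the Jordan-Wigner operators as monomial matrices\<close>

locale xy_chain =
  fixes \<mu> \<gamma> \<nu> :: "int \<Rightarrow> real" and m n :: int
begin

abbreviation "\<Lambda> \<equiv> {m..n}"
abbreviation "H \<equiv> xy_hamiltonian \<mu> \<gamma> \<nu> m n"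

definition flip2 :: "int \<Rightarrow> configuration \<Rightarrow> configuration" where
  "flip2 j s = flip (j + 1) (flip j s)"

text \<open>Weight of the bond term between \<open>j\<close> and \<open>j + 1\<close>. The x and y
  parts both flip the two spins, with row weights 1 and minus the product of the two signs.\<close>

definition q :: "int \<Rightarrow> configuration \<Rightarrow> real" where
  "q j s = \<mu> j * ((1 + \<gamma> j) - (1 - \<gamma> j) * (zsign (s j) * zsign (s (j + 1))))"

definition d :: "configuration \<Rightarrow> real" where
  "d s = (\<Sum>j\<in>\<Lambda>. \<nu> j * zsign (s j))"

text \<open>Row weight of string times local factor; the string stops before \<open>site a\<close>.
  The local factor is nonzero only in the row whose spin differs from \<open>block_index a\<close>:
  for index 1 this is row 2, column 1, the lowering matrix.\<close>

definition w :: "int \<Rightarrow> configuration \<Rightarrow> real" where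
  "w a s = (\<Prod>k\<in>{m..<site a}. zsign (s k)) * (if s (site a) = block_index a then 0 else 1)"

text \<open>\<open>jw (2j-1)\<close> is the annihilation operator \<open>c\<^sub>j\<close> and \<open>jw (2j)\<close> is its adjoint, matching the
  order of the components in the blocks of \<open>M\<close>.\<close>

definition jw :: "int \<Rightarrow> spin_op" where
  "jw a = monomial_op \<Lambda> (flip (site a)) (\<lambda>s. of_real (w a s))"

lemma H_monomial: "H s s' =
    (\<Sum>j\<in>{m..n-1}. monomial_op \<Lambda> (flip2 j) (\<lambda>s. of_real (q j s)) s s') + monomial_op \<Lambda> (\<lambda>s. s) (\<lambda>s. of_real (d s)) s s'"
proof -
  have "of_real (\<mu> j) * (of_real (1 + \<gamma> j) *
           op_mult \<Lambda> (site_op \<Lambda> j pauli_x) (site_op \<Lambda> (j+1) pauli_x) s s' +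
         of_real (1 - \<gamma> j) *
           op_mult \<Lambda> (site_op \<Lambda> j pauli_y) (site_op \<Lambda> (j+1) pauli_y) s s')
     = monomial_op \<Lambda> (flip2 j) (\<lambda>s. of_real (q j s)) s s'" if "j \<in> {m..n-1}" for j
  proof -
    have jj: "j \<in> \<Lambda>" "j + 1 \<in> \<Lambda>" using that by auto
    have y: "- \<i> * of_real x * (- \<i> * of_real y) = of_real (- (x * y))" for x y
      by (simp add: complex_eq_iff)
    have f: "flip j s (j + 1) = s (j + 1)" by (simp add: flip_apply)
    have mm: "op_mult \<Lambda> (monomial_op \<Lambda> (flip j) u) (monomial_op \<Lambda> g v)
        = monomial_op \<Lambda> (\<lambda>s. g (flip j s)) (\<lambda>s. u s * v (flip j s))" for u g v
      by (rule monomial_op_mult) (use jj in auto)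
    show ?thesis
      unfolding site_op_pauli[OF jj(1)] site_op_pauli[OF jj(2)] mm
      unfolding monomial_op_def flip2_def y q_def f
      by (auto simp: algebra_simps)
  qed
  moreover have "(\<Sum>j\<in>\<Lambda>. of_real (\<nu> j) * site_op \<Lambda> j pauli_z s s') = monomial_op \<Lambda> (\<lambda>s. s) (\<lambda>s. of_real (d s)) s s'"
    by (cases "s \<in> config \<Lambda> \<and> s' = s") (auto simp: site_op_pauli monomial_op_def d_def)
  ultimately show ?thesis by (simp add: xy_hamiltonian_def)
qed

lemma flip2_config: "j \<in> {m..n-1} \<Longrightarrow> flip2 j s \<in> config \<Lambda> \<longleftrightarrow> s \<in> config \<Lambda>"
  by (simp add: flip2_def)

lemma q_flip2: "q j (flip2 j s) = q j s"
  by (simp add: q_def flip2_def flip_apply)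

lemma flip2_flip2 [simp]: "flip2 j (flip2 j s) = s"
  by (simp add: flip2_def flip_commute[of j])

lemma H_spin_alg: "H \<in> spin_alg \<Lambda>"
  unfolding spin_alg_def H_monomial
proof (intro CollectI allI impI)
  fix s s'
  assume nz: "(\<Sum>j\<in>{m..n-1}. monomial_op \<Lambda> (flip2 j) (\<lambda>s. of_real (q j s)) s s') + monomial_op \<Lambda> (\<lambda>s. s) (\<lambda>s. of_real (d s)) s s' \<noteq> 0"
  show "s \<in> config \<Lambda> \<and> s' \<in> config \<Lambda>"
  proof (rule ccontr)
    assume c: "\<not> ?thesis"
    have "monomial_op \<Lambda> (flip2 j) (\<lambda>s. of_real (q j s)) s s' = 0" if "j \<in> {m..n-1}" for j
      using c flip2_config[OF that] by (auto simp: monomial_op_def)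
    moreover have "monomial_op \<Lambda> (\<lambda>s. s) (\<lambda>s. of_real (d s)) s s' = 0" using c by (auto simp: monomial_op_def)
    ultimately show False using nz by simp
  qed
qed

text \<open>\<open>flip2 j\<close> is an involution that leaves \<open>q j\<close> invariant, so
  every bond term is a real symmetric matrix.\<close>

lemma H_hermitian: "hermitian H"
  unfolding hermitian_def H_monomial
proof (intro allI)
  fix s s'
  have "cnj (monomial_op \<Lambda> (flip2 j) (\<lambda>s. of_real (q j s)) s s') = monomial_op \<Lambda> (flip2 j) (\<lambda>s. of_real (q j s)) s' s"
    if "j \<in> {m..n-1}" for j
    using flip2_config[OF that] q_flip2[of j] by (auto simp: monomial_op_def)
  then show "cnj ((\<Sum>j\<in>{m..n-1}. monomial_op \<Lambda> (flip2 j) (\<lambda>s. of_real (q j s)) s s') + monomial_op \<Lambda> (\<lambda>s. s) (\<lambda>s. of_real (d s)) s s')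
      = (\<Sum>j\<in>{m..n-1}. monomial_op \<Lambda> (flip2 j) (\<lambda>s. of_real (q j s)) s' s) + monomial_op \<Lambda> (\<lambda>s. s) (\<lambda>s. of_real (d s)) s' s"
    by (simp, auto simp: monomial_op_def)
qed

lemma jw_spin_alg: "site a \<in> \<Lambda> \<Longrightarrow> jw a \<in> spin_alg \<Lambda>"
  unfolding jw_def by (rule monomial_op_spin_alg) simp

text \<open>A bond not touching \<open>site a\<close> lies wholly inside the string or wholly beyond
  the site, so it changes an even number of string signs. This parity is what makes the commutator
  with the Hamiltonian local.\<close>

lemma w_flip2_far:
  assumes "j \<ge> m" "j \<noteq> site a" "j \<noteq> site a - 1"
  shows "w a (flip2 j s) = w a s"
proof -
  have "zsign (flip2 j s k) = zsign (s k) * (if k \<in> {j, j+1} then - 1 else 1)" for k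
    by (auto simp: flip2_def flip_apply)
  then have "(\<Prod>k\<in>{m..<site a}. zsign (flip2 j s k))
      = (\<Prod>k\<in>{m..<site a}. zsign (s k)) * (\<Prod>k\<in>{m..<site a}. if k \<in> {j, j+1} then - 1 else 1)"
    by (simp add: prod.distrib)
  also have "(\<Prod>k\<in>{m..<site a}. if k \<in> {j, j+1} then - 1 else (1::real)) = (- 1) ^ card ({m..<site a} \<inter> {j, j+1})"
    by (subst prod.If_cases) (simp_all only: finite_atLeastLessThan_int Collect_mem_eq prod_constant power_one mult_1_right)
  also have "card ({m..<site a} \<inter> {j, j+1}) = (if j < site a then 2 else 0)"
  proof (cases "j < site a")
    case True
    then have "{m..<site a} \<inter> {j, j+1} = {j, j+1}" using assms by auto
    then show ?thesis using True by simp
  qed (auto simp: card_eq_0_iff)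
  finally show ?thesis
    using assms by (auto simp: w_def flip2_def flip_apply)
qed

lemma w_string_Suc:
  assumes "m \<le> i"
  shows "(\<Prod>k\<in>{m..<i + 1}. zsign (s k)) = (\<Prod>k\<in>{m..<i}. zsign (s k)) * zsign (s i)"
proof -
  have "{m..<i + 1} = insert i {m..<i}" using assms by auto
  then show ?thesis by (simp add: mult.commute)
qed

lemma w_string_flip:
  assumes "\<not> (m \<le> j \<and> j < i)"
  shows "(\<Prod>k\<in>{m..<i}. zsign (flip j s k)) = (\<Prod>k\<in>{m..<i}. zsign (s k))"
  by (rule prod.cong) (use assms in \<open>auto simp: flip_apply\<close>)

end

section \<open>Entries of the one-particle matrix\<close>

lemma site_simps [simp]: "site (2*i) = i" "site (2*i - 1) = i" "site (2*i + 1) = i + 1"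
  "site (2*i + 2) = i + 1" "site (2*i - 3) = i - 1" "site (2*i - 2) = i - 1"
  by (auto simp: site_def)

lemma block_index_simps [simp]: "block_index (2*i) = 2" "block_index (2*i - 1) = 1"
  "block_index (2*i + 1) = 1" "block_index (2*i + 2) = 2" "block_index (2*i - 3) = 1" "block_index (2*i - 2) = 2"
  by (auto simp: block_index_def)

lemma index_cases: "a = 2 * site a - 1 \<or> a = 2 * site a"
  by (simp add: site_def) presburger

definition M_row :: "int \<Rightarrow> int set" where
  "M_row a = {2 * site a - 3 .. 2 * site a + 2}"

lemma M_row_eq: "M_row a = {2 * site a - 3, 2 * site a - 2, 2 * site a - 1, 2 * site a, 2 * site a + 1, 2 * site a + 2}"
  by (auto simp: M_row_def)

text \<open>Resolves the index shift in the off-diagonal blocks: the coupling to the left neighbour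
  carries the parameters of \<open>i - 1\<close>, that to the right neighbour those of
  \<open>i\<close>.\<close>

lemma M_matrix_values:
  "M_matrix \<mu> \<gamma> \<nu> (2*i - 1) (2*i - 3) = - 2 * \<mu> (i - 1)"
  "M_matrix \<mu> \<gamma> \<nu> (2*i - 1) (2*i - 2) = 2 * \<mu> (i - 1) * \<gamma> (i - 1)"
  "M_matrix \<mu> \<gamma> \<nu> (2*i - 1) (2*i - 1) = 2 * \<nu> i"
  "M_matrix \<mu> \<gamma> \<nu> (2*i - 1) (2*i) = 0"
  "M_matrix \<mu> \<gamma> \<nu> (2*i - 1) (2*i + 1) = - 2 * \<mu> i"
  "M_matrix \<mu> \<gamma> \<nu> (2*i - 1) (2*i + 2) = - 2 * \<mu> i * \<gamma> i"
  "M_matrix \<mu> \<gamma> \<nu> (2*i) (2*i - 3) = - 2 * \<mu> (i - 1) * \<gamma> (i - 1)"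
  "M_matrix \<mu> \<gamma> \<nu> (2*i) (2*i - 2) = 2 * \<mu> (i - 1)"
  "M_matrix \<mu> \<gamma> \<nu> (2*i) (2*i - 1) = 0"
  "M_matrix \<mu> \<gamma> \<nu> (2*i) (2*i) = - 2 * \<nu> i"
  "M_matrix \<mu> \<gamma> \<nu> (2*i) (2*i + 1) = 2 * \<mu> i * \<gamma> i"
  "M_matrix \<mu> \<gamma> \<nu> (2*i) (2*i + 2) = 2 * \<mu> i"
  by (simp_all add: M_matrix_def M_block_def J_block_def \<Gamma>_block_def transpose_def)

lemma M_matrix_sym: "M_matrix \<mu> \<gamma> \<nu> a b = M_matrix \<mu> \<gamma> \<nu> b a"
  unfolding M_matrix_def M_block_def J_block_def
  by (cases "block_index a" rule: two_cases; cases "block_index b" rule: two_cases)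
    (simp_all add: transpose_def)

lemma M_matrix_zero: "b \<notin> M_row a \<Longrightarrow> M_matrix \<mu> \<gamma> \<nu> a b = 0"
proof -
  assume b: "b \<notin> M_row a"
  have "\<not> (site b = site a \<or> site a = site b - 1 \<or> site a = site b + 1)"
    using b index_cases[of b] by (auto simp: M_row_def)
  then show ?thesis by (simp add: M_matrix_def M_block_def)
qed

section \<open>Commutators of the Hamiltonian with the Jordan-Wigner operators\<close>

context xy_chain
begin

lemma zsign_cases: "zsign x = 1 \<or> zsign x = - 1"
  by (simp add: zsign_def)

text \<open>Replaces the indicator in \<open>w\<close> by a polynomial in the sign at the site, so
  that the coefficient identities below can be checked on sign values.\<close>

lemma w_eq: "w a s = (\<Prod>k\<in>{m..<site a}. zsign (s k)) * ((1 + (if odd a then - 1 else 1) * zsign (s (site a))) / 2)"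
  by (cases "s (site a)" rule: two_cases) (simp_all add: w_def block_index_def zsign_def)

text \<open>The bond to the right of \<open>i\<close>: multiplied with \<open>jw a\<close> in either
  order it flips \<open>i\<close> twice, so that only \<open>i + 1\<close> is flipped, and the
  result must be matched with the two operators at that site.\<close>

lemma commutator_coeff_right:
  assumes i: "site a = i" "m < i"
  shows "q i s * w a (flip2 i s) - w a s * q i (flip i s)
    = - (M_matrix \<mu> \<gamma> \<nu> a (2*i + 1) * w (2*i + 1) s + M_matrix \<mu> \<gamma> \<nu> a (2*i + 2) * w (2*i + 2) s)"
proof -
  define P x y e where "P = (\<Prod>k\<in>{m..<i}. zsign (s k))" and "x = zsign (s i)"
    and "y = zsign (s (i + 1))" and "e = (if odd a then - 1 else 1 :: real)"
  have w1: "w a s = P * ((1 + e * x) / 2)" by (simp only: w_eq i P_def x_def e_def)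
  have w2: "w a (flip2 i s) = P * ((1 + e * - x) / 2)"
    by (simp only: w_eq i P_def x_def e_def flip2_def w_string_flip) (simp add: flip_apply)
  have w3: "q i s = \<mu> i * ((1 + \<gamma> i) - (1 - \<gamma> i) * (x * y))"
    "q i (flip i s) = \<mu> i * ((1 + \<gamma> i) - (1 - \<gamma> i) * (- x * y))"
    by (simp_all add: q_def flip_apply x_def y_def)
  \<comment> \<open>The string of site \<open>i + 1\<close> is longer by the sign \<open>x\<close>
    at \<open>i\<close>.\<close>
  have w4: "w (2*i + 1) s = P * x * ((1 - y) / 2)" "w (2*i + 2) s = P * x * ((1 + y) / 2)"
    using i by (simp_all add: w_eq w_string_Suc P_def x_def y_def)
  have xy: "x = 1 \<or> x = - 1" "y = 1 \<or> y = - 1"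
    by (simp_all add: x_def y_def zsign_cases)
  from index_cases[of a] i(1) consider "a = 2*i - 1" "e = - 1" | "a = 2*i" "e = 1"
    by (auto simp: e_def)
  then show ?thesis
  proof cases
    case 1
    show ?thesis
      unfolding w1 w2 w3 w4 unfolding 1 M_matrix_values
      using xy by (elim disjE) (simp_all add: algebra_simps)
  next
    case 2
    show ?thesis
      unfolding w1 w2 w3 w4 unfolding 2 M_matrix_values
      using xy by (elim disjE) (simp_all add: algebra_simps)
  qed
qed

text \<open>The bond to the left of \<open>i\<close>: besides the spin at \<open>i\<close> it flips
  the last sign of the string, which is absent from the shorter strings at site
  \<open>i - 1\<close>.\<close>

lemma commutator_coeff_left:
  assumes i: "site a = i" "m < i"
  shows "q (i - 1) s * w a (flip2 (i - 1) s) - w a s * q (i - 1) (flip i s)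
    = - (M_matrix \<mu> \<gamma> \<nu> a (2*i - 3) * w (2*i - 3) s + M_matrix \<mu> \<gamma> \<nu> a (2*i - 2) * w (2*i - 2) s)"
proof -
  define P x y e where "P = (\<Prod>k\<in>{m..<i - 1}. zsign (s k))" and "x = zsign (s i)"
    and "y = zsign (s (i - 1))" and "e = (if odd a then - 1 else 1 :: real)"
  have s1: "(\<Prod>k\<in>{m..<i}. zsign (s k)) = (\<Prod>k\<in>{m..<i - 1}. zsign (s k)) * zsign (s (i - 1))" for s
    using w_string_Suc[of "i - 1" s] i by simp
  have w1: "w a s = P * y * ((1 + e * x) / 2)" by (simp only: w_eq i P_def x_def y_def e_def s1)
  have w2: "w a (flip2 (i - 1) s) = P * - y * ((1 + e * - x) / 2)"
    by (simp only: w_eq i P_def x_def y_def e_def flip2_def s1)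
      (simp add: w_string_flip flip_apply)
  have w3: "q (i - 1) s = \<mu> (i - 1) * ((1 + \<gamma> (i - 1)) - (1 - \<gamma> (i - 1)) * (y * x))"
    "q (i - 1) (flip i s) = \<mu> (i - 1) * ((1 + \<gamma> (i - 1)) - (1 - \<gamma> (i - 1)) * (y * - x))"
    by (simp_all add: q_def flip_apply x_def y_def)
  have w4: "w (2*i - 3) s = P * ((1 - y) / 2)" "w (2*i - 2) s = P * ((1 + y) / 2)"
    by (simp_all add: w_eq P_def y_def)
  have xy: "x = 1 \<or> x = - 1" "y = 1 \<or> y = - 1"
    by (simp_all add: x_def y_def zsign_cases)
  from index_cases[of a] i(1) consider "a = 2*i - 1" "e = - 1" | "a = 2*i" "e = 1"
    by (auto simp: e_def)
  then show ?thesis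
  proof cases
    case 1
    show ?thesis
      unfolding w1 w2 w3 w4 unfolding 1 M_matrix_values
      using xy by (elim disjE) (simp_all add: algebra_simps)
  next
    case 2
    show ?thesis
      unfolding w1 w2 w3 w4 unfolding 2 M_matrix_values
      using xy by (elim disjE) (simp_all add: algebra_simps)
  qed
qed

lemma commutator_coeff_diag:
  assumes i: "site a = i" "i \<in> \<Lambda>"
  shows "d s * w a s - w a s * d (flip i s)
    = - (M_matrix \<mu> \<gamma> \<nu> a (2*i - 1) * w (2*i - 1) s + M_matrix \<mu> \<gamma> \<nu> a (2*i) * w (2*i) s)"
proof -
  define P x where "P = (\<Prod>k\<in>{m..<i}. zsign (s k))" and "x = zsign (s i)"
  have "d s - d (flip i s) = (\<Sum>j\<in>\<Lambda>. if j = i then 2 * \<nu> i * zsign (s i) else 0)"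
    unfolding d_def sum_subtractf[symmetric] by (rule sum.cong) (auto simp: flip_apply)
  then have dd: "d s = d (flip i s) + 2 * \<nu> i * x" using i by (simp add: x_def)
  have w: "w (2*i - 1) s = P * ((1 - x) / 2)" "w (2*i) s = P * ((1 + x) / 2)"
    by (simp_all add: w_eq P_def x_def)
  have x: "x = 1 \<or> x = - 1" by (simp add: x_def zsign_cases)
  from index_cases[of a] i(1) consider "a = 2*i - 1" | "a = 2*i" by auto
  then show ?thesis
  proof cases
    case 1
    show ?thesis unfolding 1 M_matrix_values w dd
      using x by (elim disjE) (simp_all add: algebra_simps)
  next
    case 2
    show ?thesis unfolding 2 M_matrix_values w dd
      using x by (elim disjE) (simp_all add: algebra_simps)
  qed
qed

text \<open>Of the Hamiltonian only the two bonds at the site and its own field contribute. For an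
  interior site both bonds are present and row \<open>a\<close> of M stays inside the chain. The
  minus sign becomes the one in exp(-itM).\<close>

lemma jw_commutator:
  assumes i: "m < site a" "site a < n"
  shows "op_commutator \<Lambda> H (jw a) s s' = - (\<Sum>b\<in>M_row a. of_real (M_matrix \<mu> \<gamma> \<nu> a b) * jw b s s')"
proof (cases "s \<in> config \<Lambda>")
  case False
  then have "H s u = 0" "jw b s u = 0" for u b
    using spin_alg_zero[OF H_spin_alg] by (auto simp: jw_def monomial_op_def)
  then show ?thesis by (simp add: op_commutator_def op_mult_def)
next
  case s: True
  define k where "k = site a"
  \<comment> \<open>With the row \<open>s\<close> fixed, \<open>e g x\<close> is the entry of a
    monomial term of value \<open>x\<close> in column \<open>g\<close>; terms with equal columns can
    be added.\<close>
  define e where "e = (\<lambda>g x. if s' = g then complex_of_real x else 0)"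
  have k: "m < k" "k < n" "k \<in> \<Lambda>" using i by (auto simp: k_def)
  have e_diff: "e g x - e g y = e g (x - y)" for g x y by (simp add: e_def)
  have jw: "jw b s s' = e (flip (site b) s) (w b s)" for b
    using s by (simp add: jw_def monomial_op_def e_def)
  have fs: "flip k s \<in> config \<Lambda>" using s k by simp
  have H: "H = (\<lambda>s s'. (\<Sum>j\<in>{m..n-1}. monomial_op \<Lambda> (flip2 j) (\<lambda>s. of_real (q j s)) s s')
      + monomial_op \<Lambda> (\<lambda>s. s) (\<lambda>s. of_real (d s)) s s')"
    by (intro ext H_monomial)
  have com: "flip2 j (flip k s) = flip k (flip2 j s)" for j
    by (simp add: flip2_def flip_commute[of _ k])
  have "op_mult \<Lambda> H (jw a) s s' = (\<Sum>j\<in>{m..n-1}.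
      op_mult \<Lambda> (monomial_op \<Lambda> (flip2 j) (\<lambda>s. of_real (q j s))) (jw a) s s')
      + op_mult \<Lambda> (monomial_op \<Lambda> (\<lambda>s. s) (\<lambda>s. of_real (d s))) (jw a) s s'"
    by (subst H) (simp only: op_mult_add_left op_mult_sum_left)
  also have "(\<Sum>j\<in>{m..n-1}. op_mult \<Lambda> (monomial_op \<Lambda> (flip2 j) (\<lambda>s. of_real (q j s))) (jw a) s s')
      = (\<Sum>j\<in>{m..n-1}. e (flip k (flip2 j s)) (q j s * w a (flip2 j s)))"
  proof (rule sum.cong[OF refl])
    fix j assume "j \<in> {m..n-1}"
    then show "op_mult \<Lambda> (monomial_op \<Lambda> (flip2 j) (\<lambda>s. of_real (q j s))) (jw a) s s'
        = e (flip k (flip2 j s)) (q j s * w a (flip2 j s))"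
      unfolding jw_def
      by (subst monomial_op_mult) (use flip2_config s in \<open>auto simp: monomial_op_def e_def k_def\<close>)
  qed
  also have "op_mult \<Lambda> (monomial_op \<Lambda> (\<lambda>s. s) (\<lambda>s. of_real (d s))) (jw a) s s' = e (flip k s) (d s * w a s)"
    unfolding jw_def by (subst monomial_op_mult) (use s in \<open>auto simp: monomial_op_def e_def k_def\<close>)
  finally have HC: "op_mult \<Lambda> H (jw a) s s' = (\<Sum>j\<in>{m..n-1}. e (flip k (flip2 j s)) (q j s * w a (flip2 j s)))
      + e (flip k s) (d s * w a s)" .
  have "op_mult \<Lambda> (jw a) H s s' = (\<Sum>j\<in>{m..n-1}.
      op_mult \<Lambda> (jw a) (monomial_op \<Lambda> (flip2 j) (\<lambda>s. of_real (q j s))) s s')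
      + op_mult \<Lambda> (jw a) (monomial_op \<Lambda> (\<lambda>s. s) (\<lambda>s. of_real (d s))) s s'"
    by (subst H) (simp only: op_mult_add_right op_mult_sum_right)
  also have "(\<Sum>j\<in>{m..n-1}. op_mult \<Lambda> (jw a) (monomial_op \<Lambda> (flip2 j) (\<lambda>s. of_real (q j s))) s s')
      = (\<Sum>j\<in>{m..n-1}. e (flip k (flip2 j s)) (w a s * q j (flip k s)))"
    unfolding jw_def
    by (rule sum.cong[OF refl], subst monomial_op_mult)
      (use k s in \<open>auto simp: monomial_op_def e_def com simp flip: k_def\<close>)
  also have "op_mult \<Lambda> (jw a) (monomial_op \<Lambda> (\<lambda>s. s) (\<lambda>s. of_real (d s))) s s' = e (flip k s) (w a s * d (flip k s))"
    unfolding jw_def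
    by (subst monomial_op_mult) (use k s in \<open>auto simp: monomial_op_def e_def simp flip: k_def\<close>)
  finally have CH: "op_mult \<Lambda> (jw a) H s s' = (\<Sum>j\<in>{m..n-1}. e (flip k (flip2 j s)) (w a s * q j (flip k s)))
      + e (flip k s) (w a s * d (flip k s))" .
  let ?\<alpha> = "\<lambda>j. q j s * w a (flip2 j s) - w a s * q j (flip k s)"
  have "op_commutator \<Lambda> H (jw a) s s' = (\<Sum>j\<in>{m..n-1}. e (flip k (flip2 j s)) (?\<alpha> j))
      + e (flip k s) (d s * w a s - w a s * d (flip k s))"
    by (simp add: op_commutator_def HC CH sum_subtractf flip: e_diff)
  also have "(\<Sum>j\<in>{m..n-1}. e (flip k (flip2 j s)) (?\<alpha> j)) = (\<Sum>j\<in>{k-1, k}. e (flip k (flip2 j s)) (?\<alpha> j))"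
  proof (rule sum.mono_neutral_right)
    show "\<forall>j\<in>{m..n-1} - {k-1, k}. e (flip k (flip2 j s)) (?\<alpha> j) = 0"
    proof
      fix j assume j: "j \<in> {m..n-1} - {k-1, k}"
      then have "w a (flip2 j s) = w a s" by (intro w_flip2_far) (auto simp: k_def)
      moreover have "q j (flip k s) = q j s" using j by (auto simp: q_def flip_apply)
      ultimately show "e (flip k (flip2 j s)) (?\<alpha> j) = 0" by (simp add: e_def)
    qed
  qed (use k in auto)
  \<comment> \<open>The spin at \<open>k\<close> is flipped twice, so each of the two bonds leaves a
    single flip at the neighbouring site.\<close>
  also have "\<dots> = e (flip (k - 1) s) (?\<alpha> (k - 1)) + e (flip (k + 1) s) (?\<alpha> k)"
    by (simp add: flip2_def flip_commute[of k])
  finally have c: "op_commutator \<Lambda> H (jw a) s s' = e (flip (k - 1) s) (?\<alpha> (k - 1)) + e (flip (k + 1) s) (?\<alpha> k)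
      + e (flip k s) (d s * w a s - w a s * d (flip k s))" .
  have "k = site a" by (simp add: k_def)
  note coeff = commutator_coeff_left[OF this[symmetric] k(1)] commutator_coeff_right[OF this[symmetric] k(1)]
    commutator_coeff_diag[OF this[symmetric] k(3)]
  let ?M = "M_matrix \<mu> \<gamma> \<nu> a"
  have "(\<Sum>b\<in>M_row a. of_real (?M b) * jw b s s')
      = of_real (?M (2*k - 3)) * e (flip (k - 1) s) (w (2*k - 3) s)
      + of_real (?M (2*k - 2)) * e (flip (k - 1) s) (w (2*k - 2) s)
      + of_real (?M (2*k - 1)) * e (flip k s) (w (2*k - 1) s)
      + of_real (?M (2*k)) * e (flip k s) (w (2*k) s)
      + of_real (?M (2*k + 1)) * e (flip (k + 1) s) (w (2*k + 1) s)
      + of_real (?M (2*k + 2)) * e (flip (k + 1) s) (w (2*k + 2) s)"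
    unfolding M_row_eq k_def[symmetric] by (simp add: jw)
  then show ?thesis
    unfolding c coeff by (simp add: e_def)
qed

end

section \<open>The Heisenberg evolution and its Jordan-Wigner coefficients\<close>

lemma op_mult_derivative:
  assumes "\<And>s s'. ((\<lambda>t. A t s s') has_vector_derivative A' s s') (at t)"
    "\<And>s s'. ((\<lambda>t. B t s s') has_vector_derivative B' s s') (at t)"
  shows "((\<lambda>t. op_mult S (A t) (B t) s s') has_vector_derivative
    op_mult S A' (B t) s s' + op_mult S (A t) B' s s') (at t)"
  unfolding op_mult_def
  by (auto intro!: derivative_eq_intros assms simp: sum.distrib add.commute)

lemma hs_inner_derivative:
  assumes "\<And>s s'. ((\<lambda>t. A t s s') has_vector_derivative A' s s') (at t)"
    "\<And>s s'. ((\<lambda>t. B t s s') has_vector_derivative B' s s') (at t)"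
  shows "((\<lambda>t. hs_inner S (A t) (B t)) has_vector_derivative
    hs_inner S A' (B t) + hs_inner S (A t) B') (at t)"
  unfolding hs_inner_def
  by (auto intro!: derivative_eq_intros assms simp: sum.distrib add.commute)

lemma index_eqI:
  assumes "site b = site c" "block_index b = block_index c"
  shows "b = c"
proof -
  have "odd b \<longleftrightarrow> odd c" using assms(2) by (simp add: block_index_def split: if_splits)
  then show ?thesis using assms(1) unfolding site_def by presburger
qed

context xy_chain
begin

abbreviation \<tau> :: "real \<Rightarrow> spin_op \<Rightarrow> spin_op" where
  "\<tau> \<equiv> heisenberg \<mu> \<gamma> \<nu> m n"

text \<open>The Hamiltonian commutes with its exponentials, so the commutator may be taken outside
  or inside the evolution. The outer form yields the equation in the second index of
  \<open>G\<close>, the inner form that in the first.\<close>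

lemma heisenberg_derivative:
  "((\<lambda>t. \<tau> t A s s') has_vector_derivative \<i> * op_commutator \<Lambda> H (\<tau> t A) s s') (at t)"
  "((\<lambda>t. \<tau> t A s s') has_vector_derivative \<i> * \<tau> t (op_commutator \<Lambda> H A) s s') (at t)"
proof -
  define E F where "E = (\<lambda>t::real. op_exp \<Lambda> (op_scale (\<i> * of_real t) H))"
    and "F = (\<lambda>t::real. op_exp \<Lambda> (op_scale (- \<i> * of_real t) H))"
  have tau: "\<tau> t A = op_mult \<Lambda> (op_mult \<Lambda> (E t) A) (F t)" for t A
    by (simp add: heisenberg_def E_def F_def)
  note HE = op_exp_derivative(2)[OF finite_atLeastAtMost_int H_spin_alg]
  have dE: "((\<lambda>t. E t s s') has_vector_derivative (\<i> * op_mult \<Lambda> H (E t) s s')) (at t)" for s s'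
    unfolding E_def by (rule op_exp_vector_derivative[OF finite_atLeastAtMost_int H_spin_alg])
  have dF: "((\<lambda>t. F t s s') has_vector_derivative (- \<i> * op_mult \<Lambda> H (F t) s s')) (at t)" for s s'
    unfolding F_def by (rule op_exp_vector_derivative[OF finite_atLeastAtMost_int H_spin_alg])
  have HEt: "op_mult \<Lambda> H (E t) = op_mult \<Lambda> (E t) H" and HFt: "op_mult \<Lambda> H (F t) = op_mult \<Lambda> (F t) H"
    unfolding E_def F_def using HE by auto
  have dEA: "((\<lambda>t. op_mult \<Lambda> (E t) A s s') has_vector_derivative
      op_mult \<Lambda> (\<lambda>s s'. \<i> * op_mult \<Lambda> H (E t) s s') A s s') (at t)" for s s'
    using op_mult_derivative[where A = E and B = "\<lambda>_. A" and B' = "\<lambda>_ _. 0", OF dE]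
    by (auto simp: op_mult_def[of _ _ "\<lambda>_ _. 0"])
  have "((\<lambda>t. op_mult \<Lambda> (op_mult \<Lambda> (E t) A) (F t) s s') has_vector_derivative
      op_mult \<Lambda> (op_mult \<Lambda> (\<lambda>s s'. \<i> * op_mult \<Lambda> H (E t) s s') A) (F t) s s'
      + op_mult \<Lambda> (op_mult \<Lambda> (E t) A) (\<lambda>s s'. - \<i> * op_mult \<Lambda> H (F t) s s') s s') (at t)"
    by (rule op_mult_derivative[OF dEA dF])
  moreover have "op_mult \<Lambda> (\<lambda>s s'. \<i> * op_mult \<Lambda> H (E t) s s') A = (\<lambda>s s'. \<i> * op_mult \<Lambda> (op_mult \<Lambda> H (E t)) A s s')"
    by (intro ext op_mult_scale_left)
  ultimately have d: "((\<lambda>t. \<tau> t A s s') has_vector_derivative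
      \<i> * op_mult \<Lambda> (op_mult \<Lambda> (op_mult \<Lambda> H (E t)) A) (F t) s s'
      - \<i> * op_mult \<Lambda> (op_mult \<Lambda> (E t) A) (op_mult \<Lambda> H (F t)) s s') (at t)"
    by (simp only: tau op_mult_scale_left op_mult_scale_right) simp
  have l: "op_commutator \<Lambda> H (\<tau> t A) s s' = op_mult \<Lambda> (op_mult \<Lambda> (op_mult \<Lambda> H (E t)) A) (F t) s s'
      - op_mult \<Lambda> (op_mult \<Lambda> (E t) A) (op_mult \<Lambda> H (F t)) s s'"
    by (simp add: op_commutator_def tau op_mult_assoc HFt)
  show "((\<lambda>t. \<tau> t A s s') has_vector_derivative \<i> * op_commutator \<Lambda> H (\<tau> t A) s s') (at t)"
    using d by (simp add: l right_diff_distrib)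
  have "\<tau> t (op_commutator \<Lambda> H A) s s' = op_mult \<Lambda> (op_mult \<Lambda> (E t) (op_mult \<Lambda> H A)) (F t) s s'
      - op_mult \<Lambda> (op_mult \<Lambda> (E t) (op_mult \<Lambda> A H)) (F t) s s'"
  proof -
    have "op_mult \<Lambda> (E t) (op_commutator \<Lambda> H A)
        = (\<lambda>s s'. op_mult \<Lambda> (E t) (op_mult \<Lambda> H A) s s' - op_mult \<Lambda> (E t) (op_mult \<Lambda> A H) s s')"
      unfolding op_commutator_def by (intro ext op_mult_diff_right)
    then show ?thesis by (simp add: tau op_mult_diff_left)
  qed
  then have r: "\<tau> t (op_commutator \<Lambda> H A) s s' = op_mult \<Lambda> (op_mult \<Lambda> (op_mult \<Lambda> H (E t)) A) (F t) s s'
      - op_mult \<Lambda> (op_mult \<Lambda> (E t) A) (op_mult \<Lambda> H (F t)) s s'"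
    by (simp add: op_mult_assoc HEt)
  show "((\<lambda>t. \<tau> t A s s') has_vector_derivative \<i> * \<tau> t (op_commutator \<Lambda> H A) s s') (at t)"
    using d by (simp add: r right_diff_distrib)
qed

lemma heisenberg_0: "A \<in> spin_alg \<Lambda> \<Longrightarrow> \<tau> 0 A = A"
  by (simp add: heisenberg_def op_exp_0 op_mult_id_left op_mult_id_right)

lemma heisenberg_scale: "\<tau> t (\<lambda>s s'. c * A s s') s s' = c * \<tau> t A s s'"
proof -
  have "op_mult \<Lambda> E (\<lambda>s s'. c * A s s') = (\<lambda>s s'. c * op_mult \<Lambda> E A s s')" for E
    by (intro ext op_mult_scale_right)
  then show ?thesis by (simp add: heisenberg_def op_mult_scale_left)
qed

lemma heisenberg_sum: "\<tau> t (\<lambda>s s'. \<Sum>j\<in>J. A j s s') s s' = (\<Sum>j\<in>J. \<tau> t (A j) s s')"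
proof -
  have "op_mult \<Lambda> E (\<lambda>s s'. \<Sum>j\<in>J. A j s s') = (\<lambda>s s'. \<Sum>j\<in>J. op_mult \<Lambda> E (A j) s s')" for E
    by (intro ext op_mult_sum_right)
  then show ?thesis by (simp add: heisenberg_def op_mult_sum_left)
qed

text \<open>The derivative is the sum of a number and its conjugate, and the number is purely
  imaginary because the commutator with the Hamiltonian is self-adjoint.\<close>

lemma hs_inner_heisenberg_self:
  assumes A: "A \<in> spin_alg \<Lambda>"
  shows "hs_inner \<Lambda> (\<tau> t A) (\<tau> t A) = hs_inner \<Lambda> A A"
proof -
  have "((\<lambda>t. hs_inner \<Lambda> (\<tau> t A) (\<tau> t A)) has_vector_derivative 0) (at t)" for t
  proof -
    let ?K = "op_commutator \<Lambda> H (\<tau> t A)"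
    have "((\<lambda>t. hs_inner \<Lambda> (\<tau> t A) (\<tau> t A)) has_vector_derivative
        hs_inner \<Lambda> (\<lambda>s s'. \<i> * ?K s s') (\<tau> t A) + hs_inner \<Lambda> (\<tau> t A) (\<lambda>s s'. \<i> * ?K s s')) (at t)"
      by (intro hs_inner_derivative heisenberg_derivative)
    moreover have "hs_inner \<Lambda> (\<lambda>s s'. \<i> * ?K s s') (\<tau> t A) = cnj (hs_inner \<Lambda> (\<tau> t A) (\<lambda>s s'. \<i> * ?K s s'))"
      by (simp add: hs_inner_cnj)
    ultimately show ?thesis
      using hs_inner_cnj[of \<Lambda> "\<tau> t A" ?K]
      by (simp add: hs_inner_scale_right hs_inner_commutator[OF H_hermitian])
  qed
  from has_vector_derivative_bounded_increment[of 0 t "\<lambda>t. hs_inner \<Lambda> (\<tau> t A) (\<tau> t A)" "\<lambda>_. 0" 0, OF this]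
  show ?thesis by (simp add: heisenberg_0[OF A])
qed

text \<open>The rows in which \<open>jw b\<close> has its nonzero entry.\<close>

definition rows :: "int \<Rightarrow> configuration set" where
  "rows b = {s \<in> config \<Lambda>. s (site b) \<noteq> block_index b}"

text \<open>Half the dimension of the spin space, which is the squared Hilbert-Schmidt norm of each
  \<open>jw b\<close>.\<close>

definition h :: real where
  "h = card (config \<Lambda>) / 2"

lemma finite_rows [simp]: "finite (rows b)"
  by (simp add: rows_def)

lemma card_rows:
  assumes b: "site b \<in> \<Lambda>" shows "card (rows b) = h"
proof -
  let ?f = "flip (site b)" and ?R = "{s \<in> config \<Lambda>. s (site b) = block_index b}"
  have "bij_betw ?f (rows b) ?R"
  proof (rule bij_betw_byWitness[where f' = ?f])
    have "swap2 x = y" if "x \<noteq> y" for x y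
      using that neq_iff_swap2 by metis
    then show "?f ` rows b \<subseteq> ?R"
      using b unfolding rows_def by (intro image_subsetI) (simp only: mem_Collect_eq flip_apply flip_config simp_thms if_True)
    show "?f ` ?R \<subseteq> rows b"
      using b unfolding rows_def by (intro image_subsetI) (simp add: flip_apply)
  qed simp_all
  then have eq: "card (rows b) = card ?R" by (rule bij_betw_same_card)
  have "config \<Lambda> = rows b \<union> ?R" unfolding rows_def by blast
  then have "card (config \<Lambda>) = card (rows b \<union> ?R)" by (rule arg_cong)
  also have "\<dots> = card (rows b) + card ?R"
    by (rule card_Un_disjoint) (auto simp: rows_def)
  finally show ?thesis by (simp add: h_def eq)
qed

lemma h_pos: "h > 0"
  by (simp add: h_def card_gt_0_iff config_nonempty)

lemma abs_string: "\<bar>\<Prod>k\<in>I. zsign (s k)\<bar> = 1"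
  by (simp add: abs_prod)

lemma abs_w: "s \<in> rows b \<Longrightarrow> \<bar>w b s\<bar> = 1"
  by (simp add: rows_def w_def abs_mult abs_string)

lemma abs_w_le: "\<bar>w b s\<bar> \<le> 1"
  by (simp add: w_def abs_mult abs_string)

lemma w_zero: "s \<in> config \<Lambda> - rows b \<Longrightarrow> w b s = 0"
  by (simp add: rows_def w_def)

lemma hs_inner_jw:
  assumes b: "site b \<in> \<Lambda>"
  shows "hs_inner \<Lambda> (jw b) X = (\<Sum>s\<in>rows b. of_real (w b s) * X s (flip (site b) s))"
proof -
  have "hs_inner \<Lambda> (jw b) X = (\<Sum>s\<in>config \<Lambda>. \<Sum>s'\<in>config \<Lambda>.
      if s' = flip (site b) s then of_real (w b s) * X s (flip (site b) s) else 0)"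
    unfolding hs_inner_def by (intro sum.cong refl) (auto simp: jw_def monomial_op_def)
  also have "\<dots> = (\<Sum>s\<in>config \<Lambda>. of_real (w b s) * X s (flip (site b) s))"
    by (rule sum.cong) (use b in auto)
  also have "\<dots> = (\<Sum>s\<in>rows b. of_real (w b s) * X s (flip (site b) s))"
    by (rule sum.mono_neutral_right) (auto simp: w_zero, auto simp: rows_def)
  finally show ?thesis .
qed

text \<open>Operators at different sites flip different spins and so occupy different columns. The
  two operators at one site live on complementary rows.\<close>

lemma hs_inner_jw_jw:
  assumes "site a \<in> \<Lambda>" "site b \<in> \<Lambda>"
  shows "hs_inner \<Lambda> (jw b) (jw a) = (if a = b then of_real h else 0)"
proof -
  have eq: "hs_inner \<Lambda> (jw b) (jw a) = (\<Sum>s\<in>rows b. of_real (w b s) * jw a s (flip (site b) s))"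
    by (rule hs_inner_jw[OF assms(2)])
  have c: "of_real (w b s) * jw a s (flip (site b) s) = (if a = b then 1 else 0)" if s: "s \<in> rows b" for s
  proof (cases "a = b")
    case True
    have "\<bar>w b s\<bar> * \<bar>w b s\<bar> = 1" by (simp only: abs_w[OF s] mult_1)
    then have "w b s * w b s = 1" by simp
    then show ?thesis using True s by (simp add: jw_def monomial_op_def rows_def flip: of_real_mult)
  next
    case False
    show ?thesis
    proof (cases "site a = site b")
      case True
      with False have "block_index a \<noteq> block_index b"
        using index_eqI by blast
      then have "block_index a = s (site a)"
        using s True neq_iff_swap2[of "block_index a" "block_index b"] neq_iff_swap2[of "s (site b)" "block_index b"]
        by (auto simp: rows_def dest: arg_cong[of _ _ swap2])
      then have "w a s = 0" by (simp add: w_def)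
      then show ?thesis using False by (simp add: jw_def monomial_op_def)
    next
      assume "site a \<noteq> site b"
      then show ?thesis using False by (simp add: jw_def monomial_op_def flip_eq_iff)
    qed
  qed
  have "hs_inner \<Lambda> (jw b) (jw a) = (\<Sum>s\<in>rows b. if a = b then 1 else 0)"
    unfolding eq by (rule sum.cong[OF refl c])
  also have "\<dots> = (if a = b then of_real (card (rows b)) else 0)" by simp
  finally show ?thesis by (simp only: card_rows[OF assms(2)])
qed

text \<open>The normalized coefficient of \<open>\<tau>\<^sub>t(jw a)\<close> along \<open>jw b\<close>.  Working with it requires neither
  the exponential of the finite-volume one-particle matrix nor that \<open>\<tau>\<^sub>t(jw a)\<close> remains in the
  span of the \<open>jw b\<close>.\<close>

definition G :: "real \<Rightarrow> int \<Rightarrow> int \<Rightarrow> complex" where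
  "G t a b = hs_inner \<Lambda> (jw b) (\<tau> t (jw a)) / of_real h"

lemma G_0: "site a \<in> \<Lambda> \<Longrightarrow> site b \<in> \<Lambda> \<Longrightarrow> G 0 a b = \<delta> a b"
  using h_pos by (simp add: G_def heisenberg_0 jw_spin_alg hs_inner_jw_jw \<delta>_def)

lemma hs_inner_const_derivative:
  assumes "\<And>s s'. ((\<lambda>t. B t s s') has_vector_derivative B' s s') (at t)"
  shows "((\<lambda>t. hs_inner S A (B t)) has_vector_derivative hs_inner S A B') (at t)"
  using hs_inner_derivative[of "\<lambda>_. A" "\<lambda>_ _. 0" t B B' S] assms by (simp add: hs_inner_def[of S "\<lambda>_ _. 0"])

text \<open>The inner form of the derivative: \<open>jw_commutator\<close> expands the commutator
  before it is evolved.\<close>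

lemma G_derivative_left:
  assumes a: "m < site a" "site a < n"
  shows "((\<lambda>t. G t a b) has_vector_derivative - \<i> * (\<Sum>c\<in>M_row a. of_real (M_matrix \<mu> \<gamma> \<nu> a c) * G t c b)) (at t)"
proof -
  have c: "op_commutator \<Lambda> H (jw a) = (\<lambda>s s'. \<Sum>c\<in>M_row a. - of_real (M_matrix \<mu> \<gamma> \<nu> a c) * jw c s s')"
    by (intro ext) (simp add: jw_commutator[OF a] sum_negf)
  have "\<tau> t (op_commutator \<Lambda> H (jw a)) = (\<lambda>s s'. \<Sum>c\<in>M_row a. - of_real (M_matrix \<mu> \<gamma> \<nu> a c) * \<tau> t (jw c) s s')"
    unfolding c by (intro ext) (simp only: heisenberg_sum heisenberg_scale)
  then have e: "hs_inner \<Lambda> (jw b) (\<lambda>s s'. \<i> * \<tau> t (op_commutator \<Lambda> H (jw a)) s s')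
      = \<i> * (\<Sum>c\<in>M_row a. - of_real (M_matrix \<mu> \<gamma> \<nu> a c) * hs_inner \<Lambda> (jw b) (\<tau> t (jw c)))"
    by (simp only: hs_inner_scale_right hs_inner_sum_right)
  have "((\<lambda>t. hs_inner \<Lambda> (jw b) (\<tau> t (jw a))) has_vector_derivative
      hs_inner \<Lambda> (jw b) (\<lambda>s s'. \<i> * \<tau> t (op_commutator \<Lambda> H (jw a)) s s')) (at t)"
    by (intro hs_inner_const_derivative heisenberg_derivative(2))
  from has_vector_derivative_divide[OF this, of "of_real h"]
  show ?thesis unfolding G_def e
    by (simp add: sum_negf sum_divide_distrib sum_distrib_left)
qed

text \<open>The outer form: self-adjointness moves the commutator onto \<open>jw b\<close>, where
  \<open>jw_commutator\<close> applies. The matrix entries are real and so unaffected by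
  conjugation.\<close>

lemma G_derivative_right:
  assumes b: "m < site b" "site b < n"
  shows "((\<lambda>t. G t a b) has_vector_derivative - \<i> * (\<Sum>c\<in>M_row b. of_real (M_matrix \<mu> \<gamma> \<nu> b c) * G t a c)) (at t)"
proof -
  have c: "op_commutator \<Lambda> H (jw b) = (\<lambda>s s'. \<Sum>c\<in>M_row b. - of_real (M_matrix \<mu> \<gamma> \<nu> b c) * jw c s s')"
    by (intro ext) (simp add: jw_commutator[OF b] sum_negf)
  have "hs_inner \<Lambda> (op_commutator \<Lambda> H (jw b)) X
      = cnj (\<Sum>c\<in>M_row b. - of_real (M_matrix \<mu> \<gamma> \<nu> b c) * hs_inner \<Lambda> X (jw c))" for X
    unfolding c by (subst hs_inner_cnj[symmetric]) (simp only: hs_inner_scale_right hs_inner_sum_right)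
  then have d: "hs_inner \<Lambda> (op_commutator \<Lambda> H (jw b)) X
      = (\<Sum>c\<in>M_row b. - of_real (M_matrix \<mu> \<gamma> \<nu> b c) * hs_inner \<Lambda> (jw c) X)" for X
    by (simp add: hs_inner_cnj)
  have e: "hs_inner \<Lambda> (jw b) (\<lambda>s s'. \<i> * op_commutator \<Lambda> H (\<tau> t (jw a)) s s')
      = \<i> * (\<Sum>c\<in>M_row b. - of_real (M_matrix \<mu> \<gamma> \<nu> b c) * hs_inner \<Lambda> (jw c) (\<tau> t (jw a)))"
    by (simp only: hs_inner_scale_right hs_inner_commutator[OF H_hermitian] d)
  have "((\<lambda>t. hs_inner \<Lambda> (jw b) (\<tau> t (jw a))) has_vector_derivative
      hs_inner \<Lambda> (jw b) (\<lambda>s s'. \<i> * op_commutator \<Lambda> H (\<tau> t (jw a)) s s')) (at t)"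
    by (intro hs_inner_const_derivative heisenberg_derivative(1))
  from has_vector_derivative_divide[OF this, of "of_real h"]
  show ?thesis unfolding G_def e
    by (simp add: sum_negf sum_divide_distrib sum_distrib_left)
qed

text \<open>Bessel's inequality. The operators \<open>jw b\<close> occupy disjoint sets of matrix
  entries, so Cauchy-Schwarz for each of them can be summed against the total Hilbert-Schmidt norm,
  which stays \<open>h\<close> by conservation.\<close>

lemma G_Bessel:
  assumes F: "finite F" "\<And>b. b \<in> F \<Longrightarrow> site b \<in> \<Lambda>" and a: "site a \<in> \<Lambda>"
  shows "(\<Sum>b\<in>F. (cmod (G t a b))\<^sup>2) \<le> 1"
proof -
  let ?X = "\<tau> t (jw a)"
  let ?N = "\<Sum>s\<in>config \<Lambda>. \<Sum>s'\<in>config \<Lambda>. (cmod (?X s s'))\<^sup>2"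
  have "complex_of_real ?N = of_real h"
    using hs_inner_heisenberg_self[OF jw_spin_alg[OF a], of t] hs_inner_jw_jw[OF a a]
    by (simp only: hs_inner_self simp_thms if_True)
  then have N: "?N = h" by (simp only: of_real_eq_iff)
  have 1: "(cmod (hs_inner \<Lambda> (jw b) ?X))\<^sup>2 \<le> h * (\<Sum>s\<in>rows b. (cmod (?X s (flip (site b) s)))\<^sup>2)" if b: "b \<in> F" for b
  proof -
    have "cmod (hs_inner \<Lambda> (jw b) ?X) \<le> (\<Sum>s\<in>rows b. cmod (?X s (flip (site b) s)))"
      unfolding hs_inner_jw[OF F(2)[OF b]]
      by (rule sum_norm_le) (simp add: norm_mult abs_w)
    then have "(cmod (hs_inner \<Lambda> (jw b) ?X))\<^sup>2 \<le> (\<Sum>s\<in>rows b. cmod (?X s (flip (site b) s)))\<^sup>2"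
      by (rule power_mono) simp
    also have "\<dots> \<le> (\<Sum>s\<in>rows b. (cmod (?X s (flip (site b) s)))\<^sup>2) * real (card (rows b))"
      by (rule sum_squared_le_sum_of_squares)
    finally show ?thesis using card_rows[OF F(2)[OF b]] by (simp add: mult.commute)
  qed
  have "(\<Sum>b\<in>F. \<Sum>s\<in>rows b. (cmod (?X s (flip (site b) s)))\<^sup>2)
      = (\<Sum>(b, s)\<in>Sigma F rows. (cmod (?X s (flip (site b) s)))\<^sup>2)"
    by (rule sum.Sigma) (use F in auto)
  also have "\<dots> = (\<Sum>(s, s')\<in>(\<lambda>(b, s). (s, flip (site b) s)) ` Sigma F rows. (cmod (?X s s'))\<^sup>2)"
  proof -
    \<comment> \<open>The flipped spin determines the site, and the row then determines which of its
      two operators is meant.\<close>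
    have inj: "inj_on (\<lambda>(b, s). (s, flip (site b) s)) (Sigma F rows)"
    proof (rule inj_onI)
      fix x y assume xy: "x \<in> Sigma F rows" "y \<in> Sigma F rows"
        "(\<lambda>(b, s). (s, flip (site b) s)) x = (\<lambda>(b, s). (s, flip (site b) s)) y"
      obtain b s c s' where x: "x = (b, s)" and y: "y = (c, s')" by fastforce
      from xy have as: "s \<in> rows b" "s \<in> rows c" "flip (site b) s = flip (site c) s" and s: "s = s'"
        by (auto simp: x y)
      then have "site b = site c" by (simp add: flip_eq_iff)
      moreover from this as(1,2) have "block_index b = block_index c"
        by (simp add: rows_def neq_iff_swap2)
      ultimately show "x = y"
        using index_eqI s by (simp add: x y)
    qed
    show ?thesis by (subst sum.reindex[OF inj], rule sum.cong) auto
  qed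
  also have "\<dots> \<le> (\<Sum>(s, s')\<in>config \<Lambda> \<times> config \<Lambda>. (cmod (?X s s'))\<^sup>2)"
    by (rule sum_mono2) (use F(2) in \<open>auto simp: rows_def\<close>)
  also have "\<dots> = h" using N by (simp add: sum.cartesian_product)
  finally have 2: "(\<Sum>b\<in>F. \<Sum>s\<in>rows b. (cmod (?X s (flip (site b) s)))\<^sup>2) \<le> h" .
  have "(\<Sum>b\<in>F. (cmod (G t a b))\<^sup>2) = (\<Sum>b\<in>F. (cmod (hs_inner \<Lambda> (jw b) ?X))\<^sup>2) / h\<^sup>2"
    using h_pos by (simp add: G_def norm_divide power_divide sum_divide_distrib)
  also have "\<dots> \<le> (\<Sum>b\<in>F. h * (\<Sum>s\<in>rows b. (cmod (?X s (flip (site b) s)))\<^sup>2)) / h\<^sup>2"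
    by (intro divide_right_mono sum_mono 1) auto
  also have "\<dots> \<le> (h * h) / h\<^sup>2"
    unfolding sum_distrib_left[symmetric] using 2 h_pos by (intro divide_right_mono mult_left_mono) auto
  also have "\<dots> = 1" using h_pos by (simp add: power2_eq_square)
  finally show ?thesis .
qed

end

section \<open>Supports and operator norms\<close>

lemma vec_norm_zero: "vec_norm S (\<lambda>s. 0) = 0"
  by (simp add: vec_norm_def L2_set_def)

lemma op_norm_le:
  assumes "\<And>v. vec_norm S v \<le> 1 \<Longrightarrow> vec_norm S (op_apply S A v) \<le> B"
  shows "op_norm S A \<le> B"
  unfolding op_norm_def
proof (rule cSUP_least)
  have "(\<lambda>s. 0) \<in> {v. vec_norm S v \<le> 1}" by (simp add: vec_norm_zero)
  then show "{v. vec_norm S v \<le> 1} \<noteq> {}" by blast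
qed (use assms in auto)

lemma op_norm_upper:
  assumes S: "finite S" and v: "vec_norm S v \<le> 1"
  shows "vec_norm S (op_apply S A v) \<le> op_norm S A"
  unfolding op_norm_def
proof (rule cSUP_upper)
  show "bdd_above ((\<lambda>v. vec_norm S (op_apply S A v)) ` {v. vec_norm S v \<le> 1})"
  proof (rule bdd_aboveI2)
    fix v assume "v \<in> {v. vec_norm S v \<le> 1}"
    then have v: "cmod (v s') \<le> 1" if "s' \<in> config S" for s'
      using member_le_L2_set[OF finite_config[OF S] that, of "\<lambda>s. cmod (v s)"] by (simp add: vec_norm_def)
    have "vec_norm S (op_apply S A v) \<le> (\<Sum>s\<in>config S. cmod (op_apply S A v s))"
      unfolding vec_norm_def by (rule L2_set_le_sum) simp
    also have "\<dots> \<le> (\<Sum>s\<in>config S. \<Sum>s'\<in>config S. cmod (A s s'))"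
      unfolding op_apply_def
      by (intro sum_mono sum_norm_le) (simp add: norm_mult mult_left_le v)
    finally show "vec_norm S (op_apply S A v) \<le> (\<Sum>s\<in>config S. \<Sum>s'\<in>config S. cmod (A s s'))" .
  qed
qed (use v in simp)

lemma op_norm_nonneg: "finite S \<Longrightarrow> op_norm S A \<ge> 0"
  using op_norm_upper[of S "\<lambda>s. 0" A] by (simp add: vec_norm_zero op_apply_def)

text \<open>A single entry is a coordinate of the image of a basis vector.\<close>

lemma entry_le_op_norm:
  assumes S: "finite S" and s: "s \<in> config S" "s' \<in> config S"
  shows "cmod (A s s') \<le> op_norm S A"
proof -
  let ?v = "\<lambda>u. if u = s' then 1 else (0::complex)"
  have "vec_norm S ?v = 1"
    unfolding vec_norm_def L2_set_def using s S by (simp add: if_distrib[of cmod] if_distrib[of "\<lambda>x. x\<^sup>2"] cong: if_cong)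
  moreover have "op_apply S A ?v s = A s s'"
    unfolding op_apply_def using s S by (simp add: if_distrib[of "(*) _"] cong: if_cong)
  ultimately show ?thesis
    using op_norm_upper[OF S, of ?v A] member_le_L2_set[OF finite_config[OF S] s(1), of "\<lambda>s. cmod (op_apply S A ?v s)"]
    by (simp add: vec_norm_def)
qed

lemma op_norm_monomial_le_1:
  assumes S: "finite S" and f: "\<And>s. s \<in> config S \<Longrightarrow> f s \<in> config S" "\<And>s. f (f s) = s"
    and w: "\<And>s. cmod (w s) \<le> 1"
  shows "op_norm S (monomial_op S f w) \<le> 1"
proof (rule op_norm_le)
  fix v assume v: "vec_norm S v \<le> 1"
  have a: "op_apply S (monomial_op S f w) v s = w s * v (f s)" if s: "s \<in> config S" for s
  proof -
    have "op_apply S (monomial_op S f w) v s = (\<Sum>s'\<in>config S. if s' = f s then w s * v (f s) else 0)"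
      unfolding op_apply_def by (rule sum.cong) (use s in \<open>auto simp: monomial_op_def\<close>)
    then show ?thesis using S f(1)[OF s] by simp
  qed
  have "vec_norm S (op_apply S (monomial_op S f w) v) \<le> L2_set (\<lambda>s. cmod (v (f s))) (config S)"
    unfolding vec_norm_def
    by (rule L2_set_mono) (simp_all add: a norm_mult mult_left_le_one_le w)
  also have "\<dots> = vec_norm S v"
  proof -
    have "bij_betw f (config S) (config S)"
      by (rule bij_betw_byWitness[where f' = f]) (use f in auto)
    from sum.reindex_bij_betw[OF this, of "\<lambda>s. (cmod (v s))\<^sup>2"]
    show ?thesis by (simp add: vec_norm_def L2_set_def)
  qed
  finally show "vec_norm S (op_apply S (monomial_op S f w) v) \<le> 1" using v by simp
qed

text \<open>\<open>LEAST\<close> refers to inclusion, so \<open>S\<close> must lie inside every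
  other candidate. The last assumption says that no candidate can miss a site of
  \<open>S\<close>.\<close>

lemma op_supp_eqI:
  assumes "S \<subseteq> \<Lambda>" "A \<in> op_embed S \<Lambda> ` spin_alg S"
    and "\<And>k S' A'. k \<in> S \<Longrightarrow> k \<notin> S' \<Longrightarrow> A = op_embed S' \<Lambda> A' \<Longrightarrow> False"
  shows "op_supp \<Lambda> A = S"
  unfolding op_supp_def
proof (rule Least_equality)
  fix S' assume "S' \<subseteq> \<Lambda> \<and> A \<in> op_embed S' \<Lambda> ` spin_alg S'"
  then show "S \<subseteq> S'" using assms(3) by blast
qed (use assms in auto)

lemma restrict_config: "s \<in> config \<Lambda> \<Longrightarrow> S \<subseteq> \<Lambda> \<Longrightarrow> restrict s S \<in> config S"
  by (auto simp: config_def)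

text \<open>With \<open>op_embed_diag\<close>, a test for acting as the identity at
  \<open>k\<close>: entries are unchanged when the spin at \<open>k\<close> is flipped in row and
  column alike, and the operator never changes that spin.\<close>

lemma op_embed_flip:
  assumes "k \<in> \<Lambda>" "k \<notin> S"
  shows "op_embed S \<Lambda> A (flip k s) (flip k s') = op_embed S \<Lambda> A s s'"
proof -
  have "restrict (flip k s) S = restrict s S" for s
    using assms by (auto simp: flip_apply)
  moreover have "(\<forall>j\<in>\<Lambda> - S. flip k s j = flip k s' j) \<longleftrightarrow> (\<forall>j\<in>\<Lambda> - S. s j = s' j)"
  proof -
    have "swap2 (s k) = swap2 (s' k) \<longleftrightarrow> s k = s' k" by (metis swap2_swap2)
    then show ?thesis by (auto simp: flip_apply)
  qed
  ultimately show ?thesis using assms by (simp add: op_embed_def)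
qed

lemma op_embed_diag:
  assumes "k \<in> \<Lambda>" "k \<notin> S" "op_embed S \<Lambda> A s s' \<noteq> 0"
  shows "s k = s' k"
  using assms by (auto simp: op_embed_def split: if_splits)

lemma op_supp_site_z:
  assumes r: "r \<in> \<Lambda>"
  shows "op_supp \<Lambda> (site_op \<Lambda> r pauli_z) = {r}"
proof (rule op_supp_eqI)
  show "{r} \<subseteq> \<Lambda>" using r by simp
  have "site_op \<Lambda> r pauli_z = op_embed {r} \<Lambda> (site_op {r} r pauli_z)"
  proof (intro ext)
    fix s s'
    show "site_op \<Lambda> r pauli_z s s' = op_embed {r} \<Lambda> (site_op {r} r pauli_z) s s'"
      using restrict_config[of s \<Lambda> "{r}"] restrict_config[of s' \<Lambda> "{r}"] r
      by (auto simp: site_op_def op_embed_def)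
  qed
  moreover have "site_op {r} r pauli_z \<in> spin_alg {r}" by (auto simp: site_op_def spin_alg_def)
  ultimately show "site_op \<Lambda> r pauli_z \<in> op_embed {r} \<Lambda> ` spin_alg {r}" by blast
  fix k S' A' assume k: "k \<in> {r}" "k \<notin> S'" and A: "site_op \<Lambda> r pauli_z = op_embed S' \<Lambda> A'"
  obtain s where s: "s \<in> config \<Lambda>"
    using config_nonempty by blast
  have "site_op \<Lambda> r pauli_z (flip r s) (flip r s) = site_op \<Lambda> r pauli_z s s"
    unfolding A by (rule op_embed_flip) (use k r in auto)
  then have "zsign (s r) = 0" using s r by (simp add: site_op_pauli monomial_op_def flip_apply)
  then show False by (simp add: zsign_def split: if_splits)
qed

section \<open>Supports of the Jordan-Wigner operators and decay of their coefficients\<close>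

context xy_chain
begin

lemma w_restrict: "w a (restrict s {m..site a}) = w a s" if "m \<le> site a"
proof -
  have "(\<Prod>k\<in>{m..<site a}. zsign (restrict s {m..site a} k)) = (\<Prod>k\<in>{m..<site a}. zsign (s k))"
    by (rule prod.cong) auto
  then show ?thesis using that by (simp add: w_def)
qed

lemma w_flip_string:
  assumes "m \<le> k" "k < site a"
  shows "w a (flip k s) = - w a s"
proof -
  have k: "k \<in> {m..<site a}" using assms by simp
  have "(\<Prod>j\<in>{m..<site a} - {k}. zsign (flip k s j)) = (\<Prod>j\<in>{m..<site a} - {k}. zsign (s j))"
    by (rule prod.cong) (auto simp: flip_apply)
  then have "(\<Prod>j\<in>{m..<site a}. zsign (flip k s j)) = - (\<Prod>j\<in>{m..<site a}. zsign (s j))"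
    by (simp add: prod.remove[OF _ k] flip_apply)
  then show ?thesis using assms by (simp add: w_def flip_apply)
qed

text \<open>A string site is detected by the sign change under a simultaneous flip, the end point by
  the fact that the operator itself flips its spin.\<close>

lemma op_supp_jw:
  assumes a: "site a \<in> \<Lambda>"
  shows "op_supp \<Lambda> (jw a) = {m..site a}"
proof (rule op_supp_eqI)
  let ?S = "{m..site a}" and ?i = "site a"
  show sub: "?S \<subseteq> \<Lambda>" using a by auto
  let ?A = "monomial_op ?S (flip ?i) (\<lambda>s. of_real (w a s))"
  have "jw a = op_embed ?S \<Lambda> ?A"
  proof (intro ext)
    fix s s'
    show "jw a s s' = op_embed ?S \<Lambda> ?A s s'"
    proof (cases "s \<in> config \<Lambda> \<and> s' \<in> config \<Lambda>")
      case True
      have "s' = flip ?i s \<longleftrightarrow> (\<forall>j\<in>\<Lambda> - ?S. s j = s' j) \<and> restrict s' ?S = flip ?i (restrict s ?S)" (is "?l \<longleftrightarrow> ?r")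
      proof
        assume ?l
        then show ?r using a by (auto simp: flip_apply)
      next
        assume ?r
        then have r: "\<And>j. j \<in> \<Lambda> - ?S \<Longrightarrow> s j = s' j" and
          e: "\<And>j. restrict s' ?S j = flip ?i (restrict s ?S) j" by auto
        show ?l
        proof (rule config_eqI[of _ \<Lambda>])
          show "s' k = flip ?i s k" if "k \<in> \<Lambda>" for k
            using r[of k] e[of k] that a by (cases "k \<in> ?S") (auto simp: flip_apply split: if_splits)
        qed (use True a in auto)
      qed
      then show ?thesis
        using True restrict_config[of s \<Lambda> ?S] sub w_restrict[of a s] a
        by (auto simp: jw_def monomial_op_def op_embed_def)
    next
      case False
      then show ?thesis using spin_alg_zero[OF jw_spin_alg[OF a]] by (auto simp: op_embed_def)
    qed
  qed
  moreover have "?A \<in> spin_alg ?S" by (rule monomial_op_spin_alg) (use a in simp)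
  ultimately show "jw a \<in> op_embed ?S \<Lambda> ` spin_alg ?S" by blast
  fix k S' A' assume k: "k \<in> ?S" "k \<notin> S'" and A: "jw a = op_embed S' \<Lambda> A'"
  have k\<Lambda>: "k \<in> \<Lambda>" using k a by auto
  have "rows a \<noteq> {}" using card_rows[OF a] h_pos by auto
  then obtain s where s: "s \<in> rows a" by blast
  then have sc: "s \<in> config \<Lambda>" by (simp add: rows_def)
  have nz: "w a s \<noteq> 0" using abs_w[OF s] by auto
  have e: "jw a s (flip ?i s) = of_real (w a s)" using sc by (simp add: jw_def monomial_op_def)
  show False
  proof (cases "k = ?i")
    case True
    have "s k = flip ?i s k"
      by (rule op_embed_diag[OF k\<Lambda> k(2), of A']) (use e nz A in simp)
    then show False using True by (simp add: flip_apply)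
  next
    case False
    have "jw a (flip k s) (flip k (flip ?i s)) = jw a s (flip ?i s)"
      unfolding A by (rule op_embed_flip[OF k\<Lambda> k(2)])
    moreover have "jw a (flip k s) (flip k (flip ?i s)) = of_real (w a (flip k s))"
      using sc k\<Lambda> by (simp add: jw_def monomial_op_def flip_commute[of k])
    ultimately show False using nz e False k w_flip_string[of k a s] by simp
  qed
qed

text \<open>\<open>jw b\<close> sees only those entries of the evolved operator that flip the spin
  at \<open>site b\<close>. These reappear, with a larger modulus, as entries of the commutator with
  the Pauli matrix there, and are thus bounded by its norm.\<close>

lemma G_decay:
  assumes LR: "zero_velocity_LR \<mu> \<gamma> \<nu> C \<eta>" and C: "C > 0"
    and a: "m \<le> site a" and ab: "site a < site b" and b: "site b \<le> n"
  shows "cmod (G t a b) \<le> C * exp (- \<eta> * real_of_int (site b - site a))"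
proof -
  let ?l = "site a" and ?r = "site b" and ?Z = "site_op \<Lambda> (site b) pauli_z" and ?X = "\<tau> t (jw a)"
  let ?c = "op_commutator \<Lambda> ?X ?Z" and ?e = "exp (- \<eta> * real_of_int (site b - site a))"
  have in\<Lambda>: "?l \<in> \<Lambda>" "?r \<in> \<Lambda>" using a ab b by auto
  have Z: "?Z = monomial_op \<Lambda> (\<lambda>s. s) (\<lambda>s. of_real (zsign (s ?r)))"
    by (rule site_op_pauli(3)[OF in\<Lambda>(2)])
  have Zalg: "?Z \<in> spin_alg \<Lambda>" unfolding Z by (rule monomial_op_spin_alg)
  have supp: "op_supp \<Lambda> (jw a) = {m..?l}" "op_supp \<Lambda> ?Z = {?r}"
    by (rule op_supp_jw[OF in\<Lambda>(1)]) (rule op_supp_site_z[OF in\<Lambda>(2)])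
  have mx: "Max {m..?l} = ?l" using a by (intro Max_eqI) auto
  have dist: "set_distance {m..?l} {?r} = ?r - ?l"
    unfolding set_distance_def
  proof (rule Min_eqI)
    show "?r - ?l \<in> (\<lambda>(i, j). \<bar>i - j\<bar>) ` ({m..?l} \<times> {?r})"
      using a ab by (intro image_eqI[of _ _ "(?l, ?r)"]) auto
  qed (use ab in auto)
  have "op_norm \<Lambda> ?c \<le> C * op_norm \<Lambda> (jw a) * op_norm \<Lambda> ?Z * ?e"
    using LR[unfolded zero_velocity_LR_def, rule_format, OF jw_spin_alg[OF in\<Lambda>(1)] Zalg, of t]
    unfolding Let_def supp mx dist using a ab by simp
  also have "\<dots> \<le> C * 1 * 1 * ?e"
  proof -
    have "op_norm \<Lambda> (jw a) \<le> 1"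
      unfolding jw_def by (rule op_norm_monomial_le_1) (use in\<Lambda> in \<open>auto simp: abs_w_le\<close>)
    moreover have "op_norm \<Lambda> ?Z \<le> 1"
      unfolding Z by (rule op_norm_monomial_le_1) auto
    ultimately show ?thesis using C
      by (intro mult_mono mult_nonneg_nonneg op_norm_nonneg) auto
  qed
  finally have c: "op_norm \<Lambda> ?c \<le> C * ?e" by simp
  have X: "cmod (?X s (flip ?r s)) \<le> C * ?e" if s: "s \<in> rows b" for s
  proof -
    have sc: "s \<in> config \<Lambda>" "flip ?r s \<in> config \<Lambda>" using s in\<Lambda> by (auto simp: rows_def)
    have 1: "op_mult \<Lambda> ?X ?Z s (flip ?r s) = - of_real (zsign (s ?r)) * ?X s (flip ?r s)"
    proof -
      have "op_mult \<Lambda> ?X ?Z s (flip ?r s)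
          = (\<Sum>u\<in>config \<Lambda>. if u = flip ?r s then - of_real (zsign (s ?r)) * ?X s (flip ?r s) else 0)"
        unfolding op_mult_def Z by (rule sum.cong) (auto simp: monomial_op_def flip_apply)
      then show ?thesis using sc by simp
    qed
    have 2: "op_mult \<Lambda> ?Z ?X s (flip ?r s) = of_real (zsign (s ?r)) * ?X s (flip ?r s)"
    proof -
      have "op_mult \<Lambda> ?Z ?X s (flip ?r s)
          = (\<Sum>u\<in>config \<Lambda>. if u = s then of_real (zsign (s ?r)) * ?X s (flip ?r s) else 0)"
        unfolding op_mult_def Z by (rule sum.cong) (auto simp: monomial_op_def)
      then show ?thesis using sc by simp
    qed
    \<comment> \<open>The Pauli matrix has opposite signs on row and column, so the two products add
      up. Only modulus at least 1 of the resulting factor 2 is used.\<close>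
    have "?c s (flip ?r s) = - 2 * of_real (zsign (s ?r)) * ?X s (flip ?r s)"
      by (simp add: op_commutator_def 1 2)
    then have "cmod (?X s (flip ?r s)) \<le> cmod (?c s (flip ?r s))"
      by (simp add: norm_mult)
    also have "\<dots> \<le> op_norm \<Lambda> ?c" by (rule entry_le_op_norm) (use sc in auto)
    finally show ?thesis using c by simp
  qed
  \<comment> \<open>There are \<open>h\<close> rows with weights of modulus 1, and the normalization
    of \<open>G\<close> divides by \<open>h\<close>, so the bound keeps the constant
    \<open>C\<close>.\<close>
  have "cmod (hs_inner \<Lambda> (jw b) ?X) \<le> (\<Sum>s\<in>rows b. C * ?e)"
    unfolding hs_inner_jw[OF in\<Lambda>(2)]
    by (rule sum_norm_le) (use X in \<open>simp add: norm_mult abs_w\<close>)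
  also have "\<dots> = h * (C * ?e)" by (simp add: card_rows[OF in\<Lambda>(2)])
  finally show ?thesis
    unfolding G_def using h_pos by (simp add: norm_divide pos_divide_le_eq mult.commute)
qed

end

section \<open>The infinite-volume limit\<close>

text \<open>A cluster point \<open>x\<close> of \<open>f\<close> along \<open>F\<close> gives a
  nontrivial finer filter along which \<open>f\<close> converges to \<open>x\<close>.\<close>

lemma inf_filtercomap_neq_bot:
  assumes "inf (nhds x) (filtermap f F) \<noteq> bot"
  shows "inf F (filtercomap f (nhds x)) \<noteq> bot"
proof
  assume "inf F (filtercomap f (nhds x)) = bot"
  then have "eventually (\<lambda>_. False) (inf F (filtercomap f (nhds x)))" by simp
  then obtain P Q where P: "eventually P F" and Q: "eventually Q (filtercomap f (nhds x))"
    and PQ: "\<And>k. P k \<Longrightarrow> Q k \<Longrightarrow> False" unfolding eventually_inf by blast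
  from Q obtain R where R: "eventually R (nhds x)" "\<And>k. R (f k) \<Longrightarrow> Q k"
    unfolding eventually_filtercomap by blast
  have "eventually (\<lambda>y. \<not> R y) (filtermap f F)"
    unfolding eventually_filtermap using P by eventually_elim (use PQ R in blast)
  with R(1) have "eventually (\<lambda>_. False) (inf (nhds x) (filtermap f F))"
    unfolding eventually_inf by blast
  with assms show False by (simp add: trivial_limit_def)
qed

text \<open>Tychonoff for a product of closed unit discs. The index will include all real times, and
  a cluster point in an uncountable product need not be the limit of a subsequence; hence the
  filter.\<close>

lemma bounded_pointwise_cluster:
  fixes f :: "nat \<Rightarrow> 'a \<Rightarrow> complex"
  assumes "\<And>k p. cmod (f k p) \<le> 1"
  obtains u \<F> where "\<F> \<noteq> bot" "\<F> \<le> sequentially" "\<And>p. ((\<lambda>k. f k p) \<longlongrightarrow> u p) \<F>"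
proof -
  let ?K = "Pi\<^sub>E UNIV (\<lambda>_. cball 0 1) :: ('a \<Rightarrow> complex) set"
  have "compactin (product_topology (\<lambda>_. euclidean) UNIV) ?K"
    unfolding compactin_PiE by simp
  then have "compact ?K" by (simp add: euclidean_product_topology)
  moreover have "eventually (\<lambda>y. y \<in> ?K) (filtermap f sequentially)"
    using assms by (simp add: eventually_filtermap PiE_UNIV_domain)
  ultimately obtain u where u: "inf (nhds u) (filtermap f sequentially) \<noteq> bot"
    unfolding compact_filter by (metis filtermap_bot_iff sequentially_bot)
  let ?F = "inf sequentially (filtercomap f (nhds u))"
  have lim: "filterlim f (nhds u) ?F"
    by (rule filterlim_mono[OF filterlim_filtercomap order_refl]) simp
  have coord: "((\<lambda>y. y p) \<longlongrightarrow> u p) (nhds u)" for p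
  proof (rule topological_tendstoI)
    fix S :: "complex set" assume S: "open S" "u p \<in> S"
    have "open ((\<lambda>y. y p) -` S)"
      by (rule open_vimage[OF S(1) continuous_on_product_coordinates])
    then show "\<forall>\<^sub>F y in nhds u. y p \<in> S"
      unfolding eventually_nhds using S(2) by (intro exI[of _ "(\<lambda>y. y p) -` S"]) auto
  qed
  have "((\<lambda>k. f k p) \<longlongrightarrow> u p) ?F" for p
    by (rule filterlim_compose[OF coord lim])
  then show thesis using that[of ?F u] inf_filtercomap_neq_bot[OF u] by simp
qed

text \<open>A bound on the second derivatives makes the Taylor remainder uniform in \<open>k\<close>, so that
  pointwise convergence of the functions and of their derivatives suffices.\<close>

lemma has_vector_derivative_pointwise_limit:
  fixes f :: "nat \<Rightarrow> real \<Rightarrow> complex"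
  assumes \<F>: "\<F> \<noteq> bot"
    and d: "\<forall>\<^sub>F k in \<F>. \<forall>t. (f k has_vector_derivative f' k t) (at t) \<and>
      (f' k has_vector_derivative f'' k t) (at t) \<and> cmod (f'' k t) \<le> K"
    and f: "\<And>t. ((\<lambda>k. f k t) \<longlongrightarrow> g t) \<F>" and f': "\<And>t. ((\<lambda>k. f' k t) \<longlongrightarrow> g' t) \<F>"
  shows "(g has_vector_derivative g' t) (at t)"
proof -
  have b: "cmod (g (t + x) - g t - of_real x * g' t) \<le> K * \<bar>x\<bar> * \<bar>x\<bar>" for x
  proof (rule tendsto_upperbound[OF _ _ \<F>])
    show "((\<lambda>k. cmod (f k (t + x) - f k t - of_real x * f' k t)) \<longlongrightarrow>
        cmod (g (t + x) - g t - of_real x * g' t)) \<F>"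
      by (intro tendsto_intros f f')
    from d show "\<forall>\<^sub>F k in \<F>. cmod (f k (t + x) - f k t - of_real x * f' k t) \<le> K * \<bar>x\<bar> * \<bar>x\<bar>"
    proof eventually_elim
      case (elim k)
      \<comment> \<open>\<open>f k\<close> minus its tangent at \<open>t\<close>. The
        second-derivative bound controls its derivative by \<open>K * \<bar>x\<bar>\<close> on the
        segment, and a second use of the mean value inequality gives the quadratic bound.\<close>
      let ?p = "\<lambda>s. f k s - of_real s * f' k t"
      have "cmod (?p (t + x) - ?p t) \<le> (K * \<bar>x\<bar>) * \<bar>t + x - t\<bar>"
      proof (rule has_vector_derivative_bounded_increment)
        fix s assume s: "s \<in> closed_segment t (t + x)"
        show "(?p has_vector_derivative f' k s - f' k t) (at s)"
          using elim by (auto intro!: derivative_eq_intros)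
        have "cmod (f' k s - f' k t) \<le> K * \<bar>s - t\<bar>"
          by (rule has_vector_derivative_bounded_increment) (use elim in auto)
        also have "\<dots> \<le> K * \<bar>x\<bar>"
        proof (rule mult_left_mono)
          show "\<bar>s - t\<bar> \<le> \<bar>x\<bar>"
            using s by (auto simp: closed_segment_eq_real_ivl split: if_splits)
          show "0 \<le> K" using elim norm_ge_zero order_trans by blast
        qed
        finally show "cmod (f' k s - f' k t) \<le> K * \<bar>x\<bar>" .
      qed
      then show ?case by (simp add: algebra_simps)
    qed
  qed
  have "((\<lambda>x. (g (t + x) - g t) / of_real x - g' t) \<longlongrightarrow> 0) (at 0)"
  proof (rule Lim_null_comparison)
    have "cmod ((g (t + x) - g t) / of_real x - g' t) \<le> K * \<bar>x\<bar>" if "x \<noteq> 0" for x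
    proof -
      have "(g (t + x) - g t) / of_real x - g' t = (g (t + x) - g t - of_real x * g' t) / of_real x"
        using that by (simp add: field_simps)
      then have "cmod ((g (t + x) - g t) / of_real x - g' t) \<le> (K * \<bar>x\<bar> * \<bar>x\<bar>) / \<bar>x\<bar>"
        using divide_right_mono[OF b[of x], of "\<bar>x\<bar>"] by (simp add: norm_divide)
      then show ?thesis using that by simp
    qed
    then show "\<forall>\<^sub>F x in at 0. cmod ((g (t + x) - g t) / of_real x - g' t) \<le> K * \<bar>x\<bar>"
      by (auto simp: eventually_at_filter)
    show "((\<lambda>x. K * \<bar>x\<bar>) \<longlongrightarrow> 0) (at 0)" by (auto intro!: tendsto_eq_intros)
  qed
  then show ?thesis unfolding has_vector_derivative_iff_quotient by (simp only: LIM_zero_iff)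
qed

section \<open>Coefficients in growing boxes and their limit\<close>

text \<open>Extension by 0 gives all boxes a common index set, as the compactness argument
  requires.\<close>

definition G_box ::
  "(int \<Rightarrow> real) \<Rightarrow> (int \<Rightarrow> real) \<Rightarrow> (int \<Rightarrow> real) \<Rightarrow> nat \<Rightarrow> real \<Rightarrow> int \<Rightarrow> int \<Rightarrow> complex" where
  "G_box \<mu> \<gamma> \<nu> k t a b =
     (if \<bar>site a\<bar> \<le> int k \<and> \<bar>site b\<bar> \<le> int k then xy_chain.G \<mu> \<gamma> \<nu> (- int k) (int k) t a b else 0)"

lemma G_box_Bessel:
  assumes "finite F" shows "(\<Sum>b\<in>F. (cmod (G_box \<mu> \<gamma> \<nu> k t a b))\<^sup>2) \<le> 1"
proof (cases "\<bar>site a\<bar> \<le> int k")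
  case True
  let ?F = "{b \<in> F. \<bar>site b\<bar> \<le> int k}"
  have "(\<Sum>b\<in>F. (cmod (G_box \<mu> \<gamma> \<nu> k t a b))\<^sup>2)
      = (\<Sum>b\<in>?F. (cmod (xy_chain.G \<mu> \<gamma> \<nu> (- int k) (int k) t a b))\<^sup>2)"
    by (rule sum.mono_neutral_cong_right) (use assms True in \<open>auto simp: G_box_def\<close>)
  also have "\<dots> \<le> 1" by (rule xy_chain.G_Bessel) (use assms True in auto)
  finally show ?thesis .
qed (simp add: G_box_def)

lemma G_box_le_1: "cmod (G_box \<mu> \<gamma> \<nu> k t a b) \<le> 1"
  using G_box_Bessel[of "{b}" \<mu> \<gamma> \<nu> k t a] by (simp add: power_le_one_iff)

lemma site_M_row: "c \<in> M_row a \<Longrightarrow> \<bar>site c\<bar> \<le> \<bar>site a\<bar> + 1"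
  using index_cases[of c] by (auto simp: M_row_def)

text \<open>One site of margin keeps all of \<open>M_row a\<close> in the box and \<open>a\<close>
  in its interior. If \<open>b\<close> lies outside the box, both sides vanish.\<close>

lemma G_box_derivative_left:
  assumes k: "\<bar>site a\<bar> + 1 < int k"
  shows "((\<lambda>t. G_box \<mu> \<gamma> \<nu> k t a b) has_vector_derivative
    - \<i> * (\<Sum>c\<in>M_row a. of_real (M_matrix \<mu> \<gamma> \<nu> a c) * G_box \<mu> \<gamma> \<nu> k t c b)) (at t)"
proof (cases "\<bar>site b\<bar> \<le> int k")
  case True
  have 1: "G_box \<mu> \<gamma> \<nu> k t c b = xy_chain.G \<mu> \<gamma> \<nu> (- int k) (int k) t c b" if "c \<in> insert a (M_row a)" for c t
    using that True k site_M_row[of c a] by (auto simp: G_box_def)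
  have s: "(\<Sum>c\<in>M_row a. of_real (M_matrix \<mu> \<gamma> \<nu> a c) * G_box \<mu> \<gamma> \<nu> k t c b)
      = (\<Sum>c\<in>M_row a. of_real (M_matrix \<mu> \<gamma> \<nu> a c) * xy_chain.G \<mu> \<gamma> \<nu> (- int k) (int k) t c b)"
    by (rule sum.cong) (auto simp: 1)
  show ?thesis unfolding s 1[OF insertI1] by (rule xy_chain.G_derivative_left) (use k in auto)
qed (simp add: G_box_def)

lemma G_box_derivative_right:
  assumes k: "\<bar>site b\<bar> + 1 < int k"
  shows "((\<lambda>t. G_box \<mu> \<gamma> \<nu> k t a b) has_vector_derivative
    - \<i> * (\<Sum>c\<in>M_row b. of_real (M_matrix \<mu> \<gamma> \<nu> b c) * G_box \<mu> \<gamma> \<nu> k t a c)) (at t)"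
proof (cases "\<bar>site a\<bar> \<le> int k")
  case True
  have 1: "G_box \<mu> \<gamma> \<nu> k t a c = xy_chain.G \<mu> \<gamma> \<nu> (- int k) (int k) t a c" if "c \<in> insert b (M_row b)" for c t
    using that True k site_M_row[of c b] by (auto simp: G_box_def)
  have s: "(\<Sum>c\<in>M_row b. of_real (M_matrix \<mu> \<gamma> \<nu> b c) * G_box \<mu> \<gamma> \<nu> k t a c)
      = (\<Sum>c\<in>M_row b. of_real (M_matrix \<mu> \<gamma> \<nu> b c) * xy_chain.G \<mu> \<gamma> \<nu> (- int k) (int k) t a c)"
    by (rule sum.cong) (auto simp: 1)
  show ?thesis unfolding s 1[OF insertI1] by (rule xy_chain.G_derivative_right) (use k in auto)
qed (simp add: G_box_def)

lemma G_box_0: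
  assumes "\<bar>site a\<bar> \<le> int k" "\<bar>site b\<bar> \<le> int k"
  shows "G_box \<mu> \<gamma> \<nu> k 0 a b = \<delta> a b"
proof -
  have "xy_chain.G \<mu> \<gamma> \<nu> (- int k) (int k) 0 a b = \<delta> a b"
    by (rule xy_chain.G_0) (use assms in auto)
  then show ?thesis using assms by (simp add: G_box_def)
qed

lemma G_box_decay:
  assumes "zero_velocity_LR \<mu> \<gamma> \<nu> C \<eta>" "C > 0" "site a < site b"
  shows "cmod (G_box \<mu> \<gamma> \<nu> k t a b) \<le> C * exp (- \<eta> * real_of_int (site b - site a))"
proof (cases "\<bar>site a\<bar> \<le> int k \<and> \<bar>site b\<bar> \<le> int k")
  case True
  have "cmod (xy_chain.G \<mu> \<gamma> \<nu> (- int k) (int k) t a b) \<le> C * exp (- \<eta> * real_of_int (site b - site a))"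
    by (rule xy_chain.G_decay) (use assms True in auto)
  then show ?thesis using True by (simp add: G_box_def)
next
  case False
  then have "G_box \<mu> \<gamma> \<nu> k t a b = 0" by (simp only: G_box_def if_False)
  then show ?thesis using assms by simp
qed

lemma eventually_int_gt: "\<F> \<le> sequentially \<Longrightarrow> \<forall>\<^sub>F k in \<F>. x < int k"
  by (rule filter_leD) (auto intro!: eventually_sequentiallyI[of "nat x + 1"])

interpretation M: row_finite_symmetric "M_matrix \<mu> \<gamma> \<nu>" M_row for \<mu> \<gamma> \<nu>
  by standard (auto simp: M_matrix_zero M_row_def intro: M_matrix_sym)

lemma finite_M_row: "finite (M_row a)"
  by (simp add: M_row_def)

text \<open>The equation in the first index survives the limit through its derivatives, and
  comparison with the second identifies \<open>M.T\<close> of a row. The norm bound, the initial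
  value and the decay are closed conditions.\<close>

lemma infinite_volume_solutions:
  assumes LR: "zero_velocity_LR \<mu> \<gamma> \<nu> C \<eta>" and C: "C > 0"
  obtains r where "\<And>a. M.solution \<mu> \<gamma> \<nu> (r a)" "\<And>a. r a 0 = \<delta> a"
    "\<And>a b t. site a < site b \<Longrightarrow> cmod (r a t b) \<le> C * exp (- \<eta> * real_of_int (site b - site a))"
proof -
  let ?M = "M_matrix \<mu> \<gamma> \<nu>" and ?G = "G_box \<mu> \<gamma> \<nu>"
  obtain u \<F> where \<F>: "\<F> \<noteq> bot" "\<F> \<le> sequentially"
    and "\<And>p. ((\<lambda>k. (\<lambda>(t, a, b). ?G k t a b) p) \<longlongrightarrow> u p) \<F>"
    by (rule bounded_pointwise_cluster[of "\<lambda>k (t, a, b). ?G k t a b"]) (auto simp: G_box_le_1)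
  from this(3)[of "(t, a, b)" for t a b]
  have lim0: "((\<lambda>k. ?G k t a b) \<longlongrightarrow> u (t, a, b)) \<F>" for t a b by simp
  define r where "r = (\<lambda>a t b. u (t, a, b))"
  have lim: "((\<lambda>k. ?G k t a b) \<longlongrightarrow> r a t b) \<F>" for t a b
    using lim0 by (simp add: r_def)
  note ev = eventually_int_gt[OF \<F>(2)]
  have r2: "r a t \<in> ell2" "ell2_norm (r a t) \<le> 1" for a t
  proof -
    have "cmod2_sum (r a t) F \<le> 1\<^sup>2" if "finite F" for F
    proof (rule tendsto_upperbound[OF _ _ \<F>(1)])
      show "((\<lambda>k. \<Sum>b\<in>F. (cmod (?G k t a b))\<^sup>2) \<longlongrightarrow> cmod2_sum (r a t) F) \<F>"
        by (intro tendsto_intros lim)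
    qed (simp add: G_box_Bessel[OF that])
    from ell2_boundI[OF _ this] show "r a t \<in> ell2" "ell2_norm (r a t) \<le> 1" by auto
  qed
  have deriv: "((\<lambda>t. r a t b) has_vector_derivative - \<i> * (\<Sum>c\<in>M_row a. of_real (?M a c) * r c t b)) (at t)" for a b t
  proof (rule has_vector_derivative_pointwise_limit[OF \<F>(1)])
    let ?f'' = "\<lambda>k t. - \<i> * (\<Sum>c\<in>M_row a. of_real (?M a c) * (- \<i> * (\<Sum>d\<in>M_row c. of_real (?M c d) * ?G k t d b)))"
    \<comment> \<open>The equation applied twice, with every coefficient bounded by 1; the bound
      depends on neither \<open>k\<close> nor \<open>t\<close>.\<close>
    let ?K = "\<Sum>c\<in>M_row a. \<bar>?M a c\<bar> * (\<Sum>d\<in>M_row c. \<bar>?M c d\<bar>)"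
    show "\<forall>\<^sub>F k in \<F>. \<forall>t. ((\<lambda>t. ?G k t a b) has_vector_derivative
          - \<i> * (\<Sum>c\<in>M_row a. of_real (?M a c) * ?G k t c b)) (at t) \<and>
        ((\<lambda>t. - \<i> * (\<Sum>c\<in>M_row a. of_real (?M a c) * ?G k t c b)) has_vector_derivative ?f'' k t) (at t) \<and>
        cmod (?f'' k t) \<le> ?K"
      \<comment> \<open>A margin of two sites: the equation is used at \<open>a\<close> and then at
        each of its neighbours.\<close>
      using ev[of "\<bar>site a\<bar> + 2"]
    proof eventually_elim
      case (elim k)
      have 1: "((\<lambda>t. ?G k t c b) has_vector_derivative
          - \<i> * (\<Sum>d\<in>M_row c. of_real (?M c d) * ?G k t d b)) (at t)" if "c \<in> insert a (M_row a)" for c t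
        by (rule G_box_derivative_left) (use that elim site_M_row[of c a] in auto)
      have 2: "cmod (?f'' k t) \<le> ?K" for t
      proof -
        have "cmod (\<Sum>c\<in>M_row a. of_real (?M a c) * (- \<i> * (\<Sum>d\<in>M_row c. of_real (?M c d) * ?G k t d b))) \<le> ?K"
        proof (rule sum_norm_le)
          fix c
          have "cmod (\<Sum>d\<in>M_row c. of_real (?M c d) * ?G k t d b) \<le> (\<Sum>d\<in>M_row c. \<bar>?M c d\<bar>)"
            by (rule sum_norm_le) (simp add: norm_mult mult_left_le G_box_le_1)
          then show "cmod (of_real (?M a c) * (- \<i> * (\<Sum>d\<in>M_row c. of_real (?M c d) * ?G k t d b)))
              \<le> \<bar>?M a c\<bar> * (\<Sum>d\<in>M_row c. \<bar>?M c d\<bar>)"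
            by (simp add: norm_mult mult_left_mono)
        qed
        then show ?thesis by (simp add: norm_mult)
      qed
      have "((\<lambda>t. - \<i> * (\<Sum>c\<in>M_row a. of_real (?M a c) * ?G k t c b)) has_vector_derivative ?f'' k t) (at t)" for t
        by (intro has_vector_derivative_mult_right has_vector_derivative_sum 1) simp
      with 1[OF insertI1] 2 show ?case by blast
    qed
  qed (intro tendsto_intros lim)+
  \<comment> \<open>In a large box both equations give the derivative of the same entry, so their
    right-hand sides agree. In the limit \<open>M.T\<close> of row \<open>a\<close> is a finite
    combination of rows, hence in \<open>ell2\<close>.\<close>
  have sym: "M.T \<mu> \<gamma> \<nu> (r a t) = (\<lambda>b. \<Sum>c\<in>M_row a. of_real (?M a c) * r c t b)" for a t
  proof
    fix b
    have "((\<lambda>k. - \<i> * (\<Sum>c\<in>M_row a. of_real (?M a c) * ?G k t c b)) \<longlongrightarrow>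
        - \<i> * (\<Sum>c\<in>M_row a. of_real (?M a c) * r c t b)) \<F>"
      by (intro tendsto_intros lim)
    moreover have "\<forall>\<^sub>F k in \<F>. - \<i> * (\<Sum>c\<in>M_row a. of_real (?M a c) * ?G k t c b)
        = - \<i> * (\<Sum>c\<in>M_row b. of_real (?M b c) * ?G k t a c)"
      using ev[of "\<bar>site a\<bar> + 1"] ev[of "\<bar>site b\<bar> + 1"]
    proof eventually_elim
      case (elim k)
      show ?case
        by (rule vector_derivative_unique_at[OF G_box_derivative_left[OF elim(1)] G_box_derivative_right[OF elim(2)]])
    qed
    ultimately have "((\<lambda>k. - \<i> * (\<Sum>c\<in>M_row b. of_real (?M b c) * ?G k t a c)) \<longlongrightarrow>
        - \<i> * (\<Sum>c\<in>M_row a. of_real (?M a c) * r c t b)) \<F>"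
      by (rule Lim_transform_eventually)
    moreover have "((\<lambda>k. - \<i> * (\<Sum>c\<in>M_row b. of_real (?M b c) * ?G k t a c)) \<longlongrightarrow>
        - \<i> * (\<Sum>c\<in>M_row b. of_real (?M b c) * r a t c)) \<F>"
      by (intro tendsto_intros lim)
    ultimately have "- \<i> * (\<Sum>c\<in>M_row b. of_real (?M b c) * r a t c) = - \<i> * (\<Sum>c\<in>M_row a. of_real (?M a c) * r c t b)"
      using tendsto_unique[OF \<F>(1)] by blast
    then show "M.T \<mu> \<gamma> \<nu> (r a t) b = (\<Sum>c\<in>M_row a. of_real (?M a c) * r c t b)"
      by (simp add: M.T_finite_sum)
  qed
  show thesis
  proof
    fix a
    show "M.solution \<mu> \<gamma> \<nu> (r a)"
      unfolding M.solution_def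
    \<comment> \<open>The sum of the moduli in row \<open>a\<close> of the matrix serves as the
      bound, each row \<open>r c t\<close> having norm at most 1.\<close>
    proof (intro exI[of _ "\<Sum>c\<in>M_row a. \<bar>?M a c\<bar>"] allI conjI)
      fix t k
      note s = ell2_sum[OF finite_M_row[of a] ell2_scale(1)[OF r2(1)], of "\<lambda>c. of_real (?M a c)" "\<lambda>c. c" "\<lambda>_. t"]
      show "r a t \<in> M.D \<mu> \<gamma> \<nu>" using r2(1) s(1) by (simp add: M.D_def sym)
      have "(\<Sum>c\<in>M_row a. ell2_norm (\<lambda>k. of_real (?M a c) * r c t k)) \<le> (\<Sum>c\<in>M_row a. \<bar>?M a c\<bar>)"
      proof (rule sum_mono)
        fix c
        have "ell2_norm (\<lambda>k. of_real (?M a c) * r c t k) \<le> \<bar>?M a c\<bar> * ell2_norm (r c t)"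
          using ell2_scale(2)[OF r2(1), of "of_real (?M a c)" c t] by simp
        also have "\<dots> \<le> \<bar>?M a c\<bar>" using r2(2) by (simp add: mult_left_le)
        finally show "ell2_norm (\<lambda>k. of_real (?M a c) * r c t k) \<le> \<bar>?M a c\<bar>" .
      qed
      with s(2) show "ell2_norm (M.T \<mu> \<gamma> \<nu> (r a t)) \<le> (\<Sum>c\<in>M_row a. \<bar>?M a c\<bar>)"
        unfolding sym by linarith
      show "((\<lambda>s. r a s k) has_vector_derivative - \<i> * M.T \<mu> \<gamma> \<nu> (r a t) k) (at t)"
        unfolding sym by (rule deriv)
    qed
    show "r a 0 = \<delta> a"
    proof
      fix b
      have "\<forall>\<^sub>F k in \<F>. ?G k 0 a b = \<delta> a b"
        using ev[of "\<bar>site a\<bar>"] ev[of "\<bar>site b\<bar>"] by eventually_elim (simp add: G_box_0)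
      then have "((\<lambda>k. ?G k 0 a b) \<longlongrightarrow> \<delta> a b) \<F>" by (rule tendsto_eventually)
      then show "r a 0 b = \<delta> a b" using tendsto_unique[OF \<F>(1) lim] by blast
    qed
    fix b t assume "site a < site b"
    then show "cmod (r a t b) \<le> C * exp (- \<eta> * real_of_int (site b - site a))"
      by (intro tendsto_upperbound[OF tendsto_norm[OF lim] _ \<F>(1)] always_eventually allI G_box_decay LR C)
  qed
qed

theorem theorem1p5:
  fixes \<mu> \<gamma> \<nu> :: "int \<Rightarrow> real" and C \<eta> :: real
  assumes mu_nonzero: "\<forall>j. \<mu> j \<noteq> 0"
    and C_pos: "C > 0" and eta_pos: "\<eta> > 0"
    and M_self_adjoint: "self_adjoint (M_dom \<mu> \<gamma> \<nu>) (M_op \<mu> \<gamma> \<nu>)"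
    and LR: "zero_velocity_LR \<mu> \<gamma> \<nu> C \<eta>"
  shows "uniform_dynamical_localization \<mu> \<gamma> \<nu> C \<eta>"
proof -
  obtain r where r: "\<And>a. M.solution \<mu> \<gamma> \<nu> (r a)" "\<And>a. r a 0 = \<delta> a"
    and decay: "\<And>a b t. site a < site b \<Longrightarrow> cmod (r a t b) \<le> C * exp (- \<eta> * real_of_int (site b - site a))"
    using infinite_volume_solutions[OF LR C_pos] by blast
  have T: "M.T \<mu> \<gamma> \<nu> = M_op \<mu> \<gamma> \<nu>" by (intro ext) (simp add: M.T_def M_op_def)
  have D: "M.D \<mu> \<gamma> \<nu> = M_dom \<mu> \<gamma> \<nu>" by (simp add: M.D_def M_dom_def T)
  interpret fundamental_solutions "M_matrix \<mu> \<gamma> \<nu>" M_row r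
  proof
    fix \<phi> \<psi> assume "\<phi> \<in> M.D \<mu> \<gamma> \<nu>" "\<psi> \<in> M.D \<mu> \<gamma> \<nu>"
    then show "ell2_inner \<phi> (M.T \<mu> \<gamma> \<nu> \<psi>) = ell2_inner (M.T \<mu> \<gamma> \<nu> \<phi>) \<psi>"
      using M_self_adjoint unfolding self_adjoint_def D T by blast
  qed (fact r)+
  have "exp_group (M_dom \<mu> \<gamma> \<nu>) (M_op \<mu> \<gamma> \<nu>) = (SOME U. M.generates \<mu> \<gamma> \<nu> U)"
    unfolding exp_group_def M.generates_def D T ..
  \<comment> \<open>\<open>W\<close> witnesses existence, so the chosen group is generated by M as
    well, and \<open>generates_entry\<close> computes its entries.\<close>
  moreover have "M.generates \<mu> \<gamma> \<nu> (SOME U. M.generates \<mu> \<gamma> \<nu> U)"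
    by (rule someI[of "M.generates \<mu> \<gamma> \<nu>", OF W_generates])
  ultimately have entry: "M_entry \<mu> \<gamma> \<nu> t a b = cnj (r a (- t) b)" for t a b
    using generates_entry[of "exp_group (M_dom \<mu> \<gamma> \<nu>) (M_op \<mu> \<gamma> \<nu>)" t b a]
    by (simp add: M_entry_def)
  show ?thesis
    unfolding uniform_dynamical_localization_def
  proof (intro allI impI ballI SUP_least)
    fix l k a b :: int and t :: real
    assume "l < k" "a \<in> {2*l-1, 2*l}" "b \<in> {2*k-1, 2*k}"
    then have "site a = l" "site b = k" "site a < site b" by auto
    with decay[of a b "- t"]
    show "ereal (cmod (M_entry \<mu> \<gamma> \<nu> t a b)) \<le> ereal (C * exp (- \<eta> * real_of_int (k - l)))"
      by (simp add: entry)
  qed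
qed

end
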